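(* Let $\{S_k; k\ge 1\}$ be a sequence of positive random variables. Suppose there exist, on the same probability space, a standard Wiener process $\{W(t); t\ge 0\}$ and two positive constants $\mu$ and $\sigma$ such that $$S_n-n\mu-\sigma W(n)=o\big(\sqrt{n\log\log n}\big)\quad\text{a.s.}$$ Let $\gamma=\mu/\sigma$ and let $$\mathcal F=\left\{f(t)=\int_0^t f'(u)\,du:\ f(0)=0,\ \int_0^1 (f'(u))^2\,du\le 1\right\}$$ be the set of continuous functions on $[0,1]$ which are absolutely continuous (with respect to Lebesgue measure) with derivative in the unit ball of $L_2[0,1]$. Then with probability one the sequence of functions $$\left\{\Big(\prod_{k=1}^{[nt]}\frac{S_k}{k\mu}\Big)^{\gamma/\sqrt{2n\log\log n}};\ 0\le t\le 1\right\}_{n=3}^{\infty}$$ is relatively compact, and its set of limit points is $$\left\{ x\mapsto \exp\Big\{\int_0^x\frac{f(u)}{u}\,du\Big\},\ 0\le x\le 1:\ f\in\mathcal F\right\}.$$ In particular, $$\limsup_{n\to\infty}\left(\prod_{k=1}^n\frac{S_k}{k\mu}\right)^{\gamma/\sqrt{2n\log\log n}}=e^{\sqrt2}\quad\text{a.s.}$$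
   Context: $[x]$ denotes the integer part of $x$; an empty product equals $1$. Relative compactness and limit points refer to functions on $[0,1]$ with the topology of uniform convergence (supremum norm), as in Strassen's functional law of the iterated logarithm. *)

theory Defs
  imports "HOL-Probability.Probability" "HOL-Library.Landau_Symbols"
begin

definition standard_wiener :: "'a measure \<Rightarrow> (real \<Rightarrow> 'a \<Rightarrow> real) \<Rightarrow> bool" where
  "standard_wiener M W \<longleftrightarrow>
     prob_space M \<and>
     (\<forall>t\<ge>0. W t \<in> borel_measurable M) \<and>
     (AE \<omega> in M. W 0 \<omega> = 0) \<and>
     (AE \<omega> in M. continuous_on {0..} (\<lambda>t. W t \<omega>)) \<and>
     (\<forall>s t. 0 \<le> s \<and> s < t \<longrightarrow>
        distributed M lborel (\<lambda>\<omega>. W t \<omega> - W s \<omega>) (normal_density 0 (sqrt (t - s)))) \<and>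
     (\<forall>(ts::nat \<Rightarrow> real) n. 0 \<le> ts 0 \<and> (\<forall>i<n. ts i < ts (Suc i)) \<longrightarrow>
        prob_space.indep_vars M (\<lambda>_. borel) (\<lambda>i \<omega>. W (ts (Suc i)) \<omega> - W (ts i) \<omega>) {..<n})"

definition strassen_class :: "(real \<Rightarrow> real) set" where
  "strassen_class = {f. \<exists>f'. set_borel_measurable lborel {0..1} f' \<and>
       set_integrable lborel {0..1} (\<lambda>u. (f' u)\<^sup>2) \<and>
       (LINT u:{0..1}|lborel. (f' u)\<^sup>2) \<le> 1 \<and>
       (\<forall>t\<in>{0..1}. f t = (LINT u:{0..t}|lborel. f' u))}"

text \<open>The normalized product functions, indexed from n = 3 (i.e. m \<mapsto> n = m + 3).\<close>
definition prod_fun :: "real \<Rightarrow> real \<Rightarrow> (nat \<Rightarrow> real) \<Rightarrow> nat \<Rightarrow> real \<Rightarrow> real" where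
  "prod_fun \<mu> \<gamma> s n t =
     (\<Prod>k\<in>{1..nat \<lfloor>real n * t\<rfloor>}. s k / (real k * \<mu>))
       powr (\<gamma> / sqrt (2 * real n * ln (ln (real n))))"

definition rel_compact_seq :: "(nat \<Rightarrow> real \<Rightarrow> real) \<Rightarrow> bool" where
  "rel_compact_seq g \<longleftrightarrow> (\<forall>r::nat\<Rightarrow>nat. strict_mono r \<longrightarrow>
     (\<exists>(q::nat\<Rightarrow>nat) h. strict_mono q \<and> uniform_limit {0..1} (\<lambda>n. g (r (q n))) h sequentially))"

definition limit_points :: "(nat \<Rightarrow> real \<Rightarrow> real) \<Rightarrow> (real \<Rightarrow> real) set" where
  "limit_points g = {restrict h {0..1} | h. \<exists>r::nat\<Rightarrow>nat. strict_mono r \<and>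
      uniform_limit {0..1} (\<lambda>n. g (r n)) h sequentially}"

end

theory Submission
  imports Defs "HOL-Real_Asymp.Real_Asymp" "HOL-Complex_Analysis.Great_Picard"
begin

text \<open>
  Only the values of the Wiener process at the integers matter, that is, a random walk with
  standard normal steps. Strassen's law of the iterated logarithm for this walk is reduced to
  one-dimensional statements about linear combinations of its block increments:

  \<^item> Compactness comes from a chaining bound over dyadic increments, which needs Gaussian tails
    and a union bound but no maximal inequality.

  \<^item> If all rational combinations satisfy the one-dimensional upper bound, then every limit
    point has energy at most 1 on every grid, hence lies in the Strassen class.

  \<^item> Conversely, if a combination with unit coefficient vector nearly attains its upper bound
    along a subsequence, then by strict convexity of the energy ball the limit point is close
    to the function with these slopes; and functions of unit energy are uniformly dense in the
    Strassen class.

  The logarithm of the product is, up to a uniformly small error, the sum over the integers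
  k up to nt of W(k)/k divided by the normalisation, and this converges to the integral of f(u)/u
  by dominated convergence, since |f(u)| is at most the square root of u. The supremum of this
  integral at 1 is the L2-norm of the function -ln.
\<close>

section \<open>Gaussian tails and the second Borel--Cantelli lemma\<close>

text \<open>Only countably many almost sure events can be intersected, whereas the tests run over
  all coefficient vectors and all tolerances. Hence coefficients are lists of rationals and
  tolerances are \<open>1 / real (Suc q)\<close>. Once the null sets are discarded, the locales
  \<open>strassen_path\<close> and \<open>strassen_product\<close> argue about one fixed path and
  contain no probability. The two one-dimensional bounds need different scales. The upper bound has
  to reach every n, so its scales have ratio tending to 1 and equicontinuity fills the gaps between
  them. The lower bound needs independence for the second Borel-Cantelli lemma, so its scales are
  the powers of m and the first coefficient vanishes, which leaves disjoint windows of steps. The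
  weights 1/k in the logarithm of the product sum to about ln n. Uniform closeness of the rescaled
  walk to its limit therefore does not control the weighted sums by itself; a growth bound of order
  sqrt k, uniform in k, tames the contribution near 0.\<close>

lemma (in prob_space) std_normal_tail_le:
  assumes X: "distributed M lborel X std_normal_density" and x: "0 \<le> x"
  shows "prob {\<omega>\<in>space M. x \<le> X \<omega>} \<le> exp (- x\<^sup>2 / 2)"
proof -
  \<comment> \<open>For x, z \<ge> 0 the inequality (x + z)^2 \<ge> x^2 + z^2 splits the factor exp
    (- x^2 / 2) off the shifted density. The form \<open>x + 1 * z\<close> is the one produced by
    \<open>nn_integral_real_affine\<close>.\<close>
  have dens: "std_normal_density (x + 1 * z) * indicator {x..} (x + 1 * z)
      \<le> exp (- x\<^sup>2 / 2) * std_normal_density z" for z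
  proof (cases "z \<ge> 0")
    case True
    then have "- (x + z)\<^sup>2 / 2 \<le> - x\<^sup>2 / 2 + - z\<^sup>2 / 2"
      using x by (simp add: power2_sum)
    then have "exp (- (x + z)\<^sup>2 / 2) \<le> exp (- x\<^sup>2 / 2) * exp (- z\<^sup>2 / 2)"
      by (simp only: exp_le_cancel_iff flip: exp_add)
    then have "1 / sqrt (2 * pi) * exp (- (x + z)\<^sup>2 / 2)
        \<le> 1 / sqrt (2 * pi) * (exp (- x\<^sup>2 / 2) * exp (- z\<^sup>2 / 2))"
      by (intro mult_left_mono) auto
    with True show ?thesis
      by (simp add: std_normal_density_def algebra_simps)
  qed (auto simp: indicator_def)
  have "{\<omega>\<in>space M. x \<le> X \<omega>} = X -` {x..} \<inter> space M" by auto
  then have "emeasure M {\<omega>\<in>space M. x \<le> X \<omega>}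
      = (\<integral>\<^sup>+y. ennreal (std_normal_density y) * indicator {x..} y \<partial>lborel)"
    using distributed_emeasure[OF X, of "{x..}"] by simp
  also have "\<dots> = (\<integral>\<^sup>+y. ennreal (std_normal_density y * indicator {x..} y) \<partial>lborel)"
    by (intro nn_integral_cong) (auto simp: indicator_def)
  also have "\<dots> = (\<integral>\<^sup>+z. ennreal (std_normal_density (x + 1 * z) * indicator {x..} (x + 1 * z)) \<partial>lborel)"
    by (subst nn_integral_real_affine[where c=1 and t=x]) auto
  also have "\<dots> \<le> (\<integral>\<^sup>+z. ennreal (exp (- x\<^sup>2 / 2) * std_normal_density z) \<partial>lborel)"
    by (intro nn_integral_mono ennreal_leI dens)
  also have "\<dots> = ennreal (\<integral>z. exp (- x\<^sup>2 / 2) * std_normal_density z \<partial>lborel)"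
    by (rule nn_integral_eq_integral) (auto intro!: integrable_mult_right)
  also have "\<dots> = ennreal (exp (- x\<^sup>2 / 2))"
    by simp
  finally show ?thesis
    by (simp add: emeasure_eq_measure)
qed

text \<open>The tail contains an interval of length 1, on which the density is at least its value at
  x + 1. The shift by 1 is of lower order and is later absorbed into a factor 1 -
  \<epsilon>.\<close>

lemma (in prob_space) std_normal_tail_ge:
  assumes X: "distributed M lborel X std_normal_density" and x: "0 \<le> x"
  shows "exp (- (x + 1)\<^sup>2 / 2) / sqrt (2 * pi) \<le> prob {\<omega>\<in>space M. x \<le> X \<omega>}"
proof -
  define K where "K = exp (- (x + 1)\<^sup>2 / 2) / sqrt (2 * pi)"
  have dens: "K * indicator {x..x+1} y \<le> std_normal_density y * indicator {x..} y" for y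
  proof (cases "y \<in> {x..x+1}")
    case True
    then have "y\<^sup>2 \<le> (x + 1)\<^sup>2"
      using x by (intro power_mono) auto
    then have "K \<le> std_normal_density y"
      by (simp add: K_def std_normal_density_def divide_simps)
    with True show ?thesis by (simp add: indicator_def)
  qed (auto simp: indicator_def)
  have K: "K \<ge> 0" by (simp add: K_def)
  have "ennreal K = ennreal K * emeasure lborel {x..x+1}"
    by simp
  also have "\<dots> = (\<integral>\<^sup>+y. ennreal K * indicator {x..x+1} y \<partial>lborel)"
    by (subst nn_integral_cmult_indicator) auto
  also have "\<dots> = (\<integral>\<^sup>+y. ennreal (K * indicator {x..x+1} y) \<partial>lborel)"
    by (intro nn_integral_cong) (auto simp: indicator_def)
  also have "\<dots> \<le> (\<integral>\<^sup>+y. ennreal (std_normal_density y * indicator {x..} y) \<partial>lborel)"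
    by (intro nn_integral_mono ennreal_leI dens)
  also have "\<dots> = (\<integral>\<^sup>+y. ennreal (std_normal_density y) * indicator {x..} y \<partial>lborel)"
    by (intro nn_integral_cong) (auto simp: indicator_def)
  also have "\<dots> = emeasure M (X -` {x..} \<inter> space M)"
    using distributed_emeasure[OF X, of "{x..}"] by simp
  also have "X -` {x..} \<inter> space M = {\<omega>\<in>space M. x \<le> X \<omega>}" by auto
  finally show ?thesis
    using K by (simp add: emeasure_eq_measure K_def)
qed

lemma (in prob_space) normal_tail_ge:
  assumes X: "distributed M lborel X (normal_density 0 s)" and s: "0 < s" and x: "0 \<le> x"
  shows "exp (- (x / s + 1)\<^sup>2 / 2) / sqrt (2 * pi) \<le> prob {\<omega>\<in>space M. x \<le> X \<omega>}"
proof -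
  have "distributed M lborel (\<lambda>\<omega>. X \<omega> / s) std_normal_density"
    using X normal_standard_normal_convert[OF s, of X 0] by simp
  from std_normal_tail_ge[OF this, of "x / s"] show ?thesis
    using s x by (simp add: divide_le_cancel)
qed

lemma (in prob_space) normal_abs_tail_le:
  assumes X: "distributed M lborel X (normal_density 0 s)" and s: "0 < s" and x: "0 \<le> x"
  shows "prob {\<omega>\<in>space M. x \<le> \<bar>X \<omega>\<bar>} \<le> 2 * exp (- x\<^sup>2 / (2 * s\<^sup>2))"
proof -
  have [measurable]: "X \<in> borel_measurable M"
    using X by (auto simp: distributed_def)
  have std: "distributed M lborel (\<lambda>\<omega>. X \<omega> / s) std_normal_density"
    using X normal_standard_normal_convert[OF s, of X 0] by simp
  have neg: "distributed M lborel (\<lambda>\<omega>. - X \<omega> / s) std_normal_density"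
    using normal_density_affine[OF std, of "-1" 0] by simp
  have e: "- (x / s)\<^sup>2 / 2 = - x\<^sup>2 / (2 * s\<^sup>2)"
    by (simp add: power_divide)
  have "{\<omega>\<in>space M. x \<le> \<bar>X \<omega>\<bar>} = {\<omega>\<in>space M. x / s \<le> X \<omega> / s} \<union> {\<omega>\<in>space M. x / s \<le> - X \<omega> / s}"
    using s by (auto simp: divide_le_cancel simp flip: minus_divide_left)
       (auto simp: field_simps)
  then have "prob {\<omega>\<in>space M. x \<le> \<bar>X \<omega>\<bar>}
      \<le> prob {\<omega>\<in>space M. x / s \<le> X \<omega> / s} + prob {\<omega>\<in>space M. x / s \<le> - X \<omega> / s}"
    by (simp only:) (rule measure_Un_le; measurable)
  also have "\<dots> \<le> exp (- (x / s)\<^sup>2 / 2) + exp (- (x / s)\<^sup>2 / 2)"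
    using s x by (intro add_mono std_normal_tail_le std neg) auto
  finally show ?thesis unfolding e by simp
qed

text \<open>By independence, avoiding all events from N on has probability at most the product of
  the 1 - p j, hence at most exp of minus a partial sum of the p j, and these sums are
  unbounded.\<close>

lemma (in prob_space) borel_cantelli_AE2:
  assumes ind: "indep_events (\<lambda>j::nat. {\<omega>\<in>space M. P j \<omega>}) UNIV"
    and div: "\<not> summable (\<lambda>j. prob {\<omega>\<in>space M. P j \<omega>})"
  shows "AE \<omega> in M. infinite {j. P j \<omega>}"
proof -
  define A where "A j = {\<omega>\<in>space M. P j \<omega>}" for j
  have A[measurable]: "A j \<in> sets M" for j
    using ind by (auto simp: indep_events_def A_def)
  define p where "p j = prob (A j)" for j
  \<comment> \<open>A single event is an intersection-stable family, so independence passes to the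
    generated sigma-algebras, which contain the complements.\<close>
  have indc: "indep_events (\<lambda>j. space M - A j) UNIV"
  proof -
    have "indep_sets (\<lambda>j. {A j}) UNIV"
      using ind by (simp add: indep_events_def_alt A_def)
    then have "indep_sets (\<lambda>i. sigma_sets (space M) {A i}) UNIV"
      by (rule indep_sets_sigma) (auto simp: Int_stable_def)
    then show ?thesis
      unfolding indep_events_def_alt
      by (rule indep_sets_mono_sets) (auto intro: sigma_sets.intros)
  qed
  have null: "prob (\<Inter>j\<in>{N..}. space M - A j) = 0" for N
  proof -
    have le: "prob (\<Inter>j\<in>{N..}. space M - A j) \<le> exp (- (\<Sum>j<n. p (j + N)))" for n
    proof (cases "n = 0")
      case False
      have "prob (\<Inter>j\<in>{N..}. space M - A j) \<le> prob (\<Inter>j\<in>{N..<N+n}. space M - A j)"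
        using False by (intro finite_measure_mono sets.finite_INT) auto
      also have "\<dots> = (\<Prod>j\<in>{N..<N+n}. prob (space M - A j))"
        using indc False unfolding indep_events_def by auto
      also have "\<dots> \<le> (\<Prod>j\<in>{N..<N+n}. exp (- p j))"
      proof (rule prod_mono)
        fix j show "0 \<le> prob (space M - A j) \<and> prob (space M - A j) \<le> exp (- p j)"
          using exp_ge_add_one_self[of "- p j"] by (auto simp: prob_compl p_def)
      qed
      also have "\<dots> = exp (- (\<Sum>j\<in>{N..<N+n}. p j))"
        by (simp add: exp_sum flip: sum_negf)
      also have "(\<Sum>j\<in>{N..<N+n}. p j) = (\<Sum>j<n. p (j + N))"
        using sum.shift_bounds_nat_ivl[of p 0 N n] by (simp add: atLeast0LessThan add.commute)
      finally show ?thesis .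
    qed simp
    have "\<not> summable (\<lambda>j. p (j + N))"
      using div unfolding summable_iff_shift[of p N] unfolding p_def A_def .
    show ?thesis
    proof (rule ccontr)
      assume "prob (\<Inter>j\<in>{N..}. space M - A j) \<noteq> 0"
      then have q: "prob (\<Inter>j\<in>{N..}. space M - A j) > 0"
        by (simp add: zero_less_measure_iff)
      have "(\<Sum>j<n. p (j + N)) \<le> - ln (prob (\<Inter>j\<in>{N..}. space M - A j))" for n
        using le[of n] q by (simp add: ln_le_cancel_iff[symmetric])
      then have "summable (\<lambda>j. p (j + N))"
        by (intro summableI_nonneg_bounded) (auto simp: p_def)
      with \<open>\<not> summable (\<lambda>j. p (j + N))\<close> show False by contradiction
    qed
  qed
  have "AE \<omega> in M. \<forall>N. \<omega> \<notin> (\<Inter>j\<in>{N..}. space M - A j)"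
    unfolding AE_all_countable
  proof
    fix N
    have "(\<Inter>j\<in>{N..}. space M - A j) \<in> sets M"
      by (intro sets.countable_INT') auto
    then show "AE \<omega> in M. \<omega> \<notin> (\<Inter>j\<in>{N..}. space M - A j)"
      using null[of N] by (intro AE_not_in) (simp add: null_sets_def emeasure_eq_measure)
  qed
  then show ?thesis
    using AE_space
  proof eventually_elim
    case (elim \<omega>)
    then show ?case
      by (auto simp: A_def infinite_nat_iff_unbounded_le)
  qed
qed

section \<open>Chaining over dyadic increments\<close>

definition lil_norm :: "nat \<Rightarrow> real" where
  "lil_norm n = sqrt (2 * real n * ln (ln (real n)))"

definition rescaled :: "(nat \<Rightarrow> real) \<Rightarrow> nat \<Rightarrow> real \<Rightarrow> real" where
  "rescaled b n t = b (nat \<lfloor>real n * t\<rfloor>) / lil_norm n"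

text \<open>Any constant strictly between 1 / sqrt 2 and 1 would serve in place of 9/10.\<close>

definition dyadic_bound :: "(nat \<Rightarrow> real) \<Rightarrow> bool" where
  "dyadic_bound b \<longleftrightarrow> (\<forall>\<^sub>F j in sequentially. \<forall>l\<le>j. \<forall>i<2 ^ (j - l).
     \<bar>b (Suc i * 2 ^ l) - b (i * 2 ^ l)\<bar> \<le> 2 * sqrt (2 ^ j * ln (real j)) * (9/10) ^ (j - l))"

text \<open>Since e \<le> 3, e^e \<le> e^3 \<le> 27. This is the origin of the bound 27 on indices
  throughout.\<close>

lemma ln_ln_ge_1:
  assumes "n \<ge> 27" shows "1 \<le> ln (ln (real n))"
proof -
  have "exp (exp 1) \<le> exp (3 :: real)" using exp_le by simp
  also have "\<dots> = exp 1 ^ 3" by (simp flip: exp_of_nat_mult)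
  also have "\<dots> \<le> (3 :: real) ^ 3" by (intro power_mono exp_le) simp
  finally have "exp (exp 1) \<le> real n" using assms by simp
  then have "exp 1 \<le> ln (real n)" using assms by (simp add: ln_ge_iff)
  then show ?thesis
    using order_less_le_trans[OF exp_gt_zero, of 1 "ln (real n)"] by (simp add: ln_ge_iff)
qed

lemma lil_norm_at_top: "filterlim lil_norm at_top sequentially"
  unfolding lil_norm_def by real_asymp

lemma lil_norm_pos:
  assumes "n \<ge> 27" shows "0 < lil_norm n"
  unfolding lil_norm_def using ln_ln_ge_1[OF assms] assms
  by (intro real_sqrt_gt_zero mult_pos_pos; simp only: of_nat_0_less_iff; linarith)

lemma ln_ln_mono:
  assumes "27 \<le> k" "k \<le> n" shows "ln (ln (real k)) \<le> ln (ln (real n))"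
proof -
  have "0 < ln (real k)" using assms by simp
  then show ?thesis using assms by simp
qed

text \<open>The factor 9 is the sum of (9/10)^i over i \<ge> 1.\<close>

lemma sum_geometric_scales:
  assumes "q \<le> j" shows "(\<Sum>l<q. (9/10::real) ^ (j - l)) \<le> 9 * (9/10) ^ (j - q)"
  using assms
proof (induction q)
  case (Suc q)
  have "j - q = Suc (j - Suc q)" using Suc.prems by simp
  then have "(9/10::real) ^ (j - q) = 9/10 * (9/10) ^ (j - Suc q)" by simp
  then show ?case using Suc by simp
qed simp

text \<open>The q lowest binary digits of k are cleared one at a time. Clearing digit l either
  changes nothing or steps back over one dyadic block of length 2^l, which costs at most
  \<open>B l\<close>.\<close>

lemma dyadic_truncation_bound:
  fixes b :: "nat \<Rightarrow> real"
  assumes B: "\<And>l i. l \<le> j \<Longrightarrow> i < 2 ^ (j - l) \<Longrightarrow> \<bar>b (Suc i * 2 ^ l) - b (i * 2 ^ l)\<bar> \<le> B l"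
    and k: "k \<le> 2 ^ j" and "q \<le> j"
  shows "\<bar>b k - b (k div 2 ^ q * 2 ^ q)\<bar> \<le> (\<Sum>l<q. B l)"
  using \<open>q \<le> j\<close>
proof (induction q)
  case (Suc q)
  define a where "a = k div 2 ^ q"
  have IH: "\<bar>b k - b (a * 2 ^ q)\<bar> \<le> (\<Sum>l<q. B l)"
    using Suc by (simp add: a_def)
  have B0: "0 \<le> B q"
    using B[of q 0] Suc.prems by (smt (verit) Suc_leD zero_less_numeral zero_less_power)
  have eq: "k div 2 ^ Suc q * 2 ^ Suc q = (a div 2 * 2) * 2 ^ q"
    unfolding a_def power_Suc2 div_mult2_eq by (simp add: mult.assoc mult.commute)
  have "\<bar>b (a * 2 ^ q) - b ((a div 2 * 2) * 2 ^ q)\<bar> \<le> B q"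
  proof (cases "even a")
    case True
    then show ?thesis using B0 by simp
  next
    case False
    then have a: "a = Suc (a div 2 * 2)" by presburger
    have "a * 2 ^ q \<le> k" by (simp add: a_def)
    also have "k \<le> 2 ^ (j - q) * 2 ^ q" using k Suc.prems by (simp flip: power_add)
    finally have "a \<le> 2 ^ (j - q)" by simp
    then have "a div 2 * 2 < 2 ^ (j - q)" using a by linarith
    from B[OF _ this] Suc.prems show ?thesis using a by simp
  qed
  then show ?case unfolding eq sum.lessThan_Suc using IH by linarith
qed simp

text \<open>Both points are rounded down to multiples of 2^q. The rounded points coincide or are
  neighbours because \<open>k' - k\<close> is at most 2^q. The cost is 9 + 1 + 9 = 19, rounded up to
  20.\<close>

lemma chaining_bound:
  fixes b :: "nat \<Rightarrow> real"
  assumes B: "\<And>l i. l \<le> j \<Longrightarrow> i < 2 ^ (j - l) \<Longrightarrow> \<bar>b (Suc i * 2 ^ l) - b (i * 2 ^ l)\<bar> \<le> D * (9/10) ^ (j - l)"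
    and k: "k \<le> k'" "k' \<le> 2 ^ j" "k' - k \<le> 2 ^ q" and q: "q \<le> j"
  shows "\<bar>b k' - b k\<bar> \<le> 20 * D * (9/10) ^ (j - q)"
proof -
  define a a' where "a = k div 2 ^ q" "a' = k' div 2 ^ q"
  have D: "0 \<le> D"
    using B[of j 0] by simp
  have tr: "\<bar>b x - b (x div 2 ^ q * 2 ^ q)\<bar> \<le> 9 * D * (9/10) ^ (j - q)" if "x \<le> 2 ^ j" for x
  proof -
    have "\<bar>b x - b (x div 2 ^ q * 2 ^ q)\<bar> \<le> (\<Sum>l<q. D * (9/10) ^ (j - l))"
      by (rule dyadic_truncation_bound[OF B that q])
    also have "\<dots> = D * (\<Sum>l<q. (9/10) ^ (j - l))" by (simp add: sum_distrib_left)
    also have "\<dots> \<le> D * (9 * (9/10) ^ (j - q))"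
      using D by (intro mult_left_mono sum_geometric_scales q)
    finally show ?thesis by simp
  qed
  have "a \<le> a'" unfolding a_a'_def using k by (intro div_le_mono)
  have "k' \<le> k + 1 * 2 ^ q" using k by simp
  then have "a' \<le> (k + 1 * 2 ^ q) div 2 ^ q" unfolding a_a'_def by (rule div_le_mono)
  then have "a' \<le> Suc a" by (simp add: a_a'_def)
  have "\<bar>b (a' * 2 ^ q) - b (a * 2 ^ q)\<bar> \<le> D * (9/10) ^ (j - q)"
  proof (cases "a' = a")
    case True
    then show ?thesis using D by simp
  next
    case False
    then have a': "a' = Suc a" using \<open>a \<le> a'\<close> \<open>a' \<le> Suc a\<close> by simp
    have "a' * 2 ^ q \<le> k'" by (simp add: a_a'_def)
    also have "\<dots> \<le> 2 ^ (j - q) * 2 ^ q" using k q by (simp flip: power_add)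
    finally have "a' \<le> 2 ^ (j - q)" by simp
    then have "a < 2 ^ (j - q)" using a' by simp
    from B[OF q this] show ?thesis by (simp only: a')
  qed
  moreover have "\<bar>b k - b (a * 2 ^ q)\<bar> \<le> 9 * D * (9/10) ^ (j - q)"
    using tr[of k] k by (simp add: a_a'_def)
  moreover have "\<bar>b k' - b (a' * 2 ^ q)\<bar> \<le> 9 * D * (9/10) ^ (j - q)"
    using tr[of k'] k by (simp add: a_a'_def)
  ultimately have "\<bar>b k' - b k\<bar> \<le> 19 * (D * (9/10) ^ (j - q))" by linarith
  also have "\<dots> \<le> 20 * (D * (9/10) ^ (j - q))" using D by (intro mult_right_mono) auto
  finally show ?thesis by simp
qed

abbreviation modulus_bound :: "(nat \<Rightarrow> real) \<Rightarrow> nat \<Rightarrow> nat \<Rightarrow> bool" where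
  "modulus_bound b n J \<equiv> \<forall>q\<le>J. \<forall>k\<le>n. \<forall>k'\<le>n. k \<le> k' \<longrightarrow> k' - k \<le> 2 ^ q \<longrightarrow>
     \<bar>b k' - b k\<bar> \<le> 80 * lil_norm n * (9/10) ^ (J - q)"

text \<open>With J = ceiling of log2 n, the scale 2^J is at most 2n, and ln J is at most 2 ln ln n.
  The dyadic normalisation at J is thus at most 4 times \<open>lil_norm n\<close>, and chaining
  gives 80 = 20 * 4.\<close>

lemma dyadic_bound_modulus:
  assumes b: "dyadic_bound b"
  shows "\<exists>N. \<forall>n\<ge>N. \<exists>J. n \<le> 2 ^ J \<and> modulus_bound b n J"
proof -
  obtain J0 where J0: "\<And>j l i. j \<ge> J0 \<Longrightarrow> l \<le> j \<Longrightarrow> i < 2 ^ (j - l) \<Longrightarrow>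
     \<bar>b (Suc i * 2 ^ l) - b (i * 2 ^ l)\<bar> \<le> 2 * sqrt (2 ^ j * ln (real j)) * (9/10) ^ (j - l)"
    using b unfolding dyadic_bound_def eventually_sequentially by blast
  \<comment> \<open>The factor 2 absorbs both the base of the logarithm and the ceiling in J, which
    is at most log2 n + 1.\<close>
  have "\<forall>\<^sub>F n in sequentially. ln (log 2 (real n) + 1) \<le> 2 * ln (ln (real n))"
    by real_asymp
  moreover have "\<forall>\<^sub>F n in sequentially. real J0 \<le> log 2 (real n)"
    by real_asymp
  moreover have "\<forall>\<^sub>F n in sequentially. (27::nat) \<le> n"
    by (rule eventually_ge_at_top)
  ultimately have "\<forall>\<^sub>F n in sequentially. \<exists>J. n \<le> 2 ^ J \<and> modulus_bound b n J"
  proof eventually_elim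
    case (elim n)
    define J where "J = nat \<lceil>log 2 (real n)\<rceil>"
    have n0: "real n > 0" using elim by simp
    have l0: "log 2 (real n) > 0" using elim by simp
    have J1: "log 2 (real n) \<le> real J" "real J \<le> log 2 (real n) + 1"
      unfolding J_def using l0 by linarith+
    have "J \<ge> J0" using J1 elim by linarith
    have "real n = 2 powr log 2 (real n)" using n0 by simp
    also have "\<dots> \<le> 2 powr real J" using J1 by (intro powr_mono) auto
    finally have nJ: "real n \<le> 2 ^ J" by (simp add: powr_realpow)
    have "2 powr real J \<le> 2 powr (log 2 (real n) + 1)" using J1 by (intro powr_mono) auto
    also have "\<dots> = 2 * real n" using n0 by (simp add: powr_add)
    finally have Jn: "2 ^ J \<le> 2 * real n" by (simp add: powr_realpow)
    have "real J > 0" using l0 J1 by linarith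
    then have "ln (real J) \<le> ln (log 2 (real n) + 1)" using J1 by (intro ln_mono) auto
    also have "\<dots> \<le> 2 * ln (ln (real n))" using elim by simp
    finally have lnJ: "ln (real J) \<le> 2 * ln (ln (real n))" .
    have lnJ0: "0 \<le> ln (real J)" using \<open>real J > 0\<close> by (simp add: Suc_leI)
    have "2 ^ J * ln (real J) \<le> (2 * real n) * (2 * ln (ln (real n)))"
      using Jn lnJ lnJ0 by (intro mult_mono) auto
    then have "sqrt (2 ^ J * ln (real J)) \<le> sqrt ((2 * real n) * (2 * ln (ln (real n))))"
      by (rule real_sqrt_le_mono)
    also have "\<dots> = sqrt 2 * lil_norm n"
      unfolding lil_norm_def real_sqrt_mult[symmetric] by (rule arg_cong[where f=sqrt]) simp
    also have "\<dots> \<le> 2 * lil_norm n"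
      using lil_norm_pos[of n] elim by (intro mult_right_mono) (auto intro: real_le_lsqrt)
    finally have D: "2 * sqrt (2 ^ J * ln (real J)) \<le> 4 * lil_norm n" by simp
    show ?case
    proof (intro exI[of _ J] conjI allI impI)
      show "n \<le> 2 ^ J" using nJ by (metis of_nat_le_iff of_nat_numeral of_nat_power)
      fix q k k' assume *: "q \<le> J" "k \<le> n" "k' \<le> n" "k \<le> k'" "k' - k \<le> 2 ^ q"
      have "\<bar>b k' - b k\<bar> \<le> 20 * (4 * lil_norm n) * (9/10) ^ (J - q)"
      proof (rule chaining_bound[OF _ \<open>k \<le> k'\<close> _ _ \<open>q \<le> J\<close>])
        fix l i :: nat assume "l \<le> J" "i < 2 ^ (J - l)"
        from J0[OF \<open>J \<ge> J0\<close> this]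
        have "\<bar>b (Suc i * 2 ^ l) - b (i * 2 ^ l)\<bar> \<le> 2 * sqrt (2 ^ J * ln (real J)) * (9/10) ^ (J - l)" .
        also have "\<dots> \<le> 4 * lil_norm n * (9/10) ^ (J - l)"
          using D by (intro mult_right_mono) auto
        finally show "\<bar>b (Suc i * 2 ^ l) - b (i * 2 ^ l)\<bar> \<le> 4 * lil_norm n * (9/10) ^ (J - l)" .
      qed (use * \<open>n \<le> 2 ^ J\<close> in auto)
      then show "\<bar>b k' - b k\<bar> \<le> 80 * lil_norm n * (9/10) ^ (J - q)" by simp
    qed
  qed
  then show ?thesis unfolding eventually_sequentially .
qed

text \<open>The factor sqrt k, uniform over k \<le> n, is the point: after rescaling it becomes sqrt
  (k/n), and division by k/n then leaves the integrable majorant 1 / sqrt u.\<close>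

lemma dyadic_bound_growth:
  assumes b: "dyadic_bound b" and b0: "b 0 = 0"
  obtains C where "C > 0" "\<And>n k. n \<ge> 27 \<Longrightarrow> k \<le> n \<Longrightarrow> \<bar>b k\<bar> \<le> C * sqrt (real k * ln (ln (real n)))"
proof -
  obtain N where N: "\<forall>n\<ge>N. \<exists>J. n \<le> 2 ^ J \<and> modulus_bound b n J"
    using dyadic_bound_modulus[OF b] by blast
  define C where "C = 160 + (\<Sum>k<max N 27. \<bar>b k\<bar>)"
  have "C > 0" unfolding C_def by (intro add_pos_nonneg sum_nonneg) auto
  moreover have "\<bar>b k\<bar> \<le> C * sqrt (real k * ln (ln (real n)))" if n: "n \<ge> 27" "k \<le> n" for n k
  proof (cases "k \<ge> max N 27")
    case True
    then obtain J where J: "k \<le> 2 ^ J" "modulus_bound b k J"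
      using N[rule_format, of k] by auto
    \<comment> \<open>The modulus is used at index k itself, over its whole range, and not at n;
      this yields sqrt k. The finitely many small k are covered by the sum contained in
      \<open>C\<close>.\<close>
    have "\<bar>b k - b 0\<bar> \<le> 80 * lil_norm k * (9/10) ^ (J - J)"
      using J(2)[rule_format, of J 0 k] J(1) by simp
    then have "\<bar>b k\<bar> \<le> 80 * lil_norm k" using b0 by simp
    also have "lil_norm k \<le> sqrt (2\<^sup>2 * (real k * ln (ln (real n))))"
      unfolding lil_norm_def
    proof (rule real_sqrt_le_mono)
      have "ln (ln (real k)) \<le> ln (ln (real n))" using True n by (intro ln_ln_mono) auto
      moreover have "1 \<le> ln (ln (real k))" using True by (intro ln_ln_ge_1) auto
      ultimately have "real k * (2 * ln (ln (real k))) \<le> real k * (4 * ln (ln (real n)))"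
        by (intro mult_left_mono) auto
      then show "2 * real k * ln (ln (real k)) \<le> 2\<^sup>2 * (real k * ln (ln (real n)))" by simp
    qed
    then have "80 * lil_norm k \<le> 80 * (2 * sqrt (real k * ln (ln (real n))))"
      by (simp add: real_sqrt_mult)
    also have "\<dots> = 160 * sqrt (real k * ln (ln (real n)))" by simp
    also have "\<dots> \<le> C * sqrt (real k * ln (ln (real n)))"
      using ln_ln_ge_1[OF n(1)] unfolding C_def
      by (intro mult_right_mono) (auto intro!: sum_nonneg)
    finally show ?thesis .
  next
    case False
    show ?thesis
    proof (cases "k = 0")
      case False': False
      have "\<bar>b k\<bar> \<le> (\<Sum>k<max N 27. \<bar>b k\<bar>)"
        using False by (intro member_le_sum) auto
      also have "\<dots> \<le> C" by (simp add: C_def)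
      also have "C = C * 1" by simp
      also have "\<dots> \<le> C * sqrt (real k * ln (ln (real n)))"
      proof (rule mult_left_mono)
        have "1 * 1 \<le> real k * ln (ln (real n))"
          using False' ln_ln_ge_1[OF n(1)] by (intro mult_mono) auto
        then show "1 \<le> sqrt (real k * ln (ln (real n)))" by simp
      qed (use \<open>C > 0\<close> in simp)
      finally show ?thesis .
    qed (simp add: b0)
  qed
  ultimately show ?thesis using that by blast
qed

section \<open>Asymptotic equicontinuity and a selection theorem of Arzela-Ascoli type\<close>

abbreviation rescaled_limit :: "(nat \<Rightarrow> real) \<Rightarrow> (nat \<Rightarrow> nat) \<Rightarrow> (real \<Rightarrow> real) \<Rightarrow> bool" where
  "rescaled_limit b r g \<equiv> uniform_limit {0..1} (\<lambda>n. rescaled b (r n)) g sequentially"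

abbreviation oscillation_le :: "(real \<Rightarrow> real) \<Rightarrow> real \<Rightarrow> real \<Rightarrow> bool" where
  "oscillation_le h \<delta> \<epsilon> \<equiv> \<forall>s\<in>{0..1}. \<forall>t\<in>{0..1}. \<bar>s - t\<bar> \<le> \<delta> \<longrightarrow> \<bar>h s - h t\<bar> \<le> \<epsilon>"

text \<open>The functions \<open>rescaled b n\<close> are step functions with jumps, so no single
  one need have a small modulus of continuity. A given \<delta> is required to work only from some
  index on.\<close>

definition asymp_equicontinuous :: "(nat \<Rightarrow> real \<Rightarrow> real) \<Rightarrow> bool" where
  "asymp_equicontinuous g \<longleftrightarrow> (\<forall>\<epsilon>>0. \<exists>\<delta>>0. \<exists>N. \<forall>n\<ge>N. oscillation_le (g n) \<delta> \<epsilon>)"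

lemma rescaled_equicontinuous:
  assumes b: "dyadic_bound b"
  shows "asymp_equicontinuous (rescaled b)"
  unfolding asymp_equicontinuous_def
proof (intro allI impI)
  fix \<epsilon> :: real assume eps: "\<epsilon> > 0"
  obtain N where N: "\<forall>n\<ge>N. \<exists>J. n \<le> 2 ^ J \<and> modulus_bound b n J"
    using dyadic_bound_modulus[OF b] by blast
  obtain p where p: "(9/10::real) ^ p < \<epsilon> / 80"
    using real_arch_pow_inv[of "\<epsilon> / 80" "9/10"] eps by auto
  \<comment> \<open>A time difference \<delta> corresponds to at most 2^(J - p - 1) steps. The other
    half of the allowance 2^(J - p) covers the rounding of the two indices, which adds at most
    1.\<close>
  define \<delta> :: real where "\<delta> = 1 / 2 ^ Suc p"
  have key: "\<bar>rescaled b n t - rescaled b n s\<bar> \<le> \<epsilon>"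
    if n: "n \<ge> N" "n \<ge> 27" "n > 2 ^ p" and st: "0 \<le> s" "s \<le> t" "t \<le> 1" "t - s \<le> \<delta>" for n s t
  proof -
    obtain J where J: "n \<le> 2 ^ J" "modulus_bound b n J"
      using N[rule_format, OF n(1)] by blast
    have "(2::nat) ^ p < 2 ^ J" using J(1) n(3) by linarith
    then have "p < J" by simp
    define k k' where "k = nat \<lfloor>real n * s\<rfloor>" "k' = nat \<lfloor>real n * t\<rfloor>"
    have mono: "real n * s \<le> real n * t" using st by (intro mult_left_mono) auto
    have "k \<le> k'" unfolding k_k'_def using mono by (intro nat_mono floor_mono)
    have "real n * t \<le> real n * 1" using st by (intro mult_left_mono) auto
    then have "k' \<le> n" unfolding k_k'_def by linarith
    have nn: "0 \<le> real n * s" using st by simp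
    have "real n \<le> 2 ^ J" using J(1) by (metis of_nat_le_iff of_nat_numeral of_nat_power)
    then have "real n * (t - s) \<le> 2 ^ J * \<delta>"
      using st by (intro mult_mono) auto
    also have "(2::real) ^ J = 2 ^ (J - Suc p) * 2 ^ Suc p"
      using \<open>p < J\<close> by (simp flip: power_add del: power_Suc)
    then have "2 ^ J * \<delta> = 2 ^ (J - Suc p)" by (simp add: \<delta>_def)
    finally have d: "real n * t - real n * s \<le> 2 ^ (J - Suc p)" by (simp add: algebra_simps)
    have "real k' - real k \<le> real n * t - real n * s + 1"
      unfolding k_k'_def using nn mono by linarith
    also have "\<dots> \<le> 2 ^ (J - Suc p) + 2 ^ (J - Suc p)"
      using d by (intro add_mono) auto
    also have "\<dots> = 2 ^ (J - p)"
    proof -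
      have "J - p = Suc (J - Suc p)" using \<open>p < J\<close> by simp
      then show ?thesis by simp
    qed
    finally have "real k' \<le> real (k + 2 ^ (J - p))" by simp
    then have "k' \<le> k + 2 ^ (J - p)" by (simp only: of_nat_le_iff)
    then have "k' - k \<le> 2 ^ (J - p)" by simp
    then have "\<bar>b k' - b k\<bar> \<le> 80 * lil_norm n * (9/10) ^ (J - (J - p))"
      using J(2)[rule_format, of "J - p" k k'] \<open>k \<le> k'\<close> \<open>k' \<le> n\<close> by simp
    also have "J - (J - p) = p" using \<open>p < J\<close> by simp
    also have "80 * lil_norm n * (9/10) ^ p \<le> 80 * lil_norm n * (\<epsilon> / 80)"
      using p lil_norm_pos[of n] n by (intro mult_left_mono) auto
    finally have "\<bar>b k' - b k\<bar> \<le> lil_norm n * \<epsilon>" by simp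
    then show ?thesis
      using lil_norm_pos[of n] n
      by (simp add: rescaled_def k_k'_def field_simps flip: diff_divide_distrib)
  qed
  show "\<exists>\<delta>>0. \<exists>N. \<forall>n\<ge>N. oscillation_le (rescaled b n) \<delta> \<epsilon>"
  proof (intro exI[of _ \<delta>] exI[of _ "max N (max 27 (Suc (2 ^ p)))"] conjI allI ballI impI)
    fix n s t assume *: "n \<ge> max N (max 27 (Suc (2 ^ p)))" "s \<in> {0..1}" "t \<in> {0..1}" "\<bar>s - t\<bar> \<le> \<delta>"
    show "\<bar>rescaled b n s - rescaled b n t\<bar> \<le> \<epsilon>"
    proof (cases "s \<le> t")
      case True
      then show ?thesis using key[of n s t] * by (auto simp: abs_minus_commute)
    next
      case False
      then show ?thesis using key[of n t s] * by auto
    qed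
  qed (simp add: \<delta>_def)
qed

lemma rescaled_bounded:
  assumes C: "\<And>n k. n \<ge> 27 \<Longrightarrow> k \<le> n \<Longrightarrow> \<bar>b k\<bar> \<le> C * sqrt (real k * ln (ln (real n)))"
    and n: "n \<ge> 27" "k \<le> n" and "C > 0"
  shows "\<bar>b k / lil_norm n\<bar> \<le> C * sqrt (real k / real n)"
proof -
  have "\<bar>b k / lil_norm n\<bar> = \<bar>b k\<bar> / lil_norm n"
    using lil_norm_pos[OF n(1)] by simp
  also have "\<dots> \<le> C * sqrt (real k * ln (ln (real n))) / sqrt (real n * ln (ln (real n)))"
  proof (rule frac_le)
    show "sqrt (real n * ln (ln (real n))) \<le> lil_norm n"
      using ln_ln_ge_1[OF n(1)] by (simp add: lil_norm_def)
    show "0 < sqrt (real n * ln (ln (real n)))"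
      using ln_ln_ge_1[OF n(1)] n by (intro real_sqrt_gt_zero mult_pos_pos; simp only: of_nat_0_less_iff; linarith)
    show "0 \<le> C * sqrt (real k * ln (ln (real n)))"
      using ln_ln_ge_1[OF n(1)] \<open>C > 0\<close> by simp
  qed (use C n in auto)
  also have "\<dots> = C * sqrt (real k / real n)"
    using ln_ln_ge_1[OF n(1)] by (simp add: real_sqrt_mult real_sqrt_divide)
  finally show ?thesis .
qed

lemma asymp_equicontinuous_subseq:
  assumes "asymp_equicontinuous g" "strict_mono r"
  shows "asymp_equicontinuous (\<lambda>n. g (r n))"
  unfolding asymp_equicontinuous_def
proof (intro allI impI)
  fix \<epsilon> :: real assume "\<epsilon> > 0"
  then obtain \<delta> N where "\<delta> > 0" "\<forall>n\<ge>N. oscillation_le (g n) \<delta> \<epsilon>"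
    using assms(1) unfolding asymp_equicontinuous_def by blast
  moreover have "r n \<ge> N" if "n \<ge> N" for n
    using that strict_mono_imp_increasing[OF assms(2), of n] by simp
  ultimately show "\<exists>\<delta>>0. \<exists>N. \<forall>n\<ge>N. oscillation_le (g (r n)) \<delta> \<epsilon>"
    by (intro exI[of _ \<delta>] exI[of _ N]) auto
qed

text \<open>A diagonal subsequence converges at all rationals of the unit interval. Convergence on a
  grid of mesh below \<delta> and the common modulus then make it uniformly Cauchy, without
  continuity of the individual functions. The shift by \<open>N0\<close> makes the bound hold from
  the first index, as the diagonal argument requires.\<close>

lemma asymp_equicontinuous_uniform_subseq:
  assumes eq: "asymp_equicontinuous g"
    and bd: "\<And>n t. n \<ge> N0 \<Longrightarrow> t \<in> {0..1} \<Longrightarrow> \<bar>g n t\<bar> \<le> B"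
  shows "\<exists>(q::nat\<Rightarrow>nat) h. strict_mono q \<and> uniform_limit {0..1} (\<lambda>n. g (q n)) h sequentially"
proof -
  define S :: "real set" where "S = \<rat> \<inter> {0..1}"
  have "countable S" unfolding S_def by (simp add: countable_rat countable_Int1)
  have gB: "norm (g (n + N0) x) \<le> B" if "x \<in> S" for n x
    using bd[of "n + N0" x] that by (simp add: S_def)
  obtain k where k: "strict_mono (k::nat\<Rightarrow>nat)" "\<And>x. x \<in> S \<Longrightarrow> \<exists>l. (\<lambda>n. g (k n + N0) x) \<longlonglongrightarrow> l"
    using function_convergent_subsequence[OF \<open>countable S\<close>, of "\<lambda>n. g (n + N0)" B] gB by blast
  define q where "q n = k n + N0" for n
  have q: "strict_mono q" using k(1) by (simp add: q_def strict_mono_def)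
  have cau: "Cauchy (\<lambda>n. g (q n) x)" if "x \<in> S" for x
    using k(2)[OF that] unfolding q_def by (auto intro: LIMSEQ_imp_Cauchy)
  have "uniformly_Cauchy_on {0..1} (\<lambda>n. g (q n))"
    unfolding uniformly_Cauchy_on_def
  proof (intro allI impI)
    fix e :: real assume e: "e > 0"
    then have "e / 4 > 0" by simp
    obtain \<delta> N where \<delta>: "\<delta> > 0" "\<forall>n\<ge>N. oscillation_le (g n) \<delta> (e / 4)"
      using eq \<open>e / 4 > 0\<close> unfolding asymp_equicontinuous_def by blast
    obtain m :: nat where m: "m > 0" "1 / real m < \<delta>"
      using \<delta>(1) by (metis nat_approx_posE zero_less_Suc)
    have "\<exists>Ni. \<forall>n\<ge>Ni. \<forall>n'\<ge>Ni. \<bar>g (q n) (real i / real m) - g (q n') (real i / real m)\<bar> < e / 4" if "i \<le> m" for i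
    proof -
      have "real i / real m \<in> S" using that m by (auto simp: S_def divide_simps)
      from cau[OF this, unfolded Cauchy_def dist_real_def, rule_format, of "e / 4"] e show ?thesis
        by auto
    qed
    then obtain Ni where Ni: "\<And>i n n'. i \<le> m \<Longrightarrow> n \<ge> Ni i \<Longrightarrow> n' \<ge> Ni i \<Longrightarrow>
        \<bar>g (q n) (real i / real m) - g (q n') (real i / real m)\<bar> < e / 4"
      by metis
    define L where "L = max N (Max (Ni ` {..m}))"
    show "\<exists>L. \<forall>x\<in>{0..1}. \<forall>n\<ge>L. \<forall>n'\<ge>L. dist (g (q n) x) (g (q n') x) < e"
    proof (intro exI[of _ L] ballI allI impI)
      fix x :: real and n n' assume x: "x \<in> {0..1}" and n: "L \<le> n" "L \<le> n'"
      define i where "i = nat \<lfloor>real m * x\<rfloor>"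
      have mx: "0 \<le> real m * x" "real m * x \<le> real m * 1"
        using x mult_left_mono[of x 1 "real m"] by auto
      have i: "i \<le> m" "real i \<le> real m * x" "real m * x \<le> real i + 1"
        unfolding i_def using mx by linarith+
      have y: "real i / real m \<in> {0..1}" using i m by (auto simp: divide_simps)
      have "x - real i / real m = (real m * x - real i) / real m"
        using m by (simp add: field_simps)
      moreover have "\<bar>(real m * x - real i) / real m\<bar> \<le> 1 / real m"
        unfolding abs_divide using i m by (intro frac_le) auto
      ultimately have "\<bar>x - real i / real m\<bar> \<le> 1 / real m" by simp
      then have xy: "\<bar>x - real i / real m\<bar> \<le> \<delta>" using m by simp
      have "Ni i \<le> L" using i unfolding L_def by (simp add: le_max_iff_disj)
      then have 1: "\<bar>g (q n) (real i / real m) - g (q n') (real i / real m)\<bar> < e / 4"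
        using Ni[OF i(1)] n by auto
      have "N \<le> q n" "N \<le> q n'"
        using n strict_mono_imp_increasing[OF q, of n] strict_mono_imp_increasing[OF q, of n']
        by (auto simp: L_def)
      then have "\<bar>g (q n) x - g (q n) (real i / real m)\<bar> \<le> e / 4"
        "\<bar>g (q n') x - g (q n') (real i / real m)\<bar> \<le> e / 4"
        using \<delta>(2) x y xy by blast+
      with 1 show "dist (g (q n) x) (g (q n') x) < e"
        unfolding dist_real_def using e by linarith
    qed
  qed
  then have "uniformly_convergent_on {0..1} (\<lambda>n. g (q n))"
    by (rule Cauchy_uniformly_convergent)
  then show ?thesis using q unfolding uniformly_convergent_on_def by blast
qed

section \<open>Random walks with standard normal steps\<close>

abbreviation sq_sum :: "(nat \<Rightarrow> real) \<Rightarrow> nat \<Rightarrow> real" where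
  "sq_sum c m \<equiv> \<Sum>i<m. (c i)\<^sup>2"

abbreviation block_sum :: "(nat \<Rightarrow> real) \<Rightarrow> (nat \<Rightarrow> real) \<Rightarrow> nat \<Rightarrow> nat \<Rightarrow> real" where
  "block_sum c b m r \<equiv> \<Sum>i<m. c i * (b (Suc i * r) - b (i * r))"

abbreviation grid_sum :: "(nat \<Rightarrow> real) \<Rightarrow> (real \<Rightarrow> real) \<Rightarrow> nat \<Rightarrow> real" where
  "grid_sum c f m \<equiv> \<Sum>i<m. c i * (f (real (Suc i) / real m) - f (real i / real m))"

text \<open>Lists of rationals form a countable type, so \<open>AE_all_countable\<close> can
  quantify over all coefficient vectors at once.\<close>

abbreviation rat_coeff :: "rat list \<Rightarrow> nat \<Rightarrow> real" where
  "rat_coeff cs i \<equiv> real_of_rat (cs ! i)"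

text \<open>This writes a block combination as a weighted sum of single steps, the form to which
  Gaussian tails apply. The weight of step k is the coefficient of the block containing it.\<close>

lemma sum_blocks:
  fixes x c :: "nat \<Rightarrow> real"
  shows "(\<Sum>i<m. c i * ((\<Sum>k<Suc i * r. x k) - (\<Sum>k<i * r. x k))) = (\<Sum>k<m * r. c (k div r) * x k)"
proof -
  have "c i * ((\<Sum>k<Suc i * r. x k) - (\<Sum>k<i * r. x k)) = (\<Sum>k\<in>{i * r..<i * r + r}. c (k div r) * x k)" for i
  proof -
    have "(\<Sum>k<Suc i * r. x k) - (\<Sum>k<i * r. x k) = (\<Sum>k\<in>{i * r..<i * r + r}. x k)"
      using sum_diff_nat_ivl[of 0 "i * r" "i * r + r" x] by (simp add: atLeast0LessThan add.commute)
    moreover have "k div r = i" if "k \<in> {i * r..<i * r + r}" for k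
      using that by (intro div_nat_eqI) (auto simp: algebra_simps)
    ultimately show ?thesis
      by (simp add: sum_distrib_left)
  qed
  then show ?thesis
    by (simp add: sum.nat_group)
qed

lemma sum_blocks_const:
  fixes c :: "nat \<Rightarrow> real"
  shows "(\<Sum>k<m * r. c (k div r)) = real r * (\<Sum>i<m. c i)"
  using sum_blocks[where c=c and r=r and x="\<lambda>_. 1" and m=m] by (simp add: sum_distrib_left algebra_simps)

text \<open>Consecutive scales have ratio tending to 1, while tail probabilities of order
  j powr -(1 + \<epsilon>) at these scales are still summable.\<close>

definition block_scale :: "real \<Rightarrow> nat \<Rightarrow> nat" where
  "block_scale \<epsilon> j = nat \<lceil>exp (real j powr (1 / (1 + \<epsilon>)))\<rceil>"

lemma block_scale_bounds:
  "exp (real j powr (1 / (1 + \<epsilon>))) \<le> real (block_scale \<epsilon> j)"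
  "real (block_scale \<epsilon> j) \<le> exp (real j powr (1 / (1 + \<epsilon>))) + 1"
proof -
  have "exp (real j powr (1 / (1 + \<epsilon>))) > 0" by simp
  then show "exp (real j powr (1 / (1 + \<epsilon>))) \<le> real (block_scale \<epsilon> j)"
    "real (block_scale \<epsilon> j) \<le> exp (real j powr (1 / (1 + \<epsilon>))) + 1"
    unfolding block_scale_def by linarith+
qed

section \<open>Almost sure bounds for block increments of the Gaussian walk\<close>

locale gaussian_sequence = prob_space M for M :: "'a measure" +
  fixes X :: "nat \<Rightarrow> 'a \<Rightarrow> real"
  assumes indep: "indep_vars (\<lambda>_. borel) X UNIV"
    and normal: "\<And>i. distributed M lborel (X i) std_normal_density"
begin

definition walk :: "'a \<Rightarrow> nat \<Rightarrow> real" where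
  "walk \<omega> n = (\<Sum>k<n. X k \<omega>)"

lemma X_measurable [measurable]: "X i \<in> borel_measurable M"
  using normal[of i] by (auto simp: distributed_def)

lemma walk_measurable [measurable]: "(\<lambda>\<omega>. walk \<omega> n) \<in> borel_measurable M"
  unfolding walk_def by measurable

lemma linear_combination_normal:
  assumes A: "finite A" and v: "v = (\<Sum>k\<in>A. (d k)\<^sup>2)" "v > 0"
  shows "distributed M lborel (\<lambda>\<omega>. \<Sum>k\<in>A. d k * X k \<omega>) (normal_density 0 (sqrt v))"
proof -
  \<comment> \<open>Terms with coefficient 0 are removed because \<open>sum_indep_normal\<close>
    asks for positive standard deviations.\<close>
  define B where "B = {k\<in>A. d k \<noteq> 0}"
  have B: "finite B" "B \<subseteq> A" using A by (auto simp: B_def)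
  have zero: "d k = 0" if "k \<in> A - B" for k using that by (auto simp: B_def)
  have v': "v = (\<Sum>k\<in>B. \<bar>d k\<bar>\<^sup>2)"
    unfolding v using A B zero by (intro sum.mono_neutral_cong_right) auto
  have "B \<noteq> {}" using v(2) v' by auto
  have ind: "indep_vars (\<lambda>_. borel) (\<lambda>k \<omega>. d k * X k \<omega>) B"
    by (rule indep_vars_compose2[OF indep_vars_subset[OF indep subset_UNIV], of B "\<lambda>k x. d k * x"]) auto
  have nrm: "distributed M lborel (\<lambda>\<omega>. d k * X k \<omega>) (normal_density 0 \<bar>d k\<bar>)" if "k \<in> B" for k
    using normal_density_affine[OF normal, of "d k" 0] that by (auto simp: B_def)
  have "distributed M lborel (\<lambda>\<omega>. \<Sum>k\<in>B. d k * X k \<omega>)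
      (normal_density (\<Sum>k\<in>B. 0) (sqrt (\<Sum>k\<in>B. \<bar>d k\<bar>\<^sup>2)))"
    using B \<open>B \<noteq> {}\<close> ind nrm by (intro sum_indep_normal) (auto simp: B_def)
  moreover have "(\<Sum>k\<in>B. d k * X k \<omega>) = (\<Sum>k\<in>A. d k * X k \<omega>)" for \<omega>
    using A B zero by (intro sum.mono_neutral_left) auto
  ultimately show ?thesis by (simp add: v')
qed

lemma linear_combination_tail_le:
  assumes A: "finite A" and v: "v = (\<Sum>k\<in>A. (d k)\<^sup>2)" "v > 0" and t: "0 \<le> t"
  shows "prob {\<omega>\<in>space M. t \<le> \<bar>\<Sum>k\<in>A. d k * X k \<omega>\<bar>} \<le> 2 * exp (- t\<^sup>2 / (2 * v))"
  using normal_abs_tail_le[OF linear_combination_normal[OF A v] _ t] v(2) by simp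

lemma walk_increment_tail_le:
  assumes "r > 0" "0 \<le> t"
  shows "prob {\<omega>\<in>space M. t \<le> \<bar>walk \<omega> (Suc i * r) - walk \<omega> (i * r)\<bar>} \<le> 2 * exp (- t\<^sup>2 / (2 * real r))"
proof -
  have "walk \<omega> (Suc i * r) - walk \<omega> (i * r) = (\<Sum>k\<in>{i * r..<i * r + r}. 1 * X k \<omega>)" for \<omega>
    using sum_diff_nat_ivl[of 0 "i * r" "i * r + r" "\<lambda>k. X k \<omega>"]
    by (simp add: atLeast0LessThan add.commute walk_def)
  then show ?thesis
    using linear_combination_tail_le[of "{i * r..<i * r + r}" "real r" "\<lambda>_. 1" t] assms by simp
qed

text \<open>For an increment over 2^l steps the squared threshold divided by twice the variance is 2
  ln j (81/50)^(j - l), where 81/50 = 2 (9/10)^2 exceeds 1. The exponent grows geometrically as l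
  decreases and beats the 2^(j - l) intervals of the union bound; summation over l leaves 4 /
  j^2.\<close>

lemma AE_dyadic_increments:
  "AE \<omega> in M. \<forall>\<^sub>F j in sequentially. \<forall>l\<le>j. \<forall>i<2 ^ (j - l).
     \<bar>walk \<omega> (Suc i * 2 ^ l) - walk \<omega> (i * 2 ^ l)\<bar> \<le> 2 * sqrt (2 ^ j * ln (real j)) * (9/10) ^ (j - l)"
proof -
  define thr where "thr j l = 2 * sqrt (2 ^ j * ln (real j)) * (9/10) ^ (j - l)" for j l :: nat
  define E where "E j l i = {\<omega>\<in>space M. thr j l \<le> \<bar>walk \<omega> (Suc i * 2 ^ l) - walk \<omega> (i * 2 ^ l)\<bar>}" for j l i
  define A where "A j = (\<Union>l\<in>{..j}. \<Union>i\<in>{..<2 ^ (j - l)}. E j l i)" for j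
  have [measurable]: "E j l i \<in> sets M" for j l i unfolding E_def by measurable
  have A_sets: "A j \<in> sets M" for j unfolding A_def by (intro sets.finite_UN) auto
  have PE: "prob (E j l i) \<le> 2 * exp (- (2 + real (j - l)) * ln (real j))" if "j \<ge> 4" "l \<le> j" for j l i
  proof -
    have ln: "ln (real j) \<ge> 0" using that by simp
    have thr2: "(thr j l)\<^sup>2 / (2 * real (2 ^ l)) = 2 * ln (real j) * (81/50) ^ (j - l)"
    proof -
      have "(2::real) ^ j = 2 ^ l * 2 ^ (j - l)"
        using that by (simp flip: power_add)
      moreover have "((9/10::real) ^ (j - l))\<^sup>2 = (81/100) ^ (j - l)"
        by (simp add: power2_eq_square flip: power_mult_distrib)
      moreover have "(81/50::real) ^ (j - l) = 2 ^ (j - l) * (81/100) ^ (j - l)"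
        by (simp flip: power_mult_distrib)
      ultimately show ?thesis
        using ln by (simp add: thr_def power_mult_distrib)
    qed
    \<comment> \<open>Bernoulli turns geometric growth into the linear exponent 2 + (j - l). Every
      finer level then gains a factor 1/j against only twice as many intervals.\<close>
    have "1 + real (j - l) * (31/50) \<le> (1 + 31/50) ^ (j - l)"
      by (rule Bernoulli_inequality) auto
    then have "2 + real (j - l) \<le> 2 * (81/50) ^ (j - l)"
      by simp
    then have "(2 + real (j - l)) * ln (real j) \<le> 2 * (81/50) ^ (j - l) * ln (real j)"
      using ln by (intro mult_right_mono) auto
    then have le: "- (thr j l)\<^sup>2 / (2 * real (2 ^ l)) \<le> - (2 + real (j - l)) * ln (real j)"
      using thr2 by (simp add: algebra_simps)
    have "thr j l \<ge> 0" using ln by (simp add: thr_def)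
    then have "prob (E j l i) \<le> 2 * exp (- (thr j l)\<^sup>2 / (2 * real (2 ^ l)))"
      unfolding E_def by (intro walk_increment_tail_le) auto
    also have "\<dots> \<le> 2 * exp (- (2 + real (j - l)) * ln (real j))"
      using le by simp
    finally show ?thesis .
  qed
  have PA: "prob (A j) \<le> 4 * (1 / (real j)\<^sup>2)" if j: "j \<ge> 4" for j
  proof -
    have "prob (A j) \<le> (\<Sum>l\<in>{..j}. prob (\<Union>i\<in>{..<2 ^ (j - l)}. E j l i))"
      unfolding A_def by (intro measure_UNION_le) auto
    also have "\<dots> \<le> (\<Sum>l\<in>{..j}. \<Sum>i\<in>{..<2 ^ (j - l)}. prob (E j l i))"
      by (intro sum_mono measure_UNION_le) auto
    also have "\<dots> \<le> (\<Sum>l\<in>{..j}. \<Sum>i\<in>{..<(2::nat) ^ (j - l)}. 2 * exp (- (2 + real (j - l)) * ln (real j)))"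
      using j by (intro sum_mono PE) auto
    also have "\<dots> = (\<Sum>l\<in>{..j}. 2 / (real j)\<^sup>2 * (2 / real j) ^ (j - l))"
    proof (rule sum.cong[OF refl])
      fix l
      have "exp (- (2 + real (j - l)) * ln (real j)) = exp (- (real (2 + (j - l)) * ln (real j)))"
        by (simp add: algebra_simps)
      also have "\<dots> = 1 / real j ^ (2 + (j - l))"
        using j by (simp only: exp_minus exp_of_nat_mult inverse_eq_divide) simp
      also have "\<dots> = 1 / ((real j)\<^sup>2 * real j ^ (j - l))"
        by (simp only: power_add)
      finally have *: "exp (- (2 + real (j - l)) * ln (real j)) = 1 / ((real j)\<^sup>2 * real j ^ (j - l))" .
      show "(\<Sum>i\<in>{..<(2::nat) ^ (j - l)}. 2 * exp (- (2 + real (j - l)) * ln (real j)))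
          = 2 / (real j)\<^sup>2 * (2 / real j) ^ (j - l)"
        unfolding * by (simp add: power_divide)
    qed
    also have "\<dots> \<le> (\<Sum>l\<in>{..j}. 2 / (real j)\<^sup>2 * (1/2) ^ (j - l))"
      \<comment> \<open>For j \<ge> 4 the ratio 2/j is at most 1/2.\<close>
      using j by (intro sum_mono mult_left_mono power_mono) (auto simp: divide_simps)
    also have "\<dots> = 2 / (real j)\<^sup>2 * (\<Sum>l\<in>{..j}. (1/2) ^ (j - l))"
      by (simp add: sum_distrib_left)
    also have "\<dots> \<le> 2 / (real j)\<^sup>2 * 2"
    proof (rule mult_left_mono)
      have "(\<Sum>l\<in>{..j}. (1/2::real) ^ (j - l)) = (\<Sum>l\<in>{..j}. (1/2) ^ l)"
        by (rule sum.reindex_bij_witness[of _ "\<lambda>l. j - l" "\<lambda>l. j - l"]) auto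
      also have "\<dots> \<le> 2"
        by (subst sum_gp0) (simp add: field_simps)
      finally show "(\<Sum>l\<in>{..j}. (1/2::real) ^ (j - l)) \<le> 2" .
    qed simp
    finally show ?thesis by simp
  qed
  have "summable (\<lambda>j. prob (A j))"
  proof (rule summable_comparison_test_ev)
    show "\<forall>\<^sub>F j in sequentially. norm (prob (A j)) \<le> 4 * (1 / (real j)\<^sup>2)"
      using eventually_ge_at_top[of 4] by eventually_elim (use PA in auto)
    show "summable (\<lambda>j. 4 * (1 / (real j)\<^sup>2))"
      using inverse_power_summable[of 2, where ?'a=real]
      by (intro summable_mult) (simp add: inverse_eq_divide)
  qed
  then have "AE \<omega> in M. \<forall>\<^sub>F j in sequentially. \<omega> \<in> space M - A j"
    using A_sets by (intro borel_cantelli_AE1) (auto simp: less_top[symmetric])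
  then show ?thesis
  proof eventually_elim
    case (elim \<omega>)
    then show ?case
    proof (rule eventually_mono)
      fix j assume *: "\<omega> \<in> space M - A j"
      show "\<forall>l\<le>j. \<forall>i<2 ^ (j - l). \<bar>walk \<omega> (Suc i * 2 ^ l) - walk \<omega> (i * 2 ^ l)\<bar>
          \<le> 2 * sqrt (2 ^ j * ln (real j)) * (9/10) ^ (j - l)"
      proof (intro allI impI)
        fix l i :: nat assume "l \<le> j" "i < 2 ^ (j - l)"
        with * have "\<omega> \<notin> E j l i" "\<omega> \<in> space M" unfolding A_def by auto
        then show "\<bar>walk \<omega> (Suc i * 2 ^ l) - walk \<omega> (i * 2 ^ l)\<bar>
            \<le> 2 * sqrt (2 ^ j * ln (real j)) * (9/10) ^ (j - l)"
          unfolding E_def thr_def by auto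
      qed
    qed
  qed
qed

text \<open>At these scales ln ln (r j) is at least ln j / (1 + \<epsilon>). Squaring the factor 1 +
  \<epsilon> of the threshold gives (1 + \<epsilon>)^2: one factor pays for the slow scale, the
  other remains as the summable exponent of j.\<close>

lemma AE_block_combination_upper:
  fixes c :: "nat \<Rightarrow> real" and \<epsilon> :: real
  assumes eps: "\<epsilon> > 0" and V: "V = sq_sum c m" "V > 0"
  defines "r \<equiv> block_scale \<epsilon>"
  shows "AE \<omega> in M. \<forall>\<^sub>F j in sequentially.
     \<bar>block_sum c (walk \<omega>) m (r j)\<bar>
       \<le> (1 + \<epsilon>) * sqrt (2 * real (r j) * V * ln (ln (real (r j))))"
proof -
  define Z where "Z j \<omega> = block_sum c (walk \<omega>) m (r j)" for j \<omega>
  define t where "t j = (1 + \<epsilon>) * sqrt (2 * real (r j) * V * ln (ln (real (r j))))" for j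
  define A where "A j = {\<omega>\<in>space M. t j \<le> \<bar>Z j \<omega>\<bar>}" for j
  have [measurable]: "Z j \<in> borel_measurable M" for j
    unfolding Z_def by measurable
  have A_sets: "A j \<in> sets M" for j unfolding A_def by measurable
  have PA: "prob (A j) \<le> 2 * real j powr (- (1 + \<epsilon>))" if j: "j \<ge> 1" for j
  proof -
    define y where "y = real j powr (1 / (1 + \<epsilon>))"
    have y: "y \<ge> 1" using j eps by (simp add: y_def ge_one_powr_ge_zero)
    have "exp y \<le> real (r j)" unfolding r_def y_def by (rule block_scale_bounds)
    moreover have rpos: "r j > 0"
      using calculation by (metis exp_gt_zero gr0I linorder_not_less of_nat_0)
    ultimately have "y \<le> ln (real (r j))" by (simp add: ln_ge_iff)
    then have lny: "ln y \<le> ln (ln (real (r j)))" using y by simp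
    have lny': "ln y = ln (real j) / (1 + \<epsilon>)"
      using j by (simp add: y_def ln_powr)
    have ll: "ln (ln (real (r j))) \<ge> 0" using lny y ln_ge_zero[of y] by linarith
    have tn: "t j \<ge> 0" using eps V ll by (auto simp: t_def)
    have rV: "real (r j) * V > 0" using rpos V by simp
    have Zeq: "Z j \<omega> = (\<Sum>k<m * r j. c (k div r j) * X k \<omega>)" for \<omega>
      unfolding Z_def walk_def by (rule sum_blocks)
    have var: "real (r j) * V = (\<Sum>k<m * r j. (c (k div r j))\<^sup>2)"
      unfolding V using sum_blocks_const[of "\<lambda>k. (c k)\<^sup>2" "r j" m] by simp
    have "prob (A j) \<le> 2 * exp (- (t j)\<^sup>2 / (2 * (real (r j) * V)))"
      unfolding A_def Zeq using linear_combination_tail_le[OF _ var rV tn] by simp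
    also have "(t j)\<^sup>2 / (2 * (real (r j) * V)) = (1 + \<epsilon>)\<^sup>2 * ln (ln (real (r j)))"
      using rV ll V by (simp add: t_def power_mult_distrib)
    then have "- (t j)\<^sup>2 / (2 * (real (r j) * V)) = - ((1 + \<epsilon>)\<^sup>2 * ln (ln (real (r j))))"
      by simp
    also have "2 * exp (- ((1 + \<epsilon>)\<^sup>2 * ln (ln (real (r j))))) \<le> 2 * exp (- ((1 + \<epsilon>)\<^sup>2 * ln y))"
      using lny by (simp add: mult_left_mono)
    also have "(1 + \<epsilon>)\<^sup>2 * ln y = (1 + \<epsilon>) * ln (real j)"
      using eps by (simp add: lny' power2_eq_square)
    finally show ?thesis
      using j by (simp add: powr_def algebra_simps)
  qed
  have "summable (\<lambda>j. prob (A j))"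
  proof (rule summable_comparison_test_ev)
    show "\<forall>\<^sub>F j in sequentially. norm (prob (A j)) \<le> 2 * real j powr (- (1 + \<epsilon>))"
      using eventually_ge_at_top[of 1] by eventually_elim (use PA in auto)
    show "summable (\<lambda>j. 2 * real j powr (- (1 + \<epsilon>)))"
      using eps by (intro summable_mult) (simp add: summable_real_powr_iff)
  qed
  then have "AE \<omega> in M. \<forall>\<^sub>F j in sequentially. \<omega> \<in> space M - A j"
    using A_sets by (intro borel_cantelli_AE1) (auto simp: less_top[symmetric])
  then show ?thesis
  proof eventually_elim
    case (elim \<omega>)
    then show ?case
      by (rule eventually_mono) (auto simp: A_def Z_def t_def)
  qed
qed

text \<open>The condition \<open>c 0 = 0\<close> confines the j-th combination to the steps from m^j
  up to m^(j+1). These windows are disjoint, so the events are independent. Since ln ln (m^(j+1)) =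
  ln ((j+1) ln m), their probabilities are eventually at least a constant times 1/(j+1), and the
  harmonic series diverges.\<close>

lemma AE_block_combination_lower:
  fixes c :: "nat \<Rightarrow> real" and \<epsilon> :: real
  assumes eps: "0 < \<epsilon>" "\<epsilon> \<le> 1" and V: "V = sq_sum c m" "V > 0" and m: "m \<ge> 2" and c0: "c 0 = 0"
  shows "AE \<omega> in M. infinite {j. (1 - \<epsilon>) * sqrt (2 * real (m ^ j) * V * ln (ln (real (m ^ Suc j))))
     \<le> block_sum c (walk \<omega>) m (m ^ j)}"
proof -
  define Z where "Z j \<omega> = block_sum c (walk \<omega>) m (m ^ j)" for j \<omega>
  define K where "K j = {m ^ j..<m ^ Suc j}" for j
  define t where "t j = (1 - \<epsilon>) * sqrt (2 * real (m ^ j) * V * ln (ln (real (m ^ Suc j))))" for j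
  have Zeq0: "Z j \<omega> = (\<Sum>k<m * m ^ j. c (k div m ^ j) * X k \<omega>)" for j \<omega>
    unfolding Z_def walk_def by (rule sum_blocks)
  \<comment> \<open>For k below m^j the quotient \<open>k div m ^ j\<close> is 0, and there the
    coefficient vanishes.\<close>
  have Zeq: "Z j \<omega> = (\<Sum>k\<in>K j. c (k div m ^ j) * X k \<omega>)" for j \<omega>
    unfolding Zeq0 K_def using c0 by (intro sum.mono_neutral_right) (auto simp: not_le)
  have var: "real (m ^ j) * V = (\<Sum>k<m * m ^ j. (c (k div m ^ j))\<^sup>2)" for j
    unfolding V using sum_blocks_const[of "\<lambda>k. (c k)\<^sup>2" "m ^ j" m] by simp
  have disj: "disjoint_family_on K UNIV"
    unfolding disjoint_family_on_def
  proof (intro ballI impI)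
    fix i j :: nat assume "i \<noteq> j"
    have "K i \<inter> K j = {}" if "i < j" for i j
    proof -
      have "m ^ Suc i \<le> m ^ j" using that m by (intro power_increasing) auto
      then show ?thesis unfolding K_def by auto
    qed
    with \<open>i \<noteq> j\<close> show "K i \<inter> K j = {}" by (metis inf_commute nat_neq_iff)
  qed
  have "indep_vars (\<lambda>j. PiM (K j) (\<lambda>_. borel)) (\<lambda>j \<omega>. restrict (\<lambda>i. X i \<omega>) (K j)) UNIV"
    by (rule indep_vars_restrict[OF indep _ disj]) auto
  then have "indep_vars (\<lambda>_. borel) (\<lambda>j \<omega>. (\<lambda>x. \<Sum>k\<in>K j. c (k div m ^ j) * x k) (restrict (\<lambda>i. X i \<omega>) (K j))) UNIV"
    by (rule indep_vars_compose2) measurable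
  then have indZ: "indep_vars (\<lambda>_. borel) Z UNIV"
    by (rule back_subst[of "\<lambda>Y. indep_vars (\<lambda>_. borel) Y UNIV"]) (auto simp: Zeq fun_eq_iff)
  have indE: "indep_events (\<lambda>j. {\<omega>\<in>space M. t j \<le> Z j \<omega>}) UNIV"
    by (rule indep_eventsI_indep_vars[OF indZ, of "\<lambda>j x. t j \<le> x"]) auto
  define C where "C = 1 / (ln (real m) * sqrt (2 * pi))"
  have C: "C > 0" using m by (simp add: C_def)
  have ev: "\<forall>\<^sub>F j in sequentially. C * (1 / real (Suc j)) \<le> prob {\<omega>\<in>space M. t j \<le> Z j \<omega>}"
  proof -
    have "filterlim (\<lambda>j. ln (real (Suc j) * ln (real m))) at_top sequentially"
      using m by real_asymp
    \<comment> \<open>From y \<ge> 1/\<epsilon>^2 it follows that \<epsilon> sqrt (2 y) \<ge> 1. The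
      gap left by the factor 1 - \<epsilon> then covers the shift by 1 in
      \<open>normal_tail_ge\<close>.\<close>
    then have "\<forall>\<^sub>F j in sequentially. ln (real (Suc j) * ln (real m)) \<ge> (1 / \<epsilon>)\<^sup>2"
      by (simp add: filterlim_at_top)
    then show ?thesis
    proof eventually_elim
      case (elim j)
      define y where "y = ln (real (Suc j) * ln (real m))"
      have yeq: "ln (ln (real (m ^ Suc j))) = y"
        using m by (simp add: y_def ln_realpow del: power_Suc)
      have y: "y \<ge> (1 / \<epsilon>)\<^sup>2" using elim by (simp add: y_def)
      then have y0: "y \<ge> 0" by (smt (verit) zero_le_power2)
      have mV: "real (m ^ j) * V > 0" using m V by simp
      have tj: "t j = (1 - \<epsilon>) * sqrt (2 * y) * sqrt (real (m ^ j) * V)"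
        unfolding t_def yeq by (simp add: real_sqrt_mult)
      have t0: "t j \<ge> 0" using eps y0 V by (simp add: tj)
      have "1 / \<epsilon> \<le> sqrt y" using y by (intro real_le_rsqrt)
      also have "\<dots> \<le> sqrt (2 * y)" using y0 by simp
      finally have "1 \<le> \<epsilon> * sqrt (2 * y)" using eps by (simp add: field_simps)
      moreover have "0 \<le> (1 - \<epsilon>) * sqrt (2 * y)" using eps y0 by simp
      ultimately have "((1 - \<epsilon>) * sqrt (2 * y) + 1)\<^sup>2 \<le> (sqrt (2 * y))\<^sup>2"
        using eps y0 by (intro power_mono) (auto simp: algebra_simps)
      then have "((1 - \<epsilon>) * sqrt (2 * y) + 1)\<^sup>2 / 2 \<le> y" using y0 by simp
      moreover have "t j / sqrt (real (m ^ j) * V) = (1 - \<epsilon>) * sqrt (2 * y)"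
        using mV m V unfolding tj by simp
      ultimately have "exp (- y) \<le> exp (- (t j / sqrt (real (m ^ j) * V) + 1)\<^sup>2 / 2)"
        by simp
      then have "exp (- y) / sqrt (2 * pi)
          \<le> exp (- (t j / sqrt (real (m ^ j) * V) + 1)\<^sup>2 / 2) / sqrt (2 * pi)"
        by (rule divide_right_mono) simp
      also have "\<dots> \<le> prob {\<omega>\<in>space M. t j \<le> Z j \<omega>}"
        unfolding Zeq0
        using normal_tail_ge[OF linear_combination_normal[OF _ var mV] _ t0] mV by simp
      finally have "exp (- y) / sqrt (2 * pi) \<le> prob {\<omega>\<in>space M. t j \<le> Z j \<omega>}" .
      moreover have "exp (- y) / sqrt (2 * pi) = C * (1 / real (Suc j))"
      proof -
        have "exp y = real (Suc j) * ln (real m)"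
          using m by (simp add: y_def)
        then show ?thesis by (simp only: C_def exp_minus) (simp add: divide_simps)
      qed
      ultimately show ?case by simp
    qed
  qed
  have "\<not> summable (\<lambda>j. prob {\<omega>\<in>space M. t j \<le> Z j \<omega>})"
  proof
    assume "summable (\<lambda>j. prob {\<omega>\<in>space M. t j \<le> Z j \<omega>})"
    then have "summable (\<lambda>j. C * (1 / real (Suc j)))"
      by (rule summable_comparison_test_ev[rotated])
         (use ev C in \<open>auto elim!: eventually_mono\<close>)
    then have "summable (\<lambda>j. inverse (real (Suc j)))"
      using C summable_cmult_iff[of C "\<lambda>j. 1 / real (Suc j)"] by (simp add: inverse_eq_divide)
    then show False using not_summable_harmonic[where ?'a=real]
      by (subst (asm) summable_Suc_iff) (simp add: inverse_eq_divide)
  qed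
  from borel_cantelli_AE2[OF indE this] show ?thesis
    unfolding Z_def t_def .
qed

end

section \<open>The Strassen class\<close>

text \<open>\<open>Q t\<close> is the integral of the squared derivative over [0, t]. Exporting only
  its monotonicity and the Cauchy-Schwarz inequality on intervals keeps the derivative out of all
  later estimates.\<close>

lemma strassen_class_energy:
  assumes "f \<in> strassen_class"
  obtains Q :: "real \<Rightarrow> real" where "0 \<le> Q 0" "Q 1 \<le> 1"
    "\<And>s t. 0 \<le> s \<Longrightarrow> s \<le> t \<Longrightarrow> t \<le> 1 \<Longrightarrow> Q s \<le> Q t"
    "\<And>s t. 0 \<le> s \<Longrightarrow> s \<le> t \<Longrightarrow> t \<le> 1 \<Longrightarrow> (f t - f s)\<^sup>2 \<le> (t - s) * (Q t - Q s)"
    "f 0 = 0"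
proof -
  obtain f' where m: "set_borel_measurable lborel {0..1} f'"
    and i: "set_integrable lborel {0..1} (\<lambda>u. (f' u)\<^sup>2)"
    and le1: "(LINT u:{0..1}|lborel. (f' u)\<^sup>2) \<le> 1"
    and f: "\<And>t. t \<in> {0..1} \<Longrightarrow> f t = (LINT u:{0..t}|lborel. f' u)"
    using assms unfolding strassen_class_def by blast
  define g where "g u = indicator {0..1} u * f' u" for u :: real
  have [measurable]: "g \<in> borel_measurable borel"
    using m unfolding set_borel_measurable_def g_def by simp
  have g2: "(g u)\<^sup>2 = indicator {0..1} u * (f' u)\<^sup>2" for u
    by (auto simp: g_def indicator_def)
  have i2: "integrable lborel (\<lambda>u. (g u)\<^sup>2)"
    using i unfolding set_integrable_def g2 by simp
  have ind: "integrable lborel (indicator A :: real \<Rightarrow> real)" if "A \<in> sets borel" "A \<subseteq> {0..1}" for A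
  proof -
    have "emeasure lborel A \<le> emeasure lborel {0..1::real}"
      using that by (intro emeasure_mono) auto
    then have "emeasure lborel A < \<infinity>" by (simp add: le_less_trans)
    then show ?thesis using that by (simp add: integrable_real_indicator)
  qed
  have i1: "integrable lborel g"
  proof (rule Bochner_Integration.integrable_bound)
    show "integrable lborel (\<lambda>u. indicator {0..1} u + (g u)\<^sup>2)"
      using ind[of "{0..1}"] i2 by auto
    have "\<bar>g u\<bar> \<le> indicator {0..1} u + (g u)\<^sup>2" for u
    proof (cases "u \<in> {0..1}")
      case True
      \<comment> \<open>Square integrability on an interval of length 1 yields integrability by
        completing the square.\<close>
      have "0 \<le> (\<bar>g u\<bar> - 1/2)\<^sup>2" by simp
      then have "\<bar>g u\<bar> \<le> 1/4 + (g u)\<^sup>2" by (simp add: power2_eq_square algebra_simps)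
      then show ?thesis using True by simp
    qed (simp add: g_def)
    then show "AE u in lborel. norm (g u) \<le> norm (indicator {0..1} u + (g u)\<^sup>2)"
      by (auto simp: indicator_def)
  qed simp
  define Q where "Q t = (LINT u|lborel. indicator {0..t} u * (g u)\<^sup>2)" for t :: real
  have fg: "f t = (LINT u|lborel. indicator {0..t} u * g u)" if "t \<in> {0..1}" for t
  proof -
    have "f t = (LINT u|lborel. indicator {0..t} u * f' u)"
      using f[OF that] by (simp add: set_lebesgue_integral_def)
    also have "\<dots> = (LINT u|lborel. indicator {0..t} u * g u)"
      using that by (intro Bochner_Integration.integral_cong) (auto simp: g_def indicator_def)
    finally show ?thesis .
  qed
  have int1: "integrable lborel (\<lambda>u. indicator A u * g u)" if "A \<in> sets borel" for A
    using integrable_mult_indicator[of A lborel g] i1 that by simp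
  have int2: "integrable lborel (\<lambda>u. indicator A u * (g u)\<^sup>2)" if "A \<in> sets borel" for A
    using integrable_mult_indicator[of A lborel "\<lambda>u. (g u)\<^sup>2"] i2 that by simp
  have diff: "(LINT u|lborel. indicator {0..t} u * h u) - (LINT u|lborel. indicator {0..s} u * h u)
      = (LINT u|lborel. indicator {s<..t} u * h u)"
    if "\<And>A. A \<in> sets borel \<Longrightarrow> integrable lborel (\<lambda>u. indicator A u * h u)" "0 \<le> s" "s \<le> t"
    for h :: "real \<Rightarrow> real" and s t :: real
  proof -
    have "(LINT u|lborel. indicator {0..t} u * h u) - (LINT u|lborel. indicator {0..s} u * h u)
        = (LINT u|lborel. indicator {0..t} u * h u - indicator {0..s} u * h u)"
      by (rule Bochner_Integration.integral_diff[symmetric]; rule that(1); simp)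
    also have "\<dots> = (LINT u|lborel. indicator {s<..t} u * h u)"
      using that(2,3) by (intro Bochner_Integration.integral_cong) (auto simp: indicator_def)
    finally show ?thesis .
  qed
  show ?thesis
  proof (rule that[of Q])
    show "0 \<le> Q 0" unfolding Q_def by (intro integral_nonneg_AE) auto
    have "Q 1 = (LINT u:{0..1}|lborel. (f' u)\<^sup>2)"
      unfolding Q_def set_lebesgue_integral_def g2
      by (intro Bochner_Integration.integral_cong) (auto simp: indicator_def)
    then show "Q 1 \<le> 1" using le1 by simp
    have "f 0 = (LINT u|lborel. indicator {0} u * g u)" using fg[of 0] by simp
    also have "\<dots> = (LINT u|(lborel :: real measure). 0)"
    proof (rule Bochner_Integration.integral_cong_AE)
      show "AE u in lborel. indicator {0} u * g u = 0"
        using AE_lborel_singleton[of "0::real"] by eventually_elim (simp add: indicator_def)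
    qed auto
    finally show "f 0 = 0" by simp
    fix s t :: real assume st: "0 \<le> s" "s \<le> t" "t \<le> 1"
    have Qd: "Q t - Q s = (LINT u|lborel. indicator {s<..t} u * (g u)\<^sup>2)"
      unfolding Q_def by (rule diff[OF int2 st(1,2)])
    have "0 \<le> (LINT u|lborel. indicator {s<..t} u * (g u)\<^sup>2)"
      by (intro integral_nonneg_AE) auto
    then show "Q s \<le> Q t" using Qd by linarith
    have fd: "f t - f s = (LINT u|lborel. indicator {s<..t} u * g u)"
      using fg[of s] fg[of t] st diff[OF int1 st(1,2)] by simp
    show "(f t - f s)\<^sup>2 \<le> (t - s) * (Q t - Q s)"
    proof (cases "s = t")
      case False
      define I where "I = f t - f s"
      \<comment> \<open>The mean slope minimises the integral of (g - c)^2; nonnegativity of this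
        minimum is the Cauchy-Schwarz inequality.\<close>
      define c where "c = I / (t - s)"
      have cI: "c * (t - s) = I" using False by (simp add: c_def)
      have "0 \<le> (LINT u|lborel. indicator {s<..t} u * (g u - c)\<^sup>2)"
        by (intro integral_nonneg_AE) auto
      also have "\<dots> = (LINT u|lborel. indicator {s<..t} u * (g u)\<^sup>2 - 2 * c * (indicator {s<..t} u * g u)
          + c\<^sup>2 * indicator {s<..t} u)"
        by (intro Bochner_Integration.integral_cong) (auto simp: power2_diff algebra_simps)
      also have "\<dots> = (Q t - Q s) - 2 * c * I + c\<^sup>2 * (t - s)"
        using int1[of "{s<..t}"] int2[of "{s<..t}"] ind[of "{s<..t}"] st
        by (simp add: Qd fd I_def)
      finally have "0 \<le> (t - s) * ((Q t - Q s) - 2 * c * I + c\<^sup>2 * (t - s))"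
        using st by (intro mult_nonneg_nonneg) auto
      also have "\<dots> = (t - s) * (Q t - Q s) - 2 * (c * (t - s)) * I + (c * (t - s))\<^sup>2"
        by (simp add: power2_eq_square algebra_simps)
      also have "\<dots> = (t - s) * (Q t - Q s) - I\<^sup>2"
        unfolding cI by (simp add: power2_eq_square)
      finally show ?thesis by (simp add: I_def)
    qed simp
  qed
qed

lemma strassen_class_0: "f \<in> strassen_class \<Longrightarrow> f 0 = 0"
  by (rule strassen_class_energy)

lemma strassen_class_Holder:
  assumes f: "f \<in> strassen_class" and st: "s \<in> {0..1}" "t \<in> {0..1}"
  shows "\<bar>f t - f s\<bar> \<le> sqrt \<bar>t - s\<bar>"
proof -
  obtain Q :: "real \<Rightarrow> real" where Q: "0 \<le> Q 0" "Q 1 \<le> 1"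
    "\<And>s t. 0 \<le> s \<Longrightarrow> s \<le> t \<Longrightarrow> t \<le> 1 \<Longrightarrow> Q s \<le> Q t"
    "\<And>s t. 0 \<le> s \<Longrightarrow> s \<le> t \<Longrightarrow> t \<le> 1 \<Longrightarrow> (f t - f s)\<^sup>2 \<le> (t - s) * (Q t - Q s)"
    using strassen_class_energy[OF f] by metis
  have *: "\<bar>f t - f s\<bar> \<le> sqrt (t - s)" if "0 \<le> s" "s \<le> t" "t \<le> 1" for s t
  proof -
    have "Q t - Q s \<le> 1" using Q(1,2) Q(3)[of t 1] Q(3)[of 0 s] that by linarith
    then have "(t - s) * (Q t - Q s) \<le> (t - s) * 1" using that by (intro mult_left_mono) auto
    then have "(f t - f s)\<^sup>2 \<le> t - s" using order_trans[OF Q(4)[OF that]] by simp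
    then show ?thesis by (simp add: real_le_rsqrt)
  qed
  show ?thesis
  proof (cases "s \<le> t")
    case True then show ?thesis using *[of s t] st by simp
  next
    case False then show ?thesis using *[of t s] st by (simp add: abs_minus_commute)
  qed
qed

lemma strassen_class_continuous:
  assumes f: "f \<in> strassen_class"
  shows "continuous_on {0..1} f"
  unfolding continuous_on_iff
proof (intro ballI allI impI)
  fix x e :: real assume "x \<in> {0..1}" "e > 0"
  have "dist (f y) (f x) < e" if "y \<in> {0..1}" "dist y x < e\<^sup>2" for y
  proof -
    have "\<bar>f y - f x\<bar> \<le> sqrt \<bar>y - x\<bar>" by (rule strassen_class_Holder[OF f]) fact+
    also have "\<dots> < sqrt (e\<^sup>2)" using that by (simp only: real_sqrt_less_iff dist_real_def)
    finally show ?thesis using \<open>e > 0\<close> by (simp add: dist_real_def)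
  qed
  then show "\<exists>d>0. \<forall>y\<in>{0..1}. dist y x < d \<longrightarrow> dist (f y) (f x) < e"
    using \<open>e > 0\<close> by (intro exI[of _ "e\<^sup>2"]) auto
qed

text \<open>Cauchy-Schwarz on each cell of length 1/m bounds the summand by an increment of
  \<open>Q\<close>, and these telescope.\<close>

lemma strassen_class_grid_energy:
  assumes f: "f \<in> strassen_class" and m: "m > 0"
  shows "real m * (\<Sum>i<m. (f (real (Suc i) / real m) - f (real i / real m))\<^sup>2) \<le> 1"
proof -
  obtain Q :: "real \<Rightarrow> real" where Q: "0 \<le> Q 0" "Q 1 \<le> 1"
    "\<And>s t. 0 \<le> s \<Longrightarrow> s \<le> t \<Longrightarrow> t \<le> 1 \<Longrightarrow> (f t - f s)\<^sup>2 \<le> (t - s) * (Q t - Q s)"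
    using strassen_class_energy[OF f] by metis
  have "real m * (\<Sum>i<m. (f (real (Suc i) / real m) - f (real i / real m))\<^sup>2)
      \<le> (\<Sum>i<m. Q (real (Suc i) / real m) - Q (real i / real m))"
    unfolding sum_distrib_left
  proof (rule sum_mono)
    fix i assume i: "i \<in> {..<m}"
    have "real (Suc i) / real m - real i / real m = 1 / real m"
      by (simp flip: diff_divide_distrib)
    then have "(f (real (Suc i) / real m) - f (real i / real m))\<^sup>2
        \<le> 1 / real m * (Q (real (Suc i) / real m) - Q (real i / real m))"
      using Q(3)[of "real i / real m" "real (Suc i) / real m"] i by (auto simp: divide_simps)
    then show "real m * (f (real (Suc i) / real m) - f (real i / real m))\<^sup>2
        \<le> Q (real (Suc i) / real m) - Q (real i / real m)"
      using m by (simp add: field_simps)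
  qed
  also have "\<dots> = Q (real m / real m) - Q (real 0 / real m)"
    by (rule sum_lessThan_telescope)
  also have "\<dots> \<le> 1" using m Q by simp
  finally show ?thesis .
qed

section \<open>Interpolating slopes on grids and a Riesz criterion for membership in the
  class\<close>

text \<open>The cells with i < n are open on the left, so they tile (0, 1] without overlap and stay
  away from the singularity of 1/u at 0.\<close>

definition grid_cell :: "nat \<Rightarrow> nat \<Rightarrow> real set" where
  "grid_cell n i = {real i / real n<..real (Suc i) / real n}"

text \<open>This is the derivative of the piecewise linear interpolation of f at the points i/n,
  extended by 0. For n > 0 and f 0 = 0, \<open>grid_energy\<close> is the square of its
  L2-norm.\<close>

definition grid_slope :: "(real \<Rightarrow> real) \<Rightarrow> nat \<Rightarrow> real \<Rightarrow> real" where
  "grid_slope f n u = (\<Sum>i<n. real n * (f (real (Suc i) / real n) - f (real i / real n)) * indicator (grid_cell n i) u)"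

definition grid_energy :: "(real \<Rightarrow> real) \<Rightarrow> nat \<Rightarrow> real" where
  "grid_energy f n = real n * (\<Sum>i<n. (f (real (Suc i) / real n) - f (real i / real n))\<^sup>2)"

lemma grid_cell_sets [measurable]: "grid_cell n i \<in> sets borel"
  by (simp add: grid_cell_def)

lemma grid_cell_pos: "u \<in> grid_cell n i \<Longrightarrow> 0 < u"
  unfolding grid_cell_def by (auto intro: le_less_trans[rotated])

lemma integrable_indicator_Ioc: "integrable lborel (indicator {a<..b} :: real \<Rightarrow> real)"
  by (cases "a \<le> b") (auto intro!: integrable_real_indicator)

lemma grid_slope_measurable [measurable]: "grid_slope f n \<in> borel_measurable borel"
  unfolding grid_slope_def by measurable

lemma integrable_grid_cell_mult:
  assumes "integrable lborel (h :: real \<Rightarrow> real)"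
  shows "integrable lborel (\<lambda>u. indicator (grid_cell n i) u * h u)"
  using integrable_mult_indicator[of "grid_cell n i" lborel h] assms by simp

lemma integrable_grid_slope_mult:
  assumes "integrable lborel h"
  shows "integrable lborel (\<lambda>u. grid_slope f n u * h u)"
  unfolding grid_slope_def sum_distrib_right mult.assoc
  using integrable_grid_cell_mult[OF assms] by (intro Bochner_Integration.integrable_sum) auto

lemma integral_grid_slope_mult:
  assumes "integrable lborel h"
  shows "(LINT u|lborel. grid_slope f n u * h u) =
    (\<Sum>i<n. real n * (f (real (Suc i) / real n) - f (real i / real n)) * (LINT u|lborel. indicator (grid_cell n i) u * h u))"
proof -
  have "(LINT u|lborel. grid_slope f n u * h u) =
      (LINT u|lborel. (\<Sum>i<n. real n * (f (real (Suc i) / real n) - f (real i / real n)) * (indicator (grid_cell n i) u * h u)))"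
    by (simp add: grid_slope_def sum_distrib_right mult.assoc)
  also have "\<dots> = (\<Sum>i<n. LINT u|lborel. real n * (f (real (Suc i) / real n) - f (real i / real n)) * (indicator (grid_cell n i) u * h u))"
    using integrable_grid_cell_mult[OF assms] by (intro Bochner_Integration.integral_sum) auto
  finally show ?thesis by simp
qed

lemma integrable_grid_slope: "integrable lborel (grid_slope f n)"
  unfolding grid_slope_def
  by (intro Bochner_Integration.integrable_sum integrable_mult_right) (simp add: grid_cell_def integrable_indicator_Ioc del: of_nat_Suc)

lemma grid_slope_outside: "u \<notin> {0<..1} \<Longrightarrow> grid_slope f n u = 0"
  unfolding grid_slope_def
proof (intro sum.neutral ballI)
  fix i assume u: "u \<notin> {0<..1}" and i: "i \<in> {..<n}"
  have "real (Suc i) / real n \<le> 1" using i by (auto simp: divide_simps)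
  then have "u \<notin> grid_cell n i" using u grid_cell_pos[of u n i] by (auto simp: grid_cell_def)
  then show "real n * (f (real (Suc i) / real n) - f (real i / real n)) * indicator (grid_cell n i) u = 0"
    by simp
qed

lemma integral_grid_slope:
  assumes "n > 0" "k \<le> n" "f 0 = 0"
  shows "(LINT u|lborel. grid_slope f n u * indicator {0<..real k / real n} u) = f (real k / real n)"
proof -
  have cell: "(LINT u|lborel. indicator (grid_cell n i) u * indicator {0<..real k / real n} u)
      = (if i < k then 1 / real n else 0)" for i
  proof (cases "i < k")
    case True
    then have "real (Suc i) / real n \<le> real k / real n" using assms by (intro divide_right_mono) auto
    then have "grid_cell n i \<subseteq> {0<..real k / real n}"
      using grid_cell_pos by (auto simp: grid_cell_def)
    then have "indicator (grid_cell n i) u * indicator {0<..real k / real n} u = (indicator (grid_cell n i) u :: real)" for u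
      by (auto simp: indicator_def)
    then have "(LINT u|lborel. indicator (grid_cell n i) u * indicator {0<..real k / real n} u)
        = (LINT u|lborel. (indicator (grid_cell n i) u :: real))"
      by (simp only:)
    also have "\<dots> = 1 / real n"
      using assms by (simp add: grid_cell_def divide_right_mono flip: diff_divide_distrib)
    finally show ?thesis using True by simp
  next
    case False
    then have "real k / real n \<le> real i / real n" using assms by (intro divide_right_mono) auto
    then have "indicator (grid_cell n i) u * indicator {0<..real k / real n} u = (0::real)" for u
      unfolding grid_cell_def indicator_def by auto
    then have "(LINT u|lborel. indicator (grid_cell n i) u * indicator {0<..real k / real n} u)
        = (LINT u|(lborel :: real measure). (0 :: real))"
      by (simp only:)
    then show ?thesis using False by simp
  qed
  have "(LINT u|lborel. grid_slope f n u * indicator {0<..real k / real n} u)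
    = (\<Sum>i<n. real n * (f (real (Suc i) / real n) - f (real i / real n)) * (if i < k then 1 / real n else 0))"
    by (subst integral_grid_slope_mult) (auto simp: cell integrable_indicator_Ioc)
  also have "\<dots> = (\<Sum>i<k. f (real (Suc i) / real n) - f (real i / real n))"
    using assms by (intro sum.mono_neutral_cong_right) auto
  also have "\<dots> = f (real k / real n)"
    using assms sum_lessThan_telescope[of "\<lambda>i. f (real i / real n)" k] by simp
  finally show ?thesis .
qed

text \<open>The coarse slope is the orthogonal projection of the fine slope onto step functions on
  the coarse grid: both have the same integral over each coarse cell, namely the increment of
  f.\<close>

lemma integral_grid_slope_refine:
  assumes m: "m > 0" and d: "d > 0" and f0: "f 0 = 0"
  shows "(LINT u|lborel. grid_slope f m u * grid_slope f (m * d) u) = grid_energy f m"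
proof -
  have cell: "(LINT u|lborel. indicator (grid_cell m i) u * grid_slope f (m * d) u)
      = f (real (Suc i) / real m) - f (real i / real m)" if "i < m" for i
  proof -
    have G: "(LINT u|lborel. grid_slope f (m * d) u * indicator {0<..real i / real m} u) = f (real i / real m)"
      if "i \<le> m" for i
      using integral_grid_slope[of "m * d" "i * d" f] that m d f0 by simp
    have int: "integrable lborel (\<lambda>u. grid_slope f (m * d) u * indicator {0<..x} u)" for x
      by (intro integrable_grid_slope_mult integrable_indicator_Ioc)
    have le: "0 \<le> real i / real m" "real i / real m \<le> real (Suc i) / real m"
      using m by (auto simp: divide_right_mono)
    have "(LINT u|lborel. indicator (grid_cell m i) u * grid_slope f (m * d) u)
       = (LINT u|lborel. grid_slope f (m * d) u * indicator {0<..real (Suc i) / real m} u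
            - grid_slope f (m * d) u * indicator {0<..real i / real m} u)"
      using le grid_slope_outside[of _ f "m * d"]
      by (intro Bochner_Integration.integral_cong) (auto simp: grid_cell_def indicator_def)
    also have "\<dots> = f (real (Suc i) / real m) - f (real i / real m)"
      using that by (subst Bochner_Integration.integral_diff) (auto simp only: int G Suc_leI less_imp_le)
    finally show ?thesis .
  qed
  show ?thesis
    by (subst integral_grid_slope_mult[OF integrable_grid_slope])
       (simp add: cell grid_energy_def sum_distrib_left power2_eq_square mult.assoc)
qed

lemma integral_grid_slope_square:
  assumes "m > 0" "f 0 = 0"
  shows "integrable lborel (\<lambda>u. (grid_slope f m u)\<^sup>2)" "(LINT u|lborel. (grid_slope f m u)\<^sup>2) = grid_energy f m"
  using integral_grid_slope_refine[of m 1 f] assms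
    integrable_grid_slope_mult[OF integrable_grid_slope, of f m f m]
  by (simp_all add: power2_eq_square)

text \<open>Pythagoras for the projection in \<open>integral_grid_slope_refine\<close>.\<close>

lemma integral_grid_slope_diff:
  assumes m: "m > 0" and d: "d > 0" and f0: "f 0 = 0"
  shows "integrable lborel (\<lambda>u. (grid_slope f (m * d) u - grid_slope f m u)\<^sup>2)"
    "(LINT u|lborel. (grid_slope f (m * d) u - grid_slope f m u)\<^sup>2) = grid_energy f (m * d) - grid_energy f m"
proof -
  have eq: "(grid_slope f (m * d) u - grid_slope f m u)\<^sup>2
    = (grid_slope f (m * d) u)\<^sup>2 - 2 * (grid_slope f m u * grid_slope f (m * d) u) + (grid_slope f m u)\<^sup>2" for u
    by (simp add: power2_eq_square algebra_simps)
  note ints = integral_grid_slope_square[of m f] integral_grid_slope_square[of "m * d" f]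
    integrable_grid_slope_mult[OF integrable_grid_slope, of f m f "m * d"]
  show "integrable lborel (\<lambda>u. (grid_slope f (m * d) u - grid_slope f m u)\<^sup>2)"
    unfolding eq using ints m d f0 by auto
  show "(LINT u|lborel. (grid_slope f (m * d) u - grid_slope f m u)\<^sup>2) = grid_energy f (m * d) - grid_energy f m"
    unfolding eq using ints m d f0 integral_grid_slope_refine[of m d f] by simp
qed

text \<open>The dyadic slopes form a martingale bounded in L2. By
  \<open>integral_grid_slope_diff\<close>, increasing energies with a finite limit make them Cauchy;
  along a fast subsequence they converge almost everywhere and under an integrable majorant. The
  limit is the required derivative, first at dyadic points and then everywhere by continuity, and
  Fatou bounds its energy.\<close>

lemma strassen_classI_grid_energy:
  assumes cont: "continuous_on {0..1} f" and f0: "f 0 = 0"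
    and energy: "\<And>p. grid_energy f (2 ^ p) \<le> 1"
  shows "f \<in> strassen_class"
proof -
  define e where "e p = grid_energy f (2 ^ p)" for p :: nat
  have refine: "integrable lborel (\<lambda>u. (grid_slope f (2 ^ q) u - grid_slope f (2 ^ p) u)\<^sup>2)"
    "(LINT u|lborel. (grid_slope f (2 ^ q) u - grid_slope f (2 ^ p) u)\<^sup>2) = e q - e p" if "p \<le> q" for p q :: nat
  proof -
    have "(2::nat) ^ q = 2 ^ p * 2 ^ (q - p)" using that by (simp flip: power_add)
    then show "integrable lborel (\<lambda>u. (grid_slope f (2 ^ q) u - grid_slope f (2 ^ p) u)\<^sup>2)"
      "(LINT u|lborel. (grid_slope f (2 ^ q) u - grid_slope f (2 ^ p) u)\<^sup>2) = e q - e p"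
      using integral_grid_slope_diff[of "2 ^ p" "2 ^ (q - p)" f] f0 by (simp_all add: e_def)
  qed
  have mono: "e p \<le> e q" if "p \<le> q" for p q
    using refine(2)[OF that] integral_nonneg_AE[of "\<lambda>u. (grid_slope f (2 ^ q) u - grid_slope f (2 ^ p) u)\<^sup>2" lborel]
    by simp
  have "incseq e" using mono by (auto simp: incseq_def)
  then obtain E where E: "e \<longlonglongrightarrow> E" "\<And>p. e p \<le> E"
    using incseq_convergent[of e 1] energy unfolding e_def by blast
  \<comment> \<open>The rate 4^-k for the energy defect gives L1-increments of order 2^-k, which are
    summable.\<close>
  have "\<exists>p. \<forall>k. E - e (p k) \<le> (1/4) ^ k \<and> p k < p (Suc k)"
  proof (rule dependent_nat_choice)
    have ex: "\<exists>p>q. E - e p \<le> (1/4) ^ k" for k q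
    proof -
      have "eventually (\<lambda>p. E - (1/4) ^ k < e p) sequentially"
        by (rule order_tendstoD[OF E(1)]) simp
      then have "eventually (\<lambda>p. E - (1/4) ^ k < e p \<and> p > q) sequentially"
        using eventually_gt_at_top[of q] by eventually_elim auto
      then obtain p where "E - (1/4) ^ k < e p \<and> p > q"
        using eventually_happens'[OF sequentially_bot] by blast
      then show ?thesis by (intro exI[of _ p]) auto
    qed
    show "\<exists>p. E - e p \<le> (1/4) ^ 0" using ex[of 0 0] by blast
    show "\<exists>q. E - e q \<le> (1/4) ^ Suc k \<and> p < q" for p k using ex[where q=p and k="Suc k"] by blast
  qed
  then obtain p where p: "\<And>k. E - e (p k) \<le> (1/4) ^ k" "\<And>k. p k < p (Suc k)" by blast
  then have pmono: "strict_mono p" by (simp add: strict_mono_Suc_iff)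
  define h where "h k = grid_slope f (2 ^ p k)" for k
  have [measurable]: "h k \<in> borel_measurable borel" for k by (simp add: h_def)
  have h_int: "integrable lborel (h k)" for k unfolding h_def by (rule integrable_grid_slope)
  have h_out: "h k u = 0" if "u \<notin> {0<..1}" for k u unfolding h_def by (rule grid_slope_outside[OF that])
  define d where "d k u = h (Suc k) u - h k u" for k u
  have [measurable]: "d k \<in> borel_measurable borel" for k unfolding d_def by measurable
  have d_int: "integrable lborel (d k)" for k unfolding d_def using h_int by auto
  have d_L1: "(LINT u|lborel. \<bar>d k u\<bar>) \<le> (1/2) ^ k" for k
  proof -
    have i2: "integrable lborel (\<lambda>u. (d k u)\<^sup>2)" and "(LINT u|lborel. (d k u)\<^sup>2) = e (p (Suc k)) - e (p k)"
      using refine[of "p k" "p (Suc k)"] p(2)[of k] by (simp_all add: d_def h_def)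
    then have L2: "(LINT u|lborel. (d k u)\<^sup>2) \<le> (1/4) ^ k"
      using p(1)[of k] E(2)[of "p (Suc k)"] by linarith
    have pt: "\<bar>d k u\<bar> \<le> (1/2) ^ k / 2 * indicator {0<..1} u + 2 ^ k / 2 * (d k u)\<^sup>2" for u
    proof (cases "u \<in> {0<..1}")
      case True
      define x where "x = \<bar>d k u\<bar>"
      define c :: real where "c = 2 ^ k"
      have c: "c > 0" "(1/2) ^ k = 1 / c" by (simp_all add: c_def power_divide)
      \<comment> \<open>A weighted arithmetic-geometric mean replaces Cauchy-Schwarz. The weight 2^k
        balances the two terms when the energy increment is 4^-k.\<close>
      have "0 \<le> (c * x - 1)\<^sup>2" by simp
      then have "2 * c * x \<le> 1 + c\<^sup>2 * x\<^sup>2" by (simp add: power2_eq_square algebra_simps)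
      then have "x \<le> 1 / c / 2 + c / 2 * x\<^sup>2" using c by (simp add: field_simps power2_eq_square)
      then show ?thesis using True c by (simp add: x_def c_def)
    next
      case False
      then show ?thesis using h_out[OF False] by (simp add: d_def)
    qed
    have "(LINT u|lborel. \<bar>d k u\<bar>) \<le> (LINT u|lborel. (1/2) ^ k / 2 * indicator {0<..1} u + 2 ^ k / 2 * (d k u)\<^sup>2)"
      using i2 d_int[of k] integrable_indicator_Ioc[of 0 1] by (intro integral_mono pt) auto
    also have "\<dots> = (1/2) ^ k / 2 + 2 ^ k / 2 * (LINT u|lborel. (d k u)\<^sup>2)"
      using i2 integrable_indicator_Ioc[of 0 1] by simp
    also have "\<dots> \<le> (1/2) ^ k / 2 + 2 ^ k / 2 * (1/4) ^ k"
      using L2 by (intro add_left_mono mult_left_mono) auto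
    also have "2 ^ k / 2 * (1/4) ^ k = (1/2 :: real) ^ k / 2"
      by (simp flip: power_mult_distrib)
    finally show ?thesis by simp
  qed
  have sums_d: "summable (\<lambda>k. LINT u|lborel. \<bar>d k u\<bar>)"
    by (rule summable_comparison_test'[of "\<lambda>k. (1/2) ^ k" 0]) (use d_L1 in auto)
  have AE_d: "AE u in lborel. summable (\<lambda>k. \<bar>d k u\<bar>)"
  proof -
    have "(\<integral>\<^sup>+u. (\<Sum>k. ennreal \<bar>d k u\<bar>) \<partial>lborel) = (\<Sum>k. \<integral>\<^sup>+u. ennreal \<bar>d k u\<bar> \<partial>lborel)"
      by (intro nn_integral_suminf) auto
    also have "\<dots> = (\<Sum>k. ennreal (LINT u|lborel. \<bar>d k u\<bar>))"
      using d_int by (subst nn_integral_eq_integral) auto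
    also have "\<dots> \<noteq> \<infinity>"
      using sums_d by (intro ennreal_suminf_neq_top[unfolded infinity_ennreal_def[symmetric]]) auto
    finally have "AE u in lborel. (\<Sum>k. ennreal \<bar>d k u\<bar>) \<noteq> \<infinity>"
      by (intro nn_integral_PInf_AE) auto
    then show ?thesis
      by eventually_elim (intro summable_suminf_not_top, auto)
  qed
  define g where "g u = h 0 u + (\<Sum>k. d k u)" for u
  have g_meas[measurable]: "g \<in> borel_measurable borel" unfolding g_def by measurable
  have g_int: "integrable lborel g"
    unfolding g_def using integrable_suminf[OF d_int, of] AE_d sums_d h_int
    by (intro Bochner_Integration.integrable_add) auto
  have h_lim: "AE u in lborel. (\<lambda>k. h k u) \<longlonglongrightarrow> g u"
    using AE_d
  proof eventually_elim
    case (elim u)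
    then have "summable (\<lambda>k. d k u)" by (rule summable_rabs_cancel)
    then have "(\<lambda>n. \<Sum>k<n. d k u) \<longlonglongrightarrow> (\<Sum>k. d k u)" by (rule summable_LIMSEQ)
    then have "(\<lambda>n. h 0 u + (\<Sum>k<n. d k u)) \<longlonglongrightarrow> g u" unfolding g_def by (intro tendsto_intros)
    moreover have "h 0 u + (\<Sum>k<n. d k u) = h n u" for n
      unfolding d_def by (subst sum_lessThan_telescope) simp
    ultimately show ?case by simp
  qed
  \<comment> \<open>The majorant is the total variation of the telescoping series along k, which is
    integrable because the L1-norms of the \<open>d k\<close> are summable.\<close>
  have int_lim: "(\<lambda>n. LINT u|lborel. indicator A u * h n u) \<longlonglongrightarrow> (LINT u|lborel. indicator A u * g u)"
    if A: "A \<in> sets borel" for A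
  proof (rule integral_dominated_convergence[where w="\<lambda>u. \<bar>h 0 u\<bar> + (\<Sum>k. \<bar>d k u\<bar>)"])
    show "integrable lborel (\<lambda>u. \<bar>h 0 u\<bar> + (\<Sum>k. \<bar>d k u\<bar>))"
      using h_int[of 0] integrable_suminf[of lborel "\<lambda>k u. \<bar>d k u\<bar>"] d_int AE_d sums_d
      by (intro Bochner_Integration.integrable_add) auto
    show "AE u in lborel. (\<lambda>n. indicator A u * h n u) \<longlonglongrightarrow> indicator A u * g u"
      using h_lim by eventually_elim (intro tendsto_intros)
    fix n
    show "AE u in lborel. norm (indicator A u * h n u) \<le> \<bar>h 0 u\<bar> + (\<Sum>k. \<bar>d k u\<bar>)"
      using AE_d
    proof eventually_elim
      case (elim u)
      have "h n u = h 0 u + (\<Sum>k<n. d k u)"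
        unfolding d_def by (subst sum_lessThan_telescope) simp
      moreover have "\<bar>\<Sum>k<n. d k u\<bar> \<le> (\<Sum>k<n. \<bar>d k u\<bar>)" by (rule sum_abs)
      moreover have "(\<Sum>k<n. \<bar>d k u\<bar>) \<le> (\<Sum>k. \<bar>d k u\<bar>)"
        using elim by (intro sum_le_suminf) auto
      moreover have "norm (indicator A u * h n u) \<le> \<bar>h n u\<bar>" by (simp add: indicator_def)
      ultimately show ?case by linarith
    qed
  qed (use A in auto)
  have dyadic: "(LINT u|lborel. indicator {0<..real i / 2 ^ q} u * g u) = f (real i / 2 ^ q)" if "i \<le> 2 ^ q" for i q :: nat
  proof -
    \<comment> \<open>Once the grid of \<open>h n\<close> refines the mesh 2^-q the integral
      telescopes exactly, so the sequence is eventually constant. For n \<ge> q this holds because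
      \<open>p n\<close> is at least n.\<close>
    have "(LINT u|lborel. indicator {0<..real i / 2 ^ q} u * h n u) = f (real i / 2 ^ q)" if "n \<ge> q" for n
    proof -
      have "q \<le> p n" using that strict_mono_imp_increasing[OF pmono, of n] by linarith
      then have e: "(2::nat) ^ p n = 2 ^ q * 2 ^ (p n - q)" by (simp flip: power_add)
      have r: "real (i * 2 ^ (p n - q)) / real (2 ^ p n) = real i / 2 ^ q" unfolding e by simp
      have "i * 2 ^ (p n - q) \<le> 2 ^ p n" unfolding e using \<open>i \<le> 2 ^ q\<close> by simp
      then have "(LINT u|lborel. grid_slope f (2 ^ p n) u * indicator {0<..real (i * 2 ^ (p n - q)) / real (2 ^ p n)} u)
          = f (real (i * 2 ^ (p n - q)) / real (2 ^ p n))"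
        by (intro integral_grid_slope f0) auto
      then show ?thesis unfolding r by (simp add: h_def mult.commute)
    qed
    then have "(\<lambda>n. LINT u|lborel. indicator {0<..real i / 2 ^ q} u * h n u) \<longlonglongrightarrow> f (real i / 2 ^ q)"
      by (intro tendsto_eventually) (auto simp: eventually_sequentially)
    then show ?thesis using LIMSEQ_unique[OF int_lim[of "{0<..real i / 2 ^ q}"]] by auto
  qed
  have ft: "(LINT u|lborel. indicator {0<..t} u * g u) = f t" if t: "t \<in> {0..1}" for t
  proof -
    define i where "i q = nat \<lfloor>2 ^ q * t\<rfloor>" for q
    define s where "s q = real (i q) / 2 ^ q" for q
    have i: "real (i q) \<le> 2 ^ q * t" "2 ^ q * t \<le> real (i q) + 1" for q
    proof -
      have "0 \<le> 2 ^ q * t" using t by simp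
      then show "real (i q) \<le> 2 ^ q * t" "2 ^ q * t \<le> real (i q) + 1"
        unfolding i_def by linarith+
    qed
    have s1: "s q \<le> t" "t - s q \<le> (1/2) ^ q" for q
    proof -
      show "s q \<le> t" using i(1)[of q] by (simp add: s_def divide_le_eq mult.commute)
      have "t \<le> (real (i q) + 1) / 2 ^ q" using i(2)[of q] by (simp add: le_divide_eq mult.commute)
      then show "t - s q \<le> (1/2) ^ q" by (simp add: s_def add_divide_distrib power_divide)
    qed
    have "2 ^ q * t \<le> (2::real) ^ q * 1" for q using t by (intro mult_left_mono) auto
    then have "real (i q) \<le> 2 ^ q" for q using i(1)[of q] by (metis mult_1_right order_trans)
    then have i': "i q \<le> 2 ^ q" for q by (metis of_nat_le_iff of_nat_numeral of_nat_power)
    have s01: "s q \<in> {0..1}" for q using i'[of q] by (auto simp: s_def)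
    have "(\<lambda>q. t - s q) \<longlonglongrightarrow> 0"
      by (rule tendsto_sandwich[of "\<lambda>_. 0" _ _ "\<lambda>q. (1/2) ^ q"]) (use s1 in \<open>auto intro!: LIMSEQ_power_zero\<close>)
    then have slim: "s \<longlonglongrightarrow> t" using tendsto_diff[of "\<lambda>_. t" t sequentially "\<lambda>q. t - s q" 0] by simp
    then have "(\<lambda>q. f (s q)) \<longlonglongrightarrow> f t"
      using continuous_on_tendsto_compose[OF cont slim t] s01 by auto
    moreover have "(\<lambda>q. LINT u|lborel. indicator {0<..s q} u * g u) \<longlonglongrightarrow> (LINT u|lborel. indicator {0<..t} u * g u)"
    proof (rule integral_dominated_convergence[where w="\<lambda>u. \<bar>g u\<bar>"])
      \<comment> \<open>The point u = t is left out: if t is not dyadic it lies outside every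
        interval {0<..s q} although it belongs to {0<..t}.\<close>
      have "(\<lambda>q. indicator {0<..s q} u * g u) \<longlonglongrightarrow> indicator {0<..t} u * g u" if "u \<noteq> t" for u
      proof (cases "u < t")
        case True
        then have "eventually (\<lambda>q. u < s q) sequentially" using order_tendstoD(1)[OF slim] by blast
        then have "eventually (\<lambda>q. indicator {0<..s q} u * g u = indicator {0<..t} u * g u) sequentially"
          by eventually_elim (use True in \<open>auto simp: indicator_def\<close>)
        then show ?thesis by (rule tendsto_eventually)
      next
        case False
        then have "indicator {0<..s q} u * g u = indicator {0<..t} u * g u" for q
          using s1(1)[of q] that by (auto simp: indicator_def)
        then show ?thesis by (intro tendsto_eventually always_eventually allI)
      qed
      then show "AE u in lborel. (\<lambda>q. indicator {0<..s q} u * g u) \<longlonglongrightarrow> indicator {0<..t} u * g u"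
        by (intro AE_I[of _ _ "{t}"]) auto
    qed (use g_int in \<open>auto simp: indicator_def\<close>)
    moreover have "(LINT u|lborel. indicator {0<..s q} u * g u) = f (s q)" for q
      unfolding s_def by (rule dyadic[OF i'])
    ultimately show ?thesis using LIMSEQ_unique by fastforce
  qed
  have "(\<integral>\<^sup>+u. ennreal ((g u)\<^sup>2) \<partial>lborel) \<le> 1"
  proof -
    \<comment> \<open>Fatou is applied to the nonnegative integral, before square integrability of g
      is known.\<close>
    have "(\<integral>\<^sup>+u. ennreal ((g u)\<^sup>2) \<partial>lborel) = (\<integral>\<^sup>+u. liminf (\<lambda>k. ennreal ((h k u)\<^sup>2)) \<partial>lborel)"
    proof (rule nn_integral_cong_AE)
      show "AE u in lborel. ennreal ((g u)\<^sup>2) = liminf (\<lambda>k. ennreal ((h k u)\<^sup>2))"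
        using h_lim
      proof eventually_elim
        case (elim u)
        then have "(\<lambda>k. ennreal ((h k u)\<^sup>2)) \<longlonglongrightarrow> ennreal ((g u)\<^sup>2)" by (intro tendsto_intros)
        then show ?case by (intro lim_imp_Liminf[symmetric]) auto
      qed
    qed
    also have "\<dots> \<le> liminf (\<lambda>k. \<integral>\<^sup>+u. ennreal ((h k u)\<^sup>2) \<partial>lborel)"
      by (rule nn_integral_liminf) auto
    also have "(\<lambda>k. \<integral>\<^sup>+u. ennreal ((h k u)\<^sup>2) \<partial>lborel) = (\<lambda>k. ennreal (e (p k)))"
      using integral_grid_slope_square[of "2 ^ p _" f] f0
      by (subst nn_integral_eq_integral) (auto simp: h_def e_def)
    also have "liminf (\<lambda>k. ennreal (e (p k))) \<le> liminf (\<lambda>k. 1)"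
      using energy by (intro Liminf_mono) (auto simp: e_def)
    also have "\<dots> = (1::ennreal)" by (simp add: Liminf_const)
    finally show ?thesis .
  qed
  then have g2: "integrable lborel (\<lambda>u. (g u)\<^sup>2)" "(LINT u|lborel. (g u)\<^sup>2) \<le> 1"
  proof -
    assume le: "(\<integral>\<^sup>+u. ennreal ((g u)\<^sup>2) \<partial>lborel) \<le> 1"
    then show i: "integrable lborel (\<lambda>u. (g u)\<^sup>2)"
      by (intro integrableI_bounded) (auto simp: le_less_trans)
    then show "(LINT u|lborel. (g u)\<^sup>2) \<le> 1"
      using le by (subst (asm) nn_integral_eq_integral) auto
  qed
  have g_out: "g u = 0" if "u \<notin> {0<..1}" for u
    using h_out[OF that] by (simp add: g_def d_def)
  have ind_g: "indicator {0..1} u * g u = g u" "indicator {0..1} u * (g u)\<^sup>2 = (g u)\<^sup>2" for u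
    using g_out[of u] by (cases "u \<in> {0<..1}"; simp)+
  show ?thesis
    unfolding strassen_class_def
  proof (intro CollectI exI[of _ g] conjI ballI)
    show "set_borel_measurable lborel {0..1} g"
      unfolding set_borel_measurable_def by measurable
    show "set_integrable lborel {0..1} (\<lambda>u. (g u)\<^sup>2)" "(LINT u:{0..1}|lborel. (g u)\<^sup>2) \<le> 1"
      unfolding set_integrable_def set_lebesgue_integral_def using g2 by (simp_all add: ind_g)
    fix t :: real assume t: "t \<in> {0..1}"
    have "indicator {0..t} u * g u = indicator {0<..t} u * g u" for u
      using g_out[of u] by (cases "u \<in> {0<..1}") (auto simp: indicator_def)
    then show "f t = (LINT u:{0..t}|lborel. g u)"
      using ft[OF t] by (simp only: set_lebesgue_integral_def real_scaleR_def)
  qed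
qed

section \<open>Limit points of the rescaled walk\<close>

lemma block_scale_at_top:
  assumes "\<epsilon> > 0" shows "filterlim (\<lambda>j. real (block_scale \<epsilon> j)) at_top sequentially"
proof (rule filterlim_at_top_mono)
  have "1 / (1 + \<epsilon>) > 0" using assms by simp
  then show "filterlim (\<lambda>j. exp (real j powr (1 / (1 + \<epsilon>)))) at_top sequentially" by real_asymp
qed (simp add: block_scale_bounds)

text \<open>For 0 < s < 1 the increments (j+1)^s - j^s tend to 0, so neighbouring scales have ratio
  tending to 1. The added 1 in the denominator accounts for the ceiling in
  \<open>block_scale\<close>.\<close>

lemma block_scale_ratio:
  assumes "\<epsilon> > 0" "\<delta> > 0"
  shows "\<forall>\<^sub>F j in sequentially. (1 - \<delta>) * real (block_scale \<epsilon> (Suc j)) \<le> real (block_scale \<epsilon> j)"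
proof -
  define s where "s = 1 / (1 + \<epsilon>)"
  have s: "0 < s" "s < 1" using assms by (auto simp: s_def)
  then have "((\<lambda>j. exp (real j powr s) / (exp ((real j + 1) powr s) + 1)) \<longlongrightarrow> 1) sequentially"
    by real_asymp
  then have "\<forall>\<^sub>F j in sequentially. 1 - \<delta> < exp (real j powr s) / (exp ((real j + 1) powr s) + 1)"
    using assms by (intro order_tendstoD) auto
  then show ?thesis
  proof eventually_elim
    case (elim j)
    have pos: "exp ((real j + 1) powr s) + 1 > 0" by (simp add: add_pos_pos)
    have up: "real (block_scale \<epsilon> (Suc j)) \<le> exp ((real j + 1) powr s) + 1"
      using block_scale_bounds(2)[of \<epsilon> "Suc j"] by (simp add: s_def add.commute)
    show ?case
    proof (cases "1 - \<delta> \<ge> 0")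
      case True
      then have "(1 - \<delta>) * real (block_scale \<epsilon> (Suc j)) \<le> (1 - \<delta>) * (exp ((real j + 1) powr s) + 1)"
        using up by (intro mult_left_mono)
      also have "\<dots> \<le> exp (real j powr s)" using elim pos by (simp add: pos_less_divide_eq less_imp_le)
      also have "\<dots> \<le> real (block_scale \<epsilon> j)" unfolding s_def by (rule block_scale_bounds)
      finally show ?thesis .
    next
      case False
      then have "(1 - \<delta>) * real (block_scale \<epsilon> (Suc j)) \<le> 0" by (intro mult_nonpos_nonneg) auto
      then show ?thesis by (meson of_nat_0_le_iff order_trans)
    qed
  qed
qed

abbreviation block_upper :: "(nat \<Rightarrow> real) \<Rightarrow> rat list \<Rightarrow> real \<Rightarrow> bool" where
  "block_upper b cs \<epsilon> \<equiv> sq_sum (rat_coeff cs) (length cs) > 0 \<longrightarrow>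
     (\<forall>\<^sub>F j in sequentially. \<bar>block_sum (rat_coeff cs) b (length cs) (block_scale \<epsilon> j)\<bar>
       \<le> (1 + \<epsilon>) * sqrt (2 * real (block_scale \<epsilon> j) * sq_sum (rat_coeff cs) (length cs) *
            ln (ln (real (block_scale \<epsilon> j)))))"

abbreviation block_lower :: "(nat \<Rightarrow> real) \<Rightarrow> rat list \<Rightarrow> real \<Rightarrow> bool" where
  "block_lower b cs \<epsilon> \<equiv> sq_sum (rat_coeff cs) (length cs) > 0 \<and> 2 \<le> length cs \<and> cs ! 0 = 0 \<longrightarrow>
     infinite {j. (1 - \<epsilon>) * sqrt (2 * real (length cs ^ j) * sq_sum (rat_coeff cs) (length cs) *
            ln (ln (real (length cs ^ Suc j))))
       \<le> block_sum (rat_coeff cs) b (length cs) (length cs ^ j)}"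

section \<open>Upper bound: limit points of a typical path lie in the Strassen class\<close>

locale strassen_path =
  fixes b :: "nat \<Rightarrow> real"
  assumes b_0: "b 0 = 0"
    and dyadic: "dyadic_bound b"
    and upper: "\<And>cs q. block_upper b cs (1 / real (Suc q))"
    and lower: "\<And>cs q. block_lower b cs (1 / real (Suc q))"
begin

lemma growth:
  obtains C where "C > 0" "\<And>n k. n \<ge> 27 \<Longrightarrow> k \<le> n \<Longrightarrow> \<bar>b k\<bar> \<le> C * sqrt (real k * ln (ln (real n)))"
  using dyadic_bound_growth[OF dyadic b_0] by blast

lemma rescaled_grid:
  assumes "n > 0" shows "rescaled b n (real k / real n) = b k / lil_norm n"
  using assms by (simp add: rescaled_def)

lemma relatively_compact:
  fixes r :: "nat \<Rightarrow> nat"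
  assumes r: "strict_mono r"
  shows "\<exists>(q::nat\<Rightarrow>nat) h. strict_mono q \<and> uniform_limit {0..1} (\<lambda>n. rescaled b (r (q n))) h sequentially"
proof -
  obtain C where C: "C > 0" "\<And>n k. n \<ge> 27 \<Longrightarrow> k \<le> n \<Longrightarrow> \<bar>b k\<bar> \<le> C * sqrt (real k * ln (ln (real n)))"
    using growth by blast
  have bd: "\<bar>rescaled b n t\<bar> \<le> C" if "n \<ge> 27" "t \<in> {0..1}" for n t
  proof -
    define k where "k = nat \<lfloor>real n * t\<rfloor>"
    have "real n * t \<le> real n * 1" using that by (intro mult_left_mono) auto
    then have k: "k \<le> n" unfolding k_def by linarith
    have "\<bar>rescaled b n t\<bar> \<le> C * sqrt (real k / real n)"
      unfolding rescaled_def k_def[symmetric] using rescaled_bounded[OF C(2) that(1) k C(1)] by simp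
    also have "\<dots> \<le> C * 1"
      using k C(1) by (intro mult_left_mono) (auto simp: divide_simps)
    finally show ?thesis by simp
  qed
  show ?thesis
  proof (rule asymp_equicontinuous_uniform_subseq[of "\<lambda>n. rescaled b (r n)" 27 C])
    show "asymp_equicontinuous (\<lambda>n. rescaled b (r n))"
      by (rule asymp_equicontinuous_subseq[OF rescaled_equicontinuous[OF dyadic] r])
    fix n t assume "(27::nat) \<le> n" "(t::real) \<in> {0..1}"
    then show "\<bar>rescaled b (r n) t\<bar> \<le> C"
      using strict_mono_imp_increasing[OF r, of n] by (intro bd) auto
  qed
qed

text \<open>The bound known at the scales \<open>r j\<close> is carried over to every large n. With
  the last scale satisfying m * r j \<le> n, the points i/m and i * r j / n differ by at most
  \<delta>, so equicontinuity replaces one by the other at a cost controlled by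
  \<open>\<eta>'\<close>.\<close>

lemma block_combination_upper:
  fixes cs :: "rat list"
  defines "m \<equiv> length cs" and "c \<equiv> \<lambda>i. real_of_rat (cs ! i)"
  defines "V \<equiv> sq_sum c m"
  assumes V: "V > 0" and \<eta>: "\<eta> > 0"
  shows "\<forall>\<^sub>F n in sequentially. grid_sum c (rescaled b n) m
     \<le> (1 + 1 / real (Suc q)) * sqrt (V / real m) + \<eta>"
proof -
  define \<epsilon> where "\<epsilon> = 1 / real (Suc q)"
  have eps: "\<epsilon> > 0" by (simp add: \<epsilon>_def)
  define r where "r = block_scale \<epsilon>"
  have m: "m > 0" using V unfolding V_def by (cases m) auto
  define A where "A = (\<Sum>i<m. \<bar>c i\<bar>)"
  have A: "A \<ge> 0" unfolding A_def by (intro sum_nonneg) auto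
  \<comment> \<open>Each of the two endpoints of an increment contributes one \<open>\<eta>'\<close>
    per coefficient, hence the factor 2 A; the added 1 keeps the denominator positive.\<close>
  define \<eta>' where "\<eta>' = \<eta> / (2 * A + 1)"
  have \<eta>': "\<eta>' > 0" "2 * A * \<eta>' \<le> \<eta>"
    using \<eta> A by (auto simp: \<eta>'_def field_simps)
  obtain \<delta> N where \<delta>: "\<delta> > 0" "\<forall>n\<ge>N. oscillation_le (rescaled b n) \<delta> \<eta>'"
    using rescaled_equicontinuous[OF dyadic] \<eta>'(1) unfolding asymp_equicontinuous_def by blast
  have "\<forall>\<^sub>F j in sequentially. \<bar>block_sum c b m (r j)\<bar>
        \<le> (1 + \<epsilon>) * sqrt (2 * real (r j) * V * ln (ln (real (r j))))"
    using upper[of cs q] V unfolding m_def c_def V_def r_def \<epsilon>_def by simp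
  moreover have "\<forall>\<^sub>F j in sequentially. (1 - \<delta>) * real (r (Suc j)) \<le> real (r j)"
    unfolding r_def by (rule block_scale_ratio[OF eps \<delta>(1)])
  moreover have "\<forall>\<^sub>F j in sequentially. 27 \<le> real (r j)"
    using block_scale_at_top[OF eps] unfolding r_def filterlim_at_top by blast
  ultimately have "\<forall>\<^sub>F j in sequentially. \<bar>block_sum c b m (r j)\<bar>
        \<le> (1 + \<epsilon>) * sqrt (2 * real (r j) * V * ln (ln (real (r j))))
        \<and> (1 - \<delta>) * real (r (Suc j)) \<le> real (r j) \<and> 27 \<le> r j"
    by eventually_elim simp
  then obtain J where J: "\<And>j. j \<ge> J \<Longrightarrow> \<bar>block_sum c b m (r j)\<bar>
        \<le> (1 + \<epsilon>) * sqrt (2 * real (r j) * V * ln (ln (real (r j))))"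
      "\<And>j. j \<ge> J \<Longrightarrow> (1 - \<delta>) * real (r (Suc j)) \<le> real (r j)" "\<And>j. j \<ge> J \<Longrightarrow> 27 \<le> r j"
    unfolding eventually_sequentially by blast
  have "grid_sum c (rescaled b n) m
     \<le> (1 + \<epsilon>) * sqrt (V / real m) + \<eta>" if n: "n \<ge> max N (m * r J)" for n
  proof -
    \<comment> \<open>The maximum of this finite set brackets n between m * r j and m * r (Suc
      j).\<close>
    define S where "S = {j. J \<le> j \<and> m * r j \<le> n}"
    have "finite S"
    proof -
      have "\<forall>\<^sub>F j in sequentially. real n + 1 \<le> real (r j)"
        using block_scale_at_top[OF eps] unfolding r_def filterlim_at_top by blast
      then obtain K where K: "\<And>j. j \<ge> K \<Longrightarrow> real n + 1 \<le> real (r j)"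
        unfolding eventually_sequentially by blast
      have "j < K" if "j \<in> S" for j
      proof (rule ccontr)
        assume "\<not> j < K"
        then have "n < r j" using K[of j] by simp
        also have "r j \<le> m * r j" using m by simp
        finally show False using that by (simp add: S_def)
      qed
      then show ?thesis by (meson finite_nat_set_iff_bounded)
    qed
    moreover have "J \<in> S" using n by (simp add: S_def)
    ultimately have "Max S \<in> S" by (intro Max_in) auto
    have "Suc (Max S) \<notin> S" using Max_ge[OF \<open>finite S\<close>, of "Suc (Max S)"] by auto
    define j where "j = Max S"
    have j: "j \<ge> J" "m * r j \<le> n" "n < m * r (Suc j)"
      using \<open>Max S \<in> S\<close> \<open>Suc (Max S) \<notin> S\<close> by (auto simp: S_def j_def)
    have rj: "27 \<le> r j" by (rule J(3)[OF j(1)])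
    have "r j \<le> m * r j" using m by simp
    then have n27: "r j \<le> n" "27 \<le> n" using rj j(2) by linarith+
    have a_pos: "lil_norm n > 0" by (rule lil_norm_pos) fact
    have close: "\<bar>rescaled b n (real i / real m) - b (i * r j) / lil_norm n\<bar> \<le> \<eta>'" if "i \<le> m" for i
    proof -
      define t' where "t' = real (i * r j) / real n"
      \<comment> \<open>This is the common factor that contracts each grid point i/m to the matching
        point i * r j / n. It lies between 1 - \<delta> and 1.\<close>
      define \<rho> where "\<rho> = real (m * r j) / real n"
      have t'eq: "t' = real i / real m * \<rho>"
        using m by (simp add: t'_def \<rho>_def)
      have ratio: "\<rho> \<le> 1" "1 - \<rho> \<le> \<delta>"
      proof -
        show "\<rho> \<le> 1" using j(2) n27 unfolding \<rho>_def by (simp add: divide_le_eq del: of_nat_mult)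
        have "(1 - \<delta>) * real n \<le> real (m * r j)"
        proof (cases "1 - \<delta> \<ge> 0")
          case True
          have "(1 - \<delta>) * real n \<le> (1 - \<delta>) * real (m * r (Suc j))"
            using j(3) True by (intro mult_left_mono) (auto simp del: of_nat_mult)
          also have "\<dots> = real m * ((1 - \<delta>) * real (r (Suc j)))" by simp
          also have "\<dots> \<le> real m * real (r j)" by (intro mult_left_mono J(2) j(1)) auto
          finally show ?thesis by simp
        next
          case False
          then have "(1 - \<delta>) * real n \<le> 0" by (intro mult_nonpos_nonneg) auto
          then show ?thesis by (meson of_nat_0_le_iff order_trans)
        qed
        then have "1 - \<delta> \<le> \<rho>" using n27 unfolding \<rho>_def by (simp add: pos_le_divide_eq del: of_nat_mult)
        then show "1 - \<rho> \<le> \<delta>" by linarith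
      qed
      have im: "0 \<le> real i / real m" "real i / real m \<le> 1" using that m by (auto simp: divide_simps)
      have "real i / real m - t' = real i / real m * (1 - \<rho>)"
        unfolding t'eq by (simp only: right_diff_distrib mult_1_right)
      also have "\<dots> \<le> 1 * (1 - \<rho>)"
        using im ratio by (intro mult_right_mono) auto
      finally have d1: "real i / real m - t' \<le> \<delta>" using ratio by simp
      have "real i / real m * \<rho> \<le> real i / real m * 1"
        using im ratio by (intro mult_left_mono) auto
      then have d2: "t' \<le> real i / real m" by (simp add: t'eq)
      have "t' \<ge> 0" by (simp add: t'_def)
      then have "\<bar>rescaled b n (real i / real m) - rescaled b n t'\<bar> \<le> \<eta>'"
        using \<delta>(2)[rule_format, of n "real i / real m" t'] n im d1 d2 by auto
      moreover have "rescaled b n t' = b (i * r j) / lil_norm n"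
        unfolding t'_def using n27 by (intro rescaled_grid) auto
      ultimately show ?thesis by simp
    qed
    have "grid_sum c (rescaled b n) m
       - block_sum c b m (r j) / lil_norm n
       = (\<Sum>i<m. c i * ((rescaled b n (real (Suc i) / real m) - b (Suc i * r j) / lil_norm n)
           - (rescaled b n (real i / real m) - b (i * r j) / lil_norm n)))"
      unfolding sum_divide_distrib sum_subtractf[symmetric]
      by (intro sum.cong refl) (simp add: algebra_simps diff_divide_distrib)
    also have "\<dots> \<le> (\<Sum>i<m. \<bar>c i\<bar> * (2 * \<eta>'))"
    proof (rule sum_mono)
      fix i assume "i \<in> {..<m}"
      then have "\<bar>rescaled b n (real (Suc i) / real m) - b (Suc i * r j) / lil_norm n\<bar> \<le> \<eta>'"
        "\<bar>rescaled b n (real i / real m) - b (i * r j) / lil_norm n\<bar> \<le> \<eta>'"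
        using close[of i] close[of "Suc i"] by auto
      then have "\<bar>(rescaled b n (real (Suc i) / real m) - b (Suc i * r j) / lil_norm n)
           - (rescaled b n (real i / real m) - b (i * r j) / lil_norm n)\<bar> \<le> 2 * \<eta>'" by linarith
      then have "\<bar>c i * ((rescaled b n (real (Suc i) / real m) - b (Suc i * r j) / lil_norm n)
           - (rescaled b n (real i / real m) - b (i * r j) / lil_norm n))\<bar> \<le> \<bar>c i\<bar> * (2 * \<eta>')"
        unfolding abs_mult by (intro mult_left_mono) auto
      then show "c i * ((rescaled b n (real (Suc i) / real m) - b (Suc i * r j) / lil_norm n)
           - (rescaled b n (real i / real m) - b (i * r j) / lil_norm n)) \<le> \<bar>c i\<bar> * (2 * \<eta>')"
        by (rule order_trans[OF abs_ge_self])
    qed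
    also have "\<dots> = 2 * A * \<eta>'" by (simp add: A_def sum_distrib_right[symmetric])
    also have "\<dots> \<le> \<eta>" by (rule \<eta>')
    finally have main: "grid_sum c (rescaled b n) m
       \<le> block_sum c b m (r j) / lil_norm n + \<eta>" by linarith
    have "block_sum c b m (r j) \<le> (1 + \<epsilon>) * sqrt (2 * real (r j) * V * ln (ln (real (r j))))"
      using J(1)[OF j(1)] by (meson abs_ge_self order_trans)
    also have "\<dots> \<le> (1 + \<epsilon>) * sqrt (V / real m * (2 * real n * ln (ln (real n))))"
    proof (intro mult_left_mono real_sqrt_le_mono)
      have "real (r j) * ln (ln (real (r j))) \<le> real n / real m * ln (ln (real n))"
      proof (rule mult_mono)
        have "real (m * r j) \<le> real n" using j(2) by (simp only: of_nat_le_iff)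
        then show "real (r j) \<le> real n / real m" using m by (simp add: field_simps)
        show "ln (ln (real (r j))) \<le> ln (ln (real n))" using rj n27 by (intro ln_ln_mono)
        show "0 \<le> ln (ln (real (r j)))" using ln_ln_ge_1[OF rj] by simp
      qed auto
      then have "2 * V * (real (r j) * ln (ln (real (r j)))) \<le> 2 * V * (real n / real m * ln (ln (real n)))"
        using V by (intro mult_left_mono) auto
      then show "2 * real (r j) * V * ln (ln (real (r j))) \<le> V / real m * (2 * real n * ln (ln (real n)))"
        by (simp add: algebra_simps)
    qed (use eps in auto)
    also have "\<dots> = (1 + \<epsilon>) * sqrt (V / real m) * lil_norm n"
      by (simp only: real_sqrt_mult lil_norm_def mult.assoc)
    finally have "block_sum c b m (r j) / lil_norm n \<le> (1 + \<epsilon>) * sqrt (V / real m)"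
      using a_pos by (simp add: pos_divide_le_eq)
    with main show ?thesis by linarith
  qed
  then show ?thesis
    unfolding \<epsilon>_def eventually_sequentially by blast
qed

text \<open>First n tends to infinity along the subsequence, then q. Zero variance is treated apart
  because \<open>block_upper\<close> speaks only about positive variance; all coefficients are then
  0.\<close>

lemma limit_rat_combination_le:
  fixes cs :: "rat list" and r :: "nat \<Rightarrow> nat"
  assumes r: "strict_mono r" and lim: "rescaled_limit b r g"
  shows "grid_sum (rat_coeff cs) g (length cs)
     \<le> sqrt ((sq_sum (rat_coeff cs) (length cs)) / real (length cs))"
proof (cases "sq_sum (rat_coeff cs) (length cs) > 0")
  case False
  then have "sq_sum (rat_coeff cs) (length cs) = 0"
    by (meson linorder_not_less order_antisym sum_nonneg zero_le_power2)
  then have "\<forall>i\<in>{..<length cs}. (real_of_rat (cs ! i))\<^sup>2 = 0"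
    by (subst (asm) sum_nonneg_eq_0_iff) auto
  then show ?thesis by simp
next
  case True
  define m where "m = length cs"
  define c where "c i = real_of_rat (cs ! i)" for i
  define V where "V = sq_sum c m"
  define L where "L = grid_sum c g m"
  have m: "m > 0" using True unfolding m_def by (cases cs) auto
  have "(\<lambda>n. grid_sum c (rescaled b (r n)) m) \<longlonglongrightarrow> L"
    unfolding L_def
    by (intro tendsto_sum tendsto_mult tendsto_diff tendsto_const tendsto_uniform_limitI[OF lim])
       (use m in \<open>auto simp: divide_simps\<close>)
  moreover have "\<forall>\<^sub>F n in sequentially. grid_sum c (rescaled b (r n)) m
     \<le> (1 + 1 / real (Suc q)) * sqrt (V / real m) + 1 / real (Suc q)" for q
    using eventually_subseq[OF r block_combination_upper[of cs "1 / real (Suc q)" q]] True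
    unfolding m_def c_def V_def by simp
  ultimately have "L \<le> (1 + 1 / real (Suc q)) * sqrt (V / real m) + 1 / real (Suc q)" for q
    by (intro tendsto_upperbound[of _ L sequentially]) auto
  moreover have "(\<lambda>q. (1 + 1 / real (Suc q)) * sqrt (V / real m) + 1 / real (Suc q)) \<longlonglongrightarrow> (1 + 0) * sqrt (V / real m) + 0"
    by (intro tendsto_intros LIMSEQ_Suc[OF lim_1_over_n])
  ultimately have "L \<le> (1 + 0) * sqrt (V / real m) + 0"
    by (intro LIMSEQ_le_const) auto
  then show ?thesis unfolding L_def V_def m_def c_def by simp
qed

text \<open>Duality: the linear functional is tested on the slopes of g themselves. This gives E
  \<le> sqrt E for the energy E, hence E \<le> 1. The slopes may be irrational, so they are
  approximated by rational vectors first.\<close>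

lemma limit_grid_energy:
  fixes r :: "nat \<Rightarrow> nat"
  assumes r: "strict_mono r" and lim: "rescaled_limit b r g" and m: "m > 0"
  shows "grid_energy g m \<le> 1"
proof -
  define D where "D i = g (real (Suc i) / real m) - g (real i / real m)" for i
  have "\<exists>y. (\<lambda>k. real_of_rat (y k)) \<longlonglongrightarrow> real m * D i" for i
  proof -
    have "\<exists>y. real m * D i < real_of_rat y \<and> real_of_rat y < real m * D i + 1 / real (Suc k)" for k
      by (rule of_rat_dense) simp
    then obtain y where y: "\<And>k. real m * D i < real_of_rat (y k)" "\<And>k. real_of_rat (y k) < real m * D i + 1 / real (Suc k)"
      by metis
    have "(\<lambda>k. real m * D i + 1 / real (Suc k)) \<longlonglongrightarrow> real m * D i + 0"
      by (intro tendsto_intros LIMSEQ_Suc[OF lim_1_over_n])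
    then have up: "(\<lambda>k. real m * D i + 1 / real (Suc k)) \<longlonglongrightarrow> real m * D i"
      by (simp only: add_0_right)
    have "(\<lambda>k. real_of_rat (y k)) \<longlonglongrightarrow> real m * D i"
    proof (rule tendsto_sandwich[OF _ _ tendsto_const up])
      show "\<forall>\<^sub>F k in sequentially. real m * D i \<le> real_of_rat (y k)"
        by (intro always_eventually allI less_imp_le y)
      show "\<forall>\<^sub>F k in sequentially. real_of_rat (y k) \<le> real m * D i + 1 / real (Suc k)"
        by (intro always_eventually allI less_imp_le y)
    qed
    then show ?thesis by (rule exI[of _ y])
  qed
  then have "\<forall>i. \<exists>y. (\<lambda>k. real_of_rat (y k)) \<longlonglongrightarrow> real m * D i" by (rule allI)
  from choice[OF this] obtain y where y: "\<And>i. (\<lambda>k. real_of_rat (y i k)) \<longlonglongrightarrow> real m * D i" by blast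
  have le: "(\<Sum>i<m. real_of_rat (y i k) * D i) \<le> sqrt ((\<Sum>i<m. (real_of_rat (y i k))\<^sup>2) / real m)" for k
    using limit_rat_combination_le[OF r lim, of "map (\<lambda>i. y i k) [0..<m]"] by (simp add: D_def)
  have "(\<Sum>i<m. (real m * D i) * D i) \<le> sqrt ((\<Sum>i<m. (real m * D i)\<^sup>2) / real m)"
  proof (rule LIMSEQ_le)
    show "(\<lambda>k. \<Sum>i<m. real_of_rat (y i k) * D i) \<longlonglongrightarrow> (\<Sum>i<m. (real m * D i) * D i)"
      by (intro tendsto_intros y)
    show "(\<lambda>k. sqrt ((\<Sum>i<m. (real_of_rat (y i k))\<^sup>2) / real m)) \<longlonglongrightarrow> sqrt ((\<Sum>i<m. (real m * D i)\<^sup>2) / real m)"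
      using m by (intro tendsto_intros y) simp
  qed (use le in blast)
  moreover have ge: "grid_energy g m = real m * (\<Sum>i<m. (D i)\<^sup>2)"
    by (simp add: grid_energy_def D_def)
  moreover have "(\<Sum>i<m. (real m * D i) * D i) = real m * (\<Sum>i<m. (D i)\<^sup>2)"
    by (simp add: sum_distrib_left power2_eq_square mult.assoc)
  moreover have "(\<Sum>i<m. (real m * D i)\<^sup>2) / real m = real m * (\<Sum>i<m. (D i)\<^sup>2)"
  proof -
    have "(\<Sum>i<m. (real m * D i)\<^sup>2) = (real m)\<^sup>2 * (\<Sum>i<m. (D i)\<^sup>2)"
      by (simp only: power_mult_distrib sum_distrib_left)
    then show ?thesis using m by (simp add: power2_eq_square)
  qed
  ultimately have le: "grid_energy g m \<le> sqrt (grid_energy g m)" by simp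
  have nn: "0 \<le> grid_energy g m" unfolding grid_energy_def by (intro mult_nonneg_nonneg sum_nonneg) auto
  show ?thesis
  proof (rule ccontr)
    assume "\<not> grid_energy g m \<le> 1"
    then have "sqrt (grid_energy g m) < grid_energy g m"
      using nn by (intro real_less_lsqrt) (auto simp: power2_eq_square)
    with le show False by simp
  qed
qed

lemma limit_in_strassen_class:
  fixes r :: "nat \<Rightarrow> nat"
  assumes r: "strict_mono r" and lim: "rescaled_limit b r g"
  shows "g \<in> strassen_class"
proof (rule strassen_classI_grid_energy)
  show "g 0 = 0"
  proof -
    have "(\<lambda>n. rescaled b (r n) 0) \<longlonglongrightarrow> g 0" by (rule tendsto_uniform_limitI[OF lim]) simp
    then show ?thesis by (simp add: rescaled_def b_0 LIMSEQ_const_iff)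
  qed
  show "grid_energy g (2 ^ p) \<le> 1" for p
    by (rule limit_grid_energy[OF r lim]) simp
  \<comment> \<open>The approximating step functions are discontinuous, so continuity of g comes
    from their asymptotic modulus and not from a uniform limit of continuous functions.\<close>
  show "continuous_on {0..1} g"
    unfolding continuous_on_iff
  proof (intro ballI allI impI)
    fix x e :: real assume x: "x \<in> {0..1}" and e: "e > 0"
    then have "e / 2 > 0" by simp
    obtain \<delta> N where \<delta>: "\<delta> > 0" "\<forall>n\<ge>N. oscillation_le (rescaled b (r n)) \<delta> (e / 2)"
      using asymp_equicontinuous_subseq[OF rescaled_equicontinuous[OF dyadic] r] \<open>e / 2 > 0\<close>
      unfolding asymp_equicontinuous_def by blast
    have "dist (g y) (g x) < e" if y: "y \<in> {0..1}" "dist y x < \<delta>" for y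
    proof -
      have "(\<lambda>n. \<bar>rescaled b (r n) y - rescaled b (r n) x\<bar>) \<longlonglongrightarrow> \<bar>g y - g x\<bar>"
        by (intro tendsto_intros tendsto_uniform_limitI[OF lim] x y)
      moreover have "\<forall>n\<ge>N. \<bar>rescaled b (r n) y - rescaled b (r n) x\<bar> \<le> e / 2"
        using \<delta>(2) x y by (simp add: dist_real_def)
      ultimately have "\<bar>g y - g x\<bar> \<le> e / 2" by (intro LIMSEQ_le_const2) auto
      then show ?thesis using e by (simp add: dist_real_def)
    qed
    then show "\<exists>d>0. \<forall>y\<in>{0..1}. dist y x < d \<longrightarrow> dist (g y) (g x) < e" using \<delta>(1) by blast
  qed
qed

end

section \<open>Lower bound: every function of the Strassen class is a limit point\<close>

lemma sum_pairs:
  fixes x :: "nat \<Rightarrow> real"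
  shows "(\<Sum>i<2 * m. x i) = (\<Sum>a<m. x (2 * a) + x (Suc (2 * a)))"
  by (induction m) auto

text \<open>Oscillating slopes raise the energy of the interpolated function to 1 without moving its
  values at the coarse grid points.\<close>

lemma unit_energy_slopes:
  assumes f: "f \<in> strassen_class" and m: "m \<ge> 2"
  obtains c :: "nat \<Rightarrow> real" where "c 0 = 0" "(\<Sum>i<2 * m. (c i)\<^sup>2) = 2 * real m"
    "\<And>a. a \<le> m \<Longrightarrow> \<bar>(\<Sum>i<2 * a. c i) / (2 * real m) - f (real a / real m)\<bar> \<le> 1 / sqrt (real m)"
proof -
  \<comment> \<open>The slope on the first coarse cell is set to 0, since the lower bound requires
    the first coefficient to vanish. This shifts the later values by f (1/m), which is at most 1 /
    sqrt m.\<close>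
  define s where "s a = (if a = 0 then 0 else real m * (f (real (Suc a) / real m) - f (real a / real m)))" for a
  define E where "E = (\<Sum>a<m. (s a)\<^sup>2)"
  have "E \<le> (\<Sum>a<m. (real m * (f (real (Suc a) / real m) - f (real a / real m)))\<^sup>2)"
    unfolding E_def s_def by (intro sum_mono) auto
  also have "\<dots> = (real m)\<^sup>2 * (\<Sum>a<m. (f (real (Suc a) / real m) - f (real a / real m))\<^sup>2)"
    by (simp only: power_mult_distrib sum_distrib_left)
  also have "\<dots> = real m * (real m * (\<Sum>a<m. (f (real (Suc a) / real m) - f (real a / real m))\<^sup>2))"
    by (simp only: power2_eq_square mult.assoc)
  also have "\<dots> \<le> real m * 1"
    using m by (intro mult_left_mono strassen_class_grid_energy[OF f]) auto
  finally have E: "E \<le> real m" by simp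
  \<comment> \<open>The amplitude solves 2 E + 2 (m - 1) \<kappa>^2 = 2 m, so that the 2m slopes
    have mean square 1. It is real because E \<le> m, and m \<ge> 2 keeps the denominator
    positive.\<close>
  define \<kappa> where "\<kappa> = sqrt ((real m - E) / (real m - 1))"
  have \<kappa>2: "(real m - 1) * \<kappa>\<^sup>2 = real m - E"
    using E m by (simp add: \<kappa>_def)
  define c where "c i = (if i < 2 then 0 else if even i then s (i div 2) + \<kappa> else s (i div 2) - \<kappa>)" for i
  have c_pair: "c (2 * a) = (if a = 0 then 0 else s a + \<kappa>)" "c (Suc (2 * a)) = (if a = 0 then 0 else s a - \<kappa>)" for a
    by (auto simp: c_def)
  show ?thesis
  proof
    show "c 0 = 0" by (simp add: c_def)
    obtain m' where m': "m = Suc m'" using m by (cases m) auto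
    have "(\<Sum>i<2 * m. (c i)\<^sup>2) = (\<Sum>a<m. (if a = 0 then 0 else 2 * (s a)\<^sup>2 + 2 * \<kappa>\<^sup>2))"
      unfolding sum_pairs c_pair by (intro sum.cong refl) (simp add: power2_eq_square algebra_simps)
    also have "\<dots> = (\<Sum>a<m'. 2 * (s (Suc a))\<^sup>2 + 2 * \<kappa>\<^sup>2)"
      unfolding m' sum.lessThan_Suc_shift by simp
    also have "\<dots> = 2 * (\<Sum>a<m'. (s (Suc a))\<^sup>2) + 2 * (real m' * \<kappa>\<^sup>2)"
      by (simp add: sum.distrib sum_distrib_left)
    also have "(\<Sum>a<m'. (s (Suc a))\<^sup>2) = E"
      unfolding E_def m' sum.lessThan_Suc_shift by (simp add: s_def)
    also have "real m' * \<kappa>\<^sup>2 = real m - E" using \<kappa>2 by (simp add: m')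
    finally show "(\<Sum>i<2 * m. (c i)\<^sup>2) = 2 * real m" by simp
    fix a assume a: "a \<le> m"
    have h: "\<bar>f (1 / real m)\<bar> \<le> 1 / sqrt (real m)"
      using strassen_class_Holder[OF f, of 0 "1 / real m"] strassen_class_0[OF f] m
      by (simp add: real_sqrt_divide)
    show "\<bar>(\<Sum>i<2 * a. c i) / (2 * real m) - f (real a / real m)\<bar> \<le> 1 / sqrt (real m)"
    proof (cases a)
      case 0
      then show ?thesis using strassen_class_0[OF f] by simp
    next
      case (Suc a')
      have "(\<Sum>i<2 * a. c i) = (\<Sum>a<a. 2 * s a)"
        unfolding sum_pairs c_pair by (intro sum.cong refl) (simp add: s_def)
      also have "\<dots> = (\<Sum>l<a'. 2 * real m * (f (real (Suc (Suc l)) / real m) - f (real (Suc l) / real m)))"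
        unfolding Suc sum.lessThan_Suc_shift by (simp add: s_def mult.assoc)
      also have "\<dots> = 2 * real m * (\<Sum>l<a'. f (real (Suc (Suc l)) / real m) - f (real (Suc l) / real m))"
        by (simp only: sum_distrib_left)
      also have "(\<Sum>l<a'. f (real (Suc (Suc l)) / real m) - f (real (Suc l) / real m)) = f (real a / real m) - f (1 / real m)"
        using sum_lessThan_telescope[of "\<lambda>l. f (real (Suc l) / real m)" a'] by (simp add: Suc)
      finally have "(\<Sum>i<2 * a. c i) / (2 * real m) - f (real a / real m) = - f (1 / real m)"
        using m by simp
      then show ?thesis using h by simp
    qed
  qed
qed

context strassen_path
begin

text \<open>If the pairing of \<open>c'\<close> with the increments D of the limit is nearly maximal
  and the energy of D is at most 1, then expanding the square of \<open>c' - real M * D\<close>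
  shows that the two vectors nearly agree. The partial sums are then within 2 \<eta>, and the
  rational approximation of c costs another \<eta>.\<close>

lemma limit_near_unit_slopes:
  fixes c :: "nat \<Rightarrow> real"
  assumes M: "M \<ge> 2" and c0: "c 0 = 0" and c2: "sq_sum c M = real M" and \<eta>: "0 < \<eta>" "\<eta> < 1"
  shows "\<exists>(r :: nat \<Rightarrow> nat) g. strict_mono r \<and> rescaled_limit b r g \<and>
    (\<forall>k\<le>M. \<bar>g (real k / real M) - (\<Sum>i<k. c i) / real M\<bar> \<le> 3 * \<eta>)"
proof -
  \<comment> \<open>The rational approximation must keep the first coefficient exactly 0, otherwise
    \<open>block_lower\<close> does not apply.\<close>
  have "\<exists>y. (i = 0 \<longrightarrow> y = 0) \<and> \<bar>real_of_rat y - c i\<bar> \<le> \<eta>" for i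
  proof (cases "i = 0")
    case False
    obtain y where "c i < real_of_rat y" "real_of_rat y < c i + \<eta>"
      using of_rat_dense[of "c i" "c i + \<eta>"] \<eta> by auto
    then show ?thesis using False by (intro exI[of _ y]) auto
  qed (use c0 \<eta> in auto)
  then have "\<forall>i. \<exists>y. (i = 0 \<longrightarrow> y = 0) \<and> \<bar>real_of_rat y - c i\<bar> \<le> \<eta>" by (rule allI)
  from choice[OF this] obtain y where y0: "y 0 = 0" and y: "\<And>i. \<bar>real_of_rat (y i) - c i\<bar> \<le> \<eta>" by blast
  define c' where "c' i = real_of_rat (y i)" for i
  have cc: "\<bar>c' i - c i\<bar> \<le> \<eta>" for i using y by (simp add: c'_def)
  define A where "A = sq_sum c' M"
  define v where "v = sqrt (A / real M)"
  have Mpos: "real M > 0" using M by simp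
  have A0: "A \<ge> 0" unfolding A_def by (intro sum_nonneg) auto
  have v2: "real M * v\<^sup>2 = A" and v0: "v \<ge> 0" using A0 Mpos by (simp_all add: v_def)
  have L2d: "L2_set h {..<M} \<le> \<eta> * sqrt (real M)" if "\<And>i. \<bar>h i\<bar> \<le> \<eta>" for h
  proof -
    have "(\<Sum>i<M. (h i)\<^sup>2) \<le> (\<Sum>i<M. \<eta>\<^sup>2)"
      using that \<eta> by (intro sum_mono) (simp add: abs_le_square_iff[symmetric])
    then have "L2_set h {..<M} \<le> sqrt (real M * \<eta>\<^sup>2)" unfolding L2_set_def by (intro real_sqrt_le_mono) simp
    then show ?thesis using \<eta> by (simp add: real_sqrt_mult mult.commute)
  qed
  have L2c: "L2_set c {..<M} = sqrt (real M)" unfolding L2_set_def c2 ..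
  have L2c': "L2_set c' {..<M} = v * sqrt (real M)"
    unfolding L2_set_def A_def[symmetric] v2[symmetric] using v0 by (simp add: real_sqrt_mult)
  have "L2_set (\<lambda>i. c i + (c' i - c i)) {..<M} \<le> L2_set c {..<M} + L2_set (\<lambda>i. c' i - c i) {..<M}"
    by (rule L2_set_triangle_ineq)
  also have "L2_set (\<lambda>i. c' i - c i) {..<M} \<le> \<eta> * sqrt (real M)" by (rule L2d[OF cc])
  finally have "v * sqrt (real M) \<le> (1 + \<eta>) * sqrt (real M)" by (simp add: L2c L2c' algebra_simps)
  then have v_le: "v \<le> 1 + \<eta>" using Mpos by simp
  have "L2_set (\<lambda>i. c' i + (c i - c' i)) {..<M} \<le> L2_set c' {..<M} + L2_set (\<lambda>i. c i - c' i) {..<M}"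
    by (rule L2_set_triangle_ineq)
  also have "L2_set (\<lambda>i. c i - c' i) {..<M} \<le> \<eta> * sqrt (real M)"
    by (rule L2d) (use cc in \<open>simp add: abs_minus_commute\<close>)
  finally have "(1 - \<eta>) * sqrt (real M) \<le> v * sqrt (real M)" by (simp add: L2c L2c' algebra_simps)
  then have v_ge: "1 - \<eta> \<le> v" using Mpos by simp
  have "v > 0" using v_ge \<eta> by linarith
  then have Apos: "A > 0" using v2 Mpos by (metis mult_pos_pos zero_less_power)
  \<comment> \<open>With v \<le> 1 + \<eta> < 2 this makes the error term 2 \<kappa> v at most
    \<eta>^2.\<close>
  obtain q where q: "1 / real (Suc q) < \<eta>\<^sup>2 / 4" using \<eta> nat_approx_posE[of "\<eta>\<^sup>2 / 4"] by auto
  define \<kappa> where "\<kappa> = 1 / real (Suc q)"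
  define S where "S = {j. (1 - \<kappa>) * sqrt (2 * real (M ^ j) * A * ln (ln (real (M ^ Suc j))))
      \<le> block_sum c' b M (M ^ j)}"
  have "infinite S"
    using lower[of "map y [0..<M]" q] Apos M y0 unfolding S_def \<kappa>_def c'_def A_def
    by (simp del: upt_Suc power_Suc of_nat_Suc of_nat_power mult_Suc)
  \<comment> \<open>At n = M^(j+1) the grid point i/M is exactly the index i * M^j, so no
    interpolation error arises.\<close>
  define r0 where "r0 k = M ^ Suc (enumerate S k)" for k
  have r0: "strict_mono r0"
    unfolding r0_def using M strict_mono_enumerate[OF \<open>infinite S\<close>]
    by (auto simp: strict_mono_def simp del: power_Suc)
  obtain p g where p: "strict_mono p" and lim: "uniform_limit {0..1} (\<lambda>n. rescaled b (r0 (p n))) g sequentially"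
    using relatively_compact[OF r0] by blast
  define r where "r n = r0 (p n)" for n
  have r: "strict_mono r" unfolding r_def using r0 p by (simp add: strict_mono_def)
  have lim: "rescaled_limit b r g" using lim by (simp add: r_def)
  define D where "D i = g (real (Suc i) / real M) - g (real i / real M)" for i
  have "(1 - \<kappa>) * v \<le> (\<Sum>i<M. c' i * D i)"
  proof (rule LIMSEQ_le_const)
    show "(\<lambda>n. grid_sum c' (rescaled b (r n)) M) \<longlonglongrightarrow> (\<Sum>i<M. c' i * D i)"
      unfolding D_def
      by (intro tendsto_sum tendsto_mult tendsto_diff tendsto_const tendsto_uniform_limitI[OF lim])
         (use M in \<open>auto simp: divide_simps\<close>)
    have "(1 - \<kappa>) * v \<le> grid_sum c' (rescaled b (r n)) M"
      if n: "n \<ge> 27" for n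
    proof -
      define j where "j = enumerate S (p n)"
      have "j \<in> S" unfolding j_def by (rule enumerate_in_set) fact
      have rn: "r n = M ^ Suc j" by (simp add: r_def r0_def j_def)
      have "27 \<le> r n" using strict_mono_imp_increasing[OF r, of n] n by linarith
      then have pos: "lil_norm (r n) > 0" by (rule lil_norm_pos)
      have grid: "rescaled b (r n) (real i / real M) = b (i * M ^ j) / lil_norm (r n)" for i
      proof -
        have "real i / real M = real (i * M ^ j) / real (r n)" using M by (simp add: rn)
        then show ?thesis using rescaled_grid[of "r n" "i * M ^ j"] \<open>27 \<le> r n\<close> by simp
      qed
      have "2 * real (M ^ j) * A * ln (ln (real (M ^ Suc j))) = A / real M * (2 * real (r n) * ln (ln (real (r n))))"
        using Mpos by (simp add: rn)
      then have "(1 - \<kappa>) * (v * lil_norm (r n)) \<le> block_sum c' b M (M ^ j)"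
        using \<open>j \<in> S\<close> unfolding S_def v_def lil_norm_def by (simp only: mem_Collect_eq real_sqrt_mult[symmetric])
      then have "(1 - \<kappa>) * v \<le> block_sum c' b M (M ^ j) / lil_norm (r n)"
        using pos by (simp only: pos_le_divide_eq mult.assoc)
      also have "\<dots> = grid_sum c' (rescaled b (r n)) M"
        unfolding grid sum_divide_distrib by (simp only: diff_divide_distrib[symmetric] times_divide_eq_right)
      finally show ?thesis .
    qed
    then show "\<exists>N. \<forall>n\<ge>N. (1 - \<kappa>) * v \<le> grid_sum c' (rescaled b (r n)) M"
      by blast
  qed
  then have inner: "real M * ((1 - \<kappa>) * v) \<le> real M * (\<Sum>i<M. c' i * D i)"
    using Mpos by simp
  have energy: "real M * (\<Sum>i<M. (D i)\<^sup>2) \<le> 1"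
    using limit_grid_energy[OF r lim, of M] M by (simp add: grid_energy_def D_def)
  \<comment> \<open>The bounds on pairing and energy reduce this to M ((1 - v)^2 + 2 \<kappa> v),
    and both terms in the bracket are at most \<eta>^2.\<close>
  have "(\<Sum>i<M. (c' i - real M * D i)\<^sup>2) = (\<Sum>i<M. (c' i)\<^sup>2 - 2 * real M * (c' i * D i) + (real M)\<^sup>2 * (D i)\<^sup>2)"
    by (intro sum.cong refl) (simp add: power2_eq_square algebra_simps)
  also have "\<dots> = A - 2 * real M * (\<Sum>i<M. c' i * D i) + (real M)\<^sup>2 * (\<Sum>i<M. (D i)\<^sup>2)"
    by (simp add: A_def sum.distrib sum_subtractf sum_distrib_left)
  also have "(real M)\<^sup>2 * (\<Sum>i<M. (D i)\<^sup>2) = real M * (real M * (\<Sum>i<M. (D i)\<^sup>2))"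
    by (simp add: power2_eq_square)
  also have "\<dots> \<le> real M * 1" using energy Mpos by (intro mult_left_mono) auto
  also have "A - 2 * real M * (\<Sum>i<M. c' i * D i) + real M * 1 \<le> real M * v\<^sup>2 - 2 * (real M * ((1 - \<kappa>) * v)) + real M"
    using inner v2 by simp
  also have "\<dots> = real M * ((1 - v)\<^sup>2 + 2 * \<kappa> * v)"
    by (simp add: power2_eq_square algebra_simps)
  also have "\<dots> \<le> real M * (\<eta>\<^sup>2 + \<eta>\<^sup>2)"
  proof (intro mult_left_mono add_mono)
    have "\<bar>1 - v\<bar> \<le> \<bar>\<eta>\<bar>" using v_le v_ge \<eta> by auto
    then show "(1 - v)\<^sup>2 \<le> \<eta>\<^sup>2" by (rule abs_le_square_iff[THEN iffD1])
    have "\<kappa> * v \<le> \<eta>\<^sup>2 / 4 * 2"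
      using q v_le \<eta> v0 by (intro mult_mono) (auto simp: \<kappa>_def)
    then show "2 * \<kappa> * v \<le> \<eta>\<^sup>2" by simp
  qed (use Mpos in simp)
  finally have dist2: "(\<Sum>i<M. (c' i - real M * D i)\<^sup>2) \<le> real M * (2 * \<eta>\<^sup>2)" by simp
  have L1: "(\<Sum>i<M. \<bar>c' i - real M * D i\<bar>) \<le> real M * (2 * \<eta>)"
  proof (rule power2_le_imp_le)
    have "(\<Sum>i<M. \<bar>c' i - real M * D i\<bar>)\<^sup>2 \<le> (\<Sum>i<M. (c' i - real M * D i)\<^sup>2) * (\<Sum>i<M. 1\<^sup>2)"
      using Cauchy_Schwarz_ineq_sum[of "\<lambda>i. \<bar>c' i - real M * D i\<bar>" "\<lambda>_. 1" "{..<M}"] by simp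
    also have "\<dots> \<le> (real M * (2 * \<eta>\<^sup>2)) * real M"
      using dist2 by (simp add: mult_right_mono)
    also have "\<dots> \<le> (real M * (2 * \<eta>))\<^sup>2"
      using \<eta> by (simp add: power2_eq_square algebra_simps)
    finally show "(\<Sum>i<M. \<bar>c' i - real M * D i\<bar>)\<^sup>2 \<le> (real M * (2 * \<eta>))\<^sup>2" .
  qed (use \<eta> in simp)
  have "\<bar>g (real k / real M) - (\<Sum>i<k. c i) / real M\<bar> \<le> 3 * \<eta>" if k: "k \<le> M" for k
  proof -
    have "g 0 = 0" by (rule strassen_class_0[OF limit_in_strassen_class[OF r lim]])
    then have "g (real k / real M) = (\<Sum>i<k. D i)"
      using sum_lessThan_telescope[of "\<lambda>i. g (real i / real M)" k] by (simp add: D_def)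
    then have "g (real k / real M) - (\<Sum>i<k. c i) / real M = (\<Sum>i<k. (real M * D i - c' i) + (c' i - c i)) / real M"
      using Mpos by (simp add: sum_subtractf sum.distrib diff_divide_distrib sum_distrib_left[symmetric])
    also have "\<bar>\<dots>\<bar> \<le> (real M * (3 * \<eta>)) / real M"
      unfolding abs_divide
    proof (rule frac_le)
      have "\<bar>\<Sum>i<k. (real M * D i - c' i) + (c' i - c i)\<bar> \<le> (\<Sum>i<k. \<bar>c' i - real M * D i\<bar> + \<eta>)"
      proof (rule order_trans[OF sum_abs sum_mono])
        fix i show "\<bar>(real M * D i - c' i) + (c' i - c i)\<bar> \<le> \<bar>c' i - real M * D i\<bar> + \<eta>"
          using cc[of i] by linarith
      qed
      also have "\<dots> \<le> (\<Sum>i<M. \<bar>c' i - real M * D i\<bar> + \<eta>)"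
        using k \<eta> by (intro sum_mono2) auto
      also have "\<dots> = (\<Sum>i<M. \<bar>c' i - real M * D i\<bar>) + real M * \<eta>" by (simp add: sum.distrib)
      also have "\<dots> \<le> real M * (2 * \<eta>) + real M * \<eta>" using L1 by (rule add_right_mono)
      finally show "\<bar>\<Sum>i<k. (real M * D i - c' i) + (c' i - c i)\<bar> \<le> real M * (3 * \<eta>)" by (simp only: distrib_left[symmetric]) simp
    qed (use Mpos \<eta> in auto)
    finally show ?thesis using Mpos by simp
  qed
  then show ?thesis using r lim by blast
qed

text \<open>A limit point with the oscillating slopes is close to f at the coarse points a/m, the
  even points of the grid of size 2m. Between these points both functions move by at most 1 / sqrt
  m, by the Hoelder bound for the class.\<close>

lemma strassen_class_approximated:
  assumes f: "f \<in> strassen_class" and eps: "\<epsilon> > 0"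
  shows "\<exists>n\<ge>N. \<forall>t\<in>{0..1}. \<bar>rescaled b n t - f t\<bar> < \<epsilon>"
proof -
  \<comment> \<open>The choices give h \<le> \<epsilon>/8 and \<eta> \<le> \<epsilon>/16, hence a
    total error 3 h + 3 \<eta> + \<epsilon>/4 of at most 13 \<epsilon>/16.\<close>
  obtain m0 where m0: "1 / real (Suc m0) < (\<epsilon> / 8)\<^sup>2" using nat_approx_posE[of "(\<epsilon> / 8)\<^sup>2"] eps by auto
  define m where "m = Suc (Suc m0)"
  have m: "m \<ge> 2" by (simp add: m_def)
  define h where "h = 1 / sqrt (real m)"
  have "1 / real m \<le> 1 / real (Suc m0)" by (intro divide_left_mono) (auto simp: m_def)
  then have "sqrt (1 / real m) \<le> sqrt ((\<epsilon> / 8)\<^sup>2)" using m0 by (intro real_sqrt_le_mono) linarith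
  then have h: "h \<le> \<epsilon> / 8" using eps by (simp add: h_def real_sqrt_divide)
  obtain c :: "nat \<Rightarrow> real" where c: "c 0 = 0" "(\<Sum>i<2 * m. (c i)\<^sup>2) = 2 * real m"
    "\<And>a. a \<le> m \<Longrightarrow> \<bar>(\<Sum>i<2 * a. c i) / (2 * real m) - f (real a / real m)\<bar> \<le> h"
    using unit_energy_slopes[OF f m] unfolding h_def by blast
  define \<eta> where "\<eta> = min (1/2) (\<epsilon> / 16)"
  have \<eta>: "0 < \<eta>" "\<eta> < 1" "\<eta> \<le> \<epsilon> / 16" using eps by (auto simp: \<eta>_def)
  obtain r :: "nat \<Rightarrow> nat" and g where r: "strict_mono r"
    and lim: "rescaled_limit b r g"
    and g: "\<forall>k\<le>2 * m. \<bar>g (real k / real (2 * m)) - (\<Sum>i<k. c i) / real (2 * m)\<bar> \<le> 3 * \<eta>"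
    using limit_near_unit_slopes[of "2 * m" c \<eta>] c m \<eta> by auto
  have gc: "g \<in> strassen_class" by (rule limit_in_strassen_class[OF r lim])
  have gf: "\<bar>g t - f t\<bar> \<le> 3 * h + 3 * \<eta>" if t: "t \<in> {0..1}" for t
  proof -
    define a where "a = nat \<lfloor>real m * t\<rfloor>"
    have mt: "0 \<le> real m * t" "real m * t \<le> real m" using t m by (auto simp: mult_le_cancel_left1)
    then have a: "a \<le> m" "real a \<le> real m * t" "real m * t \<le> real a + 1" unfolding a_def by linarith+
    define u where "u = real a / real m"
    have u: "u \<in> {0..1}" using a m by (auto simp: u_def divide_simps)
    have "t - u = (real m * t - real a) / real m" using m by (simp add: u_def field_simps)
    moreover have "\<bar>(real m * t - real a) / real m\<bar> \<le> 1 / real m"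
      unfolding abs_divide using a m by (intro frac_le) auto
    ultimately have "sqrt \<bar>t - u\<bar> \<le> sqrt (1 / real m)" by (intro real_sqrt_le_mono) simp
    then have tu: "sqrt \<bar>t - u\<bar> \<le> h" by (simp add: h_def real_sqrt_divide)
    have "\<bar>g t - g u\<bar> \<le> h" using strassen_class_Holder[OF gc u t] tu by linarith
    moreover have "\<bar>f t - f u\<bar> \<le> h" using strassen_class_Holder[OF f u t] tu by linarith
    moreover have "\<bar>(\<Sum>i<2 * a. c i) / (2 * real m) - f u\<bar> \<le> h" using c(3)[OF a(1)] by (simp add: u_def)
    moreover have "\<bar>g u - (\<Sum>i<2 * a. c i) / (2 * real m)\<bar> \<le> 3 * \<eta>"
      using g[rule_format, of "2 * a"] a(1) by (simp add: u_def)
    ultimately show ?thesis by linarith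
  qed
  have "\<forall>\<^sub>F n in sequentially. \<forall>t\<in>{0..1}. dist (rescaled b (r n) t) (g t) < \<epsilon> / 4"
    using lim eps unfolding uniform_limit_iff by (meson divide_pos_pos zero_less_numeral)
  moreover have "\<forall>\<^sub>F n in sequentially. n \<ge> N" by (rule eventually_ge_at_top)
  ultimately have "\<forall>\<^sub>F n in sequentially. n \<ge> N \<and> (\<forall>t\<in>{0..1}. dist (rescaled b (r n) t) (g t) < \<epsilon> / 4)"
    by eventually_elim simp
  then obtain n where n: "n \<ge> N" "\<forall>t\<in>{0..1}. dist (rescaled b (r n) t) (g t) < \<epsilon> / 4"
    using eventually_happens'[OF sequentially_bot] by blast
  show ?thesis
  proof (intro exI[of _ "r n"] conjI ballI)
    show "N \<le> r n" using strict_mono_imp_increasing[OF r, of n] n by linarith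
    fix t :: real assume t: "t \<in> {0..1}"
    then have "\<bar>rescaled b (r n) t - g t\<bar> < \<epsilon> / 4" using n(2) by (simp add: dist_real_def)
    then show "\<bar>rescaled b (r n) t - f t\<bar> < \<epsilon>" using gf[OF t] h \<eta>(3) by linarith
  qed
qed

lemma strassen_class_is_limit:
  assumes f: "f \<in> strassen_class"
  shows "\<exists>r::nat \<Rightarrow> nat. strict_mono r \<and> rescaled_limit b r f"
proof -
  have "\<exists>r. \<forall>k. (\<forall>t\<in>{0..1}. \<bar>rescaled b (r k) t - f t\<bar> < 1 / real (Suc k)) \<and> r k < r (Suc k)"
  proof (rule dependent_nat_choice)
    show "\<exists>n. \<forall>t\<in>{0..1}. \<bar>rescaled b n t - f t\<bar> < 1 / real (Suc 0)"
      using strassen_class_approximated[OF f, of 1 0] by auto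
    show "\<exists>n'. (\<forall>t\<in>{0..1}. \<bar>rescaled b n' t - f t\<bar> < 1 / real (Suc (Suc k))) \<and> n < n'" for n k
      using strassen_class_approximated[OF f, of "1 / real (Suc (Suc k))" "Suc n"] by (auto simp: Suc_le_eq)
  qed
  then obtain r where r: "\<And>k t. t \<in> {0..1} \<Longrightarrow> \<bar>rescaled b (r k) t - f t\<bar> < 1 / real (Suc k)" "\<And>k. r k < r (Suc k)"
    by blast
  have "rescaled_limit b r f"
    unfolding uniform_limit_iff
  proof (intro allI impI)
    fix e :: real assume "e > 0"
    then obtain K where K: "1 / real (Suc K) < e" using nat_approx_posE by blast
    show "\<forall>\<^sub>F n in sequentially. \<forall>t\<in>{0..1}. dist (rescaled b (r n) t) (f t) < e"
      using eventually_ge_at_top[of K]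
    proof eventually_elim
      case (elim n)
      have "1 / real (Suc n) \<le> 1 / real (Suc K)" using elim by (intro divide_left_mono) auto
      then show ?case using r(1)[of _ n] K by (fastforce simp: dist_real_def)
    qed
  qed
  then show ?thesis using r(2) by (intro exI[of _ r]) (simp add: strict_mono_Suc_iff)
qed

end

section \<open>Logarithmic averages\<close>

text \<open>Only one-sided limits of the antiderivative are asked for, so nonnegative integrands
  singular at 0, such as 1 / sqrt u and powers of - ln u, are covered. The endpoints form a null
  set.\<close>

lemma integral_FTC_from_0:
  fixes F f :: "real \<Rightarrow> real"
  assumes t: "0 < t"
    and F: "\<And>x. 0 < x \<Longrightarrow> x < t \<Longrightarrow> (F has_real_derivative f x) (at x)"
    and cont: "\<And>x. 0 < x \<Longrightarrow> x < t \<Longrightarrow> isCont f x"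
    and nn: "\<And>x. 0 < x \<Longrightarrow> x < t \<Longrightarrow> 0 \<le> f x"
    and A: "(F \<longlongrightarrow> A) (at_right 0)" and B: "(F \<longlongrightarrow> B) (at_left t)"
  shows "set_integrable lborel {0..t} f" "(LINT u:{0..t}|lborel. f u) = B - A"
proof -
  have A': "((F \<circ> real_of_ereal) \<longlongrightarrow> A) (at_right (ereal 0))"
    and B': "((F \<circ> real_of_ereal) \<longlongrightarrow> B) (at_left (ereal t))"
    using A B by (simp_all add: ereal_tendsto_simps)
  note ftc = interval_integral_FTC_nonneg[of "ereal 0" "ereal t" F f, OF _ _ _ _ A' B']
  have 1: "set_integrable lborel (einterval (ereal 0) (ereal t)) f"
    using t F cont nn by (intro ftc) auto
  have 2: "(LBINT x=ereal 0..ereal t. f x) = B - A"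
    using t F cont nn by (intro ftc) auto
  have "einterval (ereal 0) (ereal t) = {0<..<t}" by (auto simp: einterval_def)
  with 1 have "set_integrable lborel {0<..<t} f" by simp
  then show "set_integrable lborel {0..t} f"
    by (subst set_integrable_discrete_difference[where X="{0, t}" and B="{0<..<t}"]) auto
  show "(LINT u:{0..t}|lborel. f u) = B - A"
    using 2 t interval_integral_Icc[of 0 t f] by (simp add: zero_ereal_def)
qed

lemma integral_inverse_sqrt:
  assumes t: "0 < t"
  shows "set_integrable lborel {0..t} (\<lambda>u. 1 / sqrt u)" "(LINT u:{0..t}|lborel. 1 / sqrt u) = 2 * sqrt t"
proof -
  have d: "((\<lambda>x. 2 * sqrt x) has_real_derivative 1 / sqrt x) (at x)" if "0 < x" for x
    using that by (auto intro!: derivative_eq_intros simp: field_simps)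
  have A: "((\<lambda>x. 2 * sqrt x) \<longlongrightarrow> 2 * sqrt 0) (at_right 0)" and B: "((\<lambda>x. 2 * sqrt x) \<longlongrightarrow> 2 * sqrt t) (at_left t)"
    by (intro tendsto_intros)+
  have c: "isCont (\<lambda>u. 1 / sqrt u) x" if "0 < x" for x
    using that by (intro continuous_intros) auto
  show "set_integrable lborel {0..t} (\<lambda>u. 1 / sqrt u)"
    by (rule integral_FTC_from_0(1)[OF t d c _ A B]) auto
  show "(LINT u:{0..t}|lborel. 1 / sqrt u) = 2 * sqrt t"
    using integral_FTC_from_0(2)[OF t d c _ A B] by simp
qed

lemma grid_slope_on_cell:
  assumes "i < n" "u \<in> grid_cell n i"
  shows "grid_slope f n u = real n * (f (real (Suc i) / real n) - f (real i / real n))"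
proof -
  have "indicator (grid_cell n j) u = (if j = i then 1 else (0::real))" for j
  proof (cases "j = i")
    case False
    have "u \<notin> grid_cell n j"
    proof
      assume "u \<in> grid_cell n j"
      then have "real i / real n < real (Suc j) / real n" "real j / real n < real (Suc i) / real n"
        using assms(2) by (auto simp: grid_cell_def simp del: of_nat_Suc)
      then have "i < Suc j" "j < Suc i" using assms(1) by (auto simp: divide_less_cancel simp del: of_nat_Suc)
      then show False using False by simp
    qed
    then show ?thesis using False by simp
  qed (use assms in simp)
  then show ?thesis
    unfolding grid_slope_def using assms(1) by (simp add: if_distrib[of "(*) _"] sum.delta cong: if_cong)
qed

lemma in_grid_cell:
  assumes n: "n > 0" and u: "u \<in> {0<..1}"
  defines "i \<equiv> nat \<lceil>real n * u\<rceil> - 1"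
  shows "i < n" "u \<in> grid_cell n i" "u \<le> real (Suc i) / real n" "real (Suc i) / real n \<le> u + 1 / real n"
proof -
  have "0 < real n * u" "real n * u \<le> real n * 1" using n u by (auto simp: mult_le_cancel_left)
  then have *: "Suc i \<le> n" "real n * u \<le> real (Suc i)" "real (Suc i) < real n * u + 1"
    unfolding i_def by linarith+
  then show "i < n" by simp
  show u1: "u \<le> real (Suc i) / real n" using * n by (simp add: pos_le_divide_eq mult.commute)
  have "real (Suc i) / real n \<le> (real n * u + 1) / real n" using * by (intro divide_right_mono) auto
  also have "\<dots> = u + 1 / real n" using n by (simp add: add_divide_distrib)
  finally show "real (Suc i) / real n \<le> u + 1 / real n" .
  have "real i < real n * u" using * by simp
  then have "real i / real n < u" using n by (simp add: pos_divide_less_eq mult.commute)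
  then show "u \<in> grid_cell n i" using u1 by (simp add: grid_cell_def)
qed

lemma strassen_quotient_bound:
  assumes f: "f \<in> strassen_class" and u: "u \<in> {0<..1}"
  shows "\<bar>f u / u\<bar> \<le> 1 / sqrt u"
proof -
  have "\<bar>f u\<bar> \<le> sqrt u" using strassen_class_Holder[OF f, of 0 u] strassen_class_0[OF f] u by simp
  then have "\<bar>f u / u\<bar> \<le> sqrt u / u" using u by (simp add: divide_right_mono)
  also have "\<dots> = 1 / sqrt u" using u by (simp add: field_simps)
  finally show ?thesis .
qed

text \<open>At u = 0 the quotient is 0 by the convention for division by zero, and a single point
  does not affect the integral.\<close>

definition log_average :: "(real \<Rightarrow> real) \<Rightarrow> real \<Rightarrow> real" where
  "log_average f t = (LINT u:{0..t}|lborel. f u / u)"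

lemma strassen_quotient_measurable:
  assumes f: "f \<in> strassen_class"
  shows "(\<lambda>u. indicator {0<..1} u * (f u / u)) \<in> borel_measurable borel"
proof -
  have [measurable]: "(\<lambda>u. indicator {0..1} u *\<^sub>R f u) \<in> borel_measurable borel"
    by (rule borel_measurable_continuous_on_indicator) (use strassen_class_continuous[OF f] in auto)
  have "(\<lambda>u. indicator {0<..1} u * ((indicator {0..1} u *\<^sub>R f u) / u)) \<in> borel_measurable borel"
    by measurable
  moreover have "indicator {0<..1} u * ((indicator {0..1} u *\<^sub>R f u) / u) = indicator {0<..1} u * (f u / u)" for u :: real
    by (auto simp: indicator_def)
  ultimately show ?thesis by (simp only:)
qed

lemma log_average_eq:
  assumes "t \<in> {0..1}"
  shows "log_average f t = (LINT u|lborel. indicator {0<..t} u * (indicator {0<..1} u * (f u / u)))"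
  unfolding log_average_def set_lebesgue_integral_def
  using assms by (intro Bochner_Integration.integral_cong) (auto simp: indicator_def)

lemma integrable_sqrt_majorant: "integrable lborel (\<lambda>u. indicator {0<..1} u * (1 / sqrt u))"
proof -
  have "integrable lborel (\<lambda>u. indicator {0..1} u *\<^sub>R (1 / sqrt u))"
    using integral_inverse_sqrt(1)[of 1] by (simp only: set_integrable_def zero_less_one)
  moreover have "indicator {0..1} u *\<^sub>R (1 / sqrt u) = indicator {0<..1} u * (1 / sqrt u)" for u :: real
    by (auto simp: indicator_def)
  ultimately show ?thesis by (simp only:)
qed

lemma integral_sqrt_majorant:
  assumes "0 \<le> t" "t \<le> 1"
  shows "(LINT u|lborel. indicator {0<..t} u * (indicator {0<..1} u * (1 / sqrt u))) = 2 * sqrt t"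
proof (cases "t = 0")
  case False
  have "(LINT u|lborel. indicator {0<..t} u * (indicator {0<..1} u * (1 / sqrt u))) = (LINT u:{0..t}|lborel. 1 / sqrt u)"
    unfolding set_lebesgue_integral_def
    using assms by (intro Bochner_Integration.integral_cong) (auto simp: indicator_def)
  then show ?thesis using integral_inverse_sqrt(2)[of t] False assms by simp
qed simp

lemma strassen_quotient_integrable:
  assumes f: "f \<in> strassen_class"
  shows "integrable lborel (\<lambda>u. indicator {0<..1} u * (f u / u))"
proof (rule Bochner_Integration.integrable_bound[OF integrable_sqrt_majorant])
  show "AE u in lborel. norm (indicator {0<..1} u * (f u / u)) \<le> norm (indicator {0<..1} u * (1 / sqrt u))"
  proof (intro AE_I2)
    fix u :: real
    show "norm (indicator {0<..1} u * (f u / u)) \<le> norm (indicator {0<..1} u * (1 / sqrt u))"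
      using strassen_quotient_bound[OF f, of u] by (cases "u \<in> {0<..1}") auto
  qed
qed (use strassen_quotient_measurable[OF f] in simp)

lemma log_average_diff:
  assumes f: "f \<in> strassen_class" and st: "0 \<le> s" "s \<le> t" "t \<le> 1"
  shows "\<bar>log_average f t - log_average f s\<bar> \<le> 2 * (sqrt t - sqrt s)"
proof -
  define \<phi> where "\<phi> u = indicator {0<..1} u * (f u / u)" for u :: real
  define w where "w u = indicator {0<..1} u * (1 / sqrt u)" for u :: real
  have int: "integrable lborel (\<lambda>u. indicator {0<..x} u * \<phi> u)" "integrable lborel (\<lambda>u. indicator {0<..x} u * w u)" for x
    using integrable_mult_indicator[of "{0<..x}" lborel \<phi>] integrable_mult_indicator[of "{0<..x}" lborel w]
      strassen_quotient_integrable[OF f] integrable_sqrt_majorant by (simp_all add: \<phi>_def[abs_def] w_def[abs_def])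
  have bound: "\<bar>\<phi> u\<bar> \<le> w u" for u
    using strassen_quotient_bound[OF f, of u] by (cases "u \<in> {0<..1}") (auto simp: \<phi>_def w_def)
  have "log_average f t - log_average f s = (LINT u|lborel. indicator {0<..t} u * \<phi> u - indicator {0<..s} u * \<phi> u)"
    using st int by (simp add: log_average_eq \<phi>_def)
  also have "\<bar>\<dots>\<bar> \<le> (LINT u|lborel. \<bar>indicator {0<..t} u * \<phi> u - indicator {0<..s} u * \<phi> u\<bar>)"
    by (rule integral_abs_bound)
  also have "\<dots> \<le> (LINT u|lborel. indicator {0<..t} u * w u - indicator {0<..s} u * w u)"
  proof (rule integral_mono)
    fix u
    show "\<bar>indicator {0<..t} u * \<phi> u - indicator {0<..s} u * \<phi> u\<bar> \<le> indicator {0<..t} u * w u - indicator {0<..s} u * w u"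
      using bound[of u] st by (auto simp: indicator_def)
  qed (use int in auto)
  also have "\<dots> = 2 * sqrt t - 2 * sqrt s"
    using int integral_sqrt_majorant[of t] integral_sqrt_majorant[of s] st by (simp add: w_def)
  finally show ?thesis by simp
qed

lemma log_average_0: "f \<in> strassen_class \<Longrightarrow> log_average f 0 = 0"
  by (simp add: log_average_eq)

lemma log_average_bounded:
  assumes "f \<in> strassen_class" "t \<in> {0..1}" shows "\<bar>log_average f t\<bar> \<le> 2"
proof -
  have "\<bar>log_average f t\<bar> \<le> 2 * sqrt t"
    using log_average_diff[OF assms(1), of 0 t] assms log_average_0[OF assms(1)] by simp
  also have "\<dots> \<le> 2" using assms by simp
  finally show ?thesis .
qed

text \<open>The partial sums are integrals of step functions \<open>v j\<close> with value h(k) /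
  (k/N) on the k-th cell. These converge to f(u)/u pointwise and are dominated by a multiple of 1 /
  sqrt u, hence converge in L1. An L1-bound does not depend on the upper limit of integration, so
  the convergence is uniform in t.\<close>

lemma weighted_sum_limit:
  fixes h :: "nat \<Rightarrow> nat \<Rightarrow> real" and N :: "nat \<Rightarrow> nat"
  assumes f: "f \<in> strassen_class" and N: "filterlim N at_top sequentially"
    and bd: "\<forall>\<^sub>F j in sequentially. \<forall>k\<in>{1..N j}. \<bar>h j k\<bar> \<le> C * sqrt (real k / real (N j))"
    and conv: "\<And>e. e > 0 \<Longrightarrow> \<forall>\<^sub>F j in sequentially. \<forall>k\<in>{1..N j}. \<bar>h j k - f (real k / real (N j))\<bar> < e"
  shows "uniform_limit {0..1} (\<lambda>j t. \<Sum>k\<in>{1..nat \<lfloor>real (N j) * t\<rfloor>}. h j k / real k) (log_average f) sequentially"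
proof -
  define F where "F j x = (\<Sum>k\<in>{1..nat \<lfloor>real (N j) * x\<rfloor>}. h j k / real k)" for j x
  define v where "v j = grid_slope (F j) (N j)" for j
  define \<phi> where "\<phi> u = indicator {0<..1} u * (f u / u)" for u :: real
  have [measurable]: "\<phi> \<in> borel_measurable borel" "v j \<in> borel_measurable borel" for j
    using strassen_quotient_measurable[OF f] by (simp_all add: \<phi>_def[abs_def] v_def)
  have \<phi>_int: "integrable lborel \<phi>" using strassen_quotient_integrable[OF f] by (simp add: \<phi>_def[abs_def])
  have v_int: "integrable lborel (v j)" for j unfolding v_def by (rule integrable_grid_slope)
  have Npos: "\<forall>\<^sub>F j in sequentially. 0 < N j" 
    using filterlim_at_top[THEN iffD1, OF N, rule_format, of 1] by eventually_elim simp
  have Ftop: "F j (real i / real (N j)) = (\<Sum>k\<in>{1..i}. h j k / real k)" if "N j > 0" for i j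
    using that by (simp add: F_def)
  have v_cell: "v j u = h j (Suc i) / (real (Suc i) / real (N j))"
    if "N j > 0" "u \<in> {0<..1}" "i = nat \<lceil>real (N j) * u\<rceil> - 1" for j u i
  proof -
    have "v j u = real (N j) * (F j (real (Suc i) / real (N j)) - F j (real i / real (N j)))"
      unfolding v_def using in_grid_cell[OF that(1,2)] that(3) by (intro grid_slope_on_cell) auto
    also have "\<dots> = real (N j) * (h j (Suc i) / real (Suc i))"
      using that(1) by (simp only: Ftop sum.cl_ivl_Suc) simp
    finally show ?thesis by simp
  qed
  have v_bound: "\<bar>v j u\<bar> \<le> \<bar>C\<bar> * (indicator {0<..1} u * (1 / sqrt u))"
    if "N j > 0" "\<forall>k\<in>{1..N j}. \<bar>h j k\<bar> \<le> C * sqrt (real k / real (N j))" for j u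
  proof (cases "u \<in> {0<..1}")
    case True
    define i where "i = nat \<lceil>real (N j) * u\<rceil> - 1"
    define x where "x = real (Suc i) / real (N j)"
    note cell = in_grid_cell[OF that(1) True, folded i_def]
    have x: "u \<le> x" "0 < x" using cell True by (auto simp: x_def)
    have "\<bar>h j (Suc i)\<bar> \<le> C * sqrt x" using that(2)[rule_format, of "Suc i"] cell(1) by (simp add: x_def)
    also have "\<dots> \<le> \<bar>C\<bar> * sqrt x" using x by (intro mult_right_mono) auto
    finally have "\<bar>h j (Suc i) / x\<bar> \<le> \<bar>C\<bar> * sqrt x / x" using x by (simp add: divide_right_mono)
    also have "\<dots> = \<bar>C\<bar> * (1 / sqrt x)" using x by (simp add: field_simps)
    also have "\<dots> \<le> \<bar>C\<bar> * (1 / sqrt u)" using x True by (intro mult_left_mono divide_left_mono) auto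
    finally show ?thesis using v_cell[OF that(1) True i_def] True by (simp add: x_def)
  next
    case False
    then show ?thesis using grid_slope_outside[OF False] by (simp add: v_def)
  qed
  have inv_N: "(\<lambda>j. 1 / real (N j)) \<longlonglongrightarrow> 0"
    by (rule filterlim_compose[OF lim_1_over_n N])
  have v_lim: "(\<lambda>j. v j u) \<longlonglongrightarrow> \<phi> u" for u
  proof (cases "u \<in> {0<..1}")
    case True
    define i where "i j = nat \<lceil>real (N j) * u\<rceil> - 1" for j
    define x where "x j = real (Suc (i j)) / real (N j)" for j
    have x: "u \<le> x j" "x j \<le> u + 1 / real (N j)" "x j \<le> 1" "i j < N j" if "N j > 0" for j
      using in_grid_cell[OF that True, folded i_def] by (auto simp: x_def divide_simps)
    have x_lim: "x \<longlonglongrightarrow> u"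
    proof (rule tendsto_sandwich)
      show "\<forall>\<^sub>F j in sequentially. u \<le> x j" using Npos by eventually_elim (use x in auto)
      show "\<forall>\<^sub>F j in sequentially. x j \<le> u + 1 / real (N j)" using Npos by eventually_elim (use x in auto)
      show "(\<lambda>j. u + 1 / real (N j)) \<longlonglongrightarrow> u" using tendsto_add[OF tendsto_const inv_N, of u] by simp
    qed simp
    have fx: "(\<lambda>j. f (x j)) \<longlonglongrightarrow> f u"
    proof (rule continuous_on_tendsto_compose[OF strassen_class_continuous[OF f] x_lim])
      show "\<forall>\<^sub>F j in sequentially. x j \<in> {0..1}"
        using Npos by eventually_elim (use x True in \<open>auto simp: x_def\<close>)
    qed (use True in auto)
    have "(\<lambda>j. h j (Suc (i j)) - f (x j)) \<longlonglongrightarrow> 0"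
    proof (rule tendstoI)
      fix e :: real assume "e > 0"
      from conv[OF this] Npos
      show "\<forall>\<^sub>F j in sequentially. dist (h j (Suc (i j)) - f (x j)) 0 < e"
      proof eventually_elim
        case (elim j)
        show ?case
          using elim(1)[rule_format, of "Suc (i j)"] x(4)[OF elim(2)] by (simp add: x_def dist_real_def)
      qed
    qed
    from tendsto_add[OF this fx] have "(\<lambda>j. h j (Suc (i j))) \<longlonglongrightarrow> f u" by simp
    then have "(\<lambda>j. h j (Suc (i j)) / x j) \<longlonglongrightarrow> f u / u"
      using x_lim True by (intro tendsto_divide) auto
    moreover have "\<forall>\<^sub>F j in sequentially. h j (Suc (i j)) / x j = v j u"
      using Npos by eventually_elim (use v_cell True in \<open>auto simp: x_def i_def\<close>)
    ultimately show ?thesis using True by (auto simp: \<phi>_def elim: Lim_transform_eventually)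
  next
    case False
    then show ?thesis using grid_slope_outside[OF False] by (simp add: v_def \<phi>_def)
  qed
  have L1: "(\<lambda>j. LINT u|lborel. \<bar>v j u - \<phi> u\<bar>) \<longlonglongrightarrow> 0"
  proof -
    \<comment> \<open>The domination holds only from some index on, so the dominated convergence
      theorem is applied to the shifted sequence.\<close>
    obtain J where J: "\<And>j. j \<ge> J \<Longrightarrow> N j > 0 \<and> (\<forall>k\<in>{1..N j}. \<bar>h j k\<bar> \<le> C * sqrt (real k / real (N j)))"
      using eventually_conj[OF Npos bd] unfolding eventually_sequentially by blast
    have "(\<lambda>j. LINT u|lborel. \<bar>v (j + J) u - \<phi> u\<bar>) \<longlonglongrightarrow> (LINT u|(lborel :: real measure). 0)"
    proof (rule integral_dominated_convergence[where w="\<lambda>u. (\<bar>C\<bar> + 1) * (indicator {0<..1} u * (1 / sqrt u))"])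
      show "AE u in lborel. (\<lambda>j. \<bar>v (j + J) u - \<phi> u\<bar>) \<longlonglongrightarrow> 0"
      proof (intro AE_I2)
        fix u
        have "(\<lambda>j. \<bar>v j u - \<phi> u\<bar>) \<longlonglongrightarrow> \<bar>\<phi> u - \<phi> u\<bar>" by (intro tendsto_intros v_lim)
        then show "(\<lambda>j. \<bar>v (j + J) u - \<phi> u\<bar>) \<longlonglongrightarrow> 0" using LIMSEQ_ignore_initial_segment by fastforce
      qed
      show "integrable lborel (\<lambda>u. (\<bar>C\<bar> + 1) * (indicator {0<..1} u * (1 / sqrt u)))"
        by (intro integrable_mult_right integrable_sqrt_majorant)
      fix j
      show "AE u in lborel. norm \<bar>v (j + J) u - \<phi> u\<bar> \<le> (\<bar>C\<bar> + 1) * (indicator {0<..1} u * (1 / sqrt u))"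
      proof (intro AE_I2)
        fix u
        have "\<bar>v (j + J) u\<bar> \<le> \<bar>C\<bar> * (indicator {0<..1} u * (1 / sqrt u))"
          using J[of "j + J"] by (intro v_bound) auto
        moreover have "\<bar>\<phi> u\<bar> \<le> indicator {0<..1} u * (1 / sqrt u)"
          using strassen_quotient_bound[OF f, of u] by (cases "u \<in> {0<..1}") (auto simp: \<phi>_def)
        ultimately show "norm \<bar>v (j + J) u - \<phi> u\<bar> \<le> (\<bar>C\<bar> + 1) * (indicator {0<..1} u * (1 / sqrt u))"
          unfolding real_norm_def distrib_right mult_1_left abs_idempotent by linarith
      qed
    qed auto
    then have "(\<lambda>j. LINT u|lborel. \<bar>v (j + J) u - \<phi> u\<bar>) \<longlonglongrightarrow> 0" by simp
    then show ?thesis by (rule LIMSEQ_offset)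
  qed
  show ?thesis
    unfolding uniform_limit_iff F_def[symmetric]
  proof (intro allI impI)
    fix e :: real assume e: "e > 0"
    have "\<forall>\<^sub>F j in sequentially. (LINT u|lborel. \<bar>v j u - \<phi> u\<bar>) < e / 2"
      using L1 e by (intro order_tendstoD) auto
    moreover have "(\<lambda>j. 2 * sqrt (1 / real (N j))) \<longlonglongrightarrow> 2 * sqrt 0"
      by (intro tendsto_intros inv_N)
    then have "\<forall>\<^sub>F j in sequentially. 2 * sqrt (1 / real (N j)) < e / 2"
      by (rule order_tendstoD) (use e in simp)
    ultimately show "\<forall>\<^sub>F j in sequentially. \<forall>t\<in>{0..1}. dist (F j t) (log_average f t) < e"
      using Npos
    proof eventually_elim
      case (elim j)
      show ?case
      proof
        fix t :: real assume t: "t \<in> {0..1}"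
        define k where "k = nat \<lfloor>real (N j) * t\<rfloor>"
        have Nt: "0 \<le> real (N j) * t" "real (N j) * t \<le> real (N j) * 1"
          using t by (intro mult_nonneg_nonneg mult_left_mono; simp)+
        have k: "k \<le> N j" "real k \<le> real (N j) * t" "real (N j) * t \<le> real k + 1"
          unfolding k_def using Nt by linarith+
        define s where "s = real k / real (N j)"
        have s: "0 \<le> s" "s \<le> t" using k elim by (auto simp: s_def pos_divide_le_eq mult.commute)
        have "t \<le> (real k + 1) / real (N j)" using k elim by (simp add: pos_le_divide_eq mult.commute)
        then have ts: "t - s \<le> 1 / real (N j)" by (simp add: s_def add_divide_distrib)
        have "F j t = F j s" using elim by (simp add: F_def s_def k_def)
        also have "\<dots> = (LINT u|lborel. v j u * indicator {0<..s} u)"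
          unfolding v_def s_def using elim k by (intro integral_grid_slope[symmetric]) (auto simp: F_def)
        also have "\<dots> = (LINT u|lborel. indicator {0<..s} u * v j u)" by (simp only: mult.commute)
        finally have Fj: "F j t = (LINT u|lborel. indicator {0<..s} u * v j u)" .
        have int: "integrable lborel (\<lambda>u. indicator {0<..s} u * \<phi> u)" "integrable lborel (\<lambda>u. indicator {0<..s} u * v j u)"
          using integrable_mult_indicator[of "{0<..s}" lborel \<phi>] integrable_mult_indicator[of "{0<..s}" lborel "v j"]
            \<phi>_int v_int by simp_all
        have "F j t - log_average f s = (LINT u|lborel. indicator {0<..s} u * v j u - indicator {0<..s} u * \<phi> u)"
          using int s t by (simp add: Fj log_average_eq \<phi>_def)
        also have "\<bar>\<dots>\<bar> \<le> (LINT u|lborel. \<bar>indicator {0<..s} u * v j u - indicator {0<..s} u * \<phi> u\<bar>)"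
          by (rule integral_abs_bound)
        also have "\<dots> \<le> (LINT u|lborel. \<bar>v j u - \<phi> u\<bar>)"
          using int v_int[of j] \<phi>_int by (intro integral_mono) (auto simp: indicator_def)
        finally have 1: "\<bar>F j t - log_average f s\<bar> < e / 2" using elim by linarith
        \<comment> \<open>The sum sees only the grid point s below t; the part of the integral from
          s to t is at most 2 sqrt (1/N).\<close>
        have "\<bar>log_average f t - log_average f s\<bar> \<le> 2 * (sqrt t - sqrt s)"
          using s t by (intro log_average_diff f) auto
        also have "sqrt t \<le> sqrt s + sqrt (t - s)" using sqrt_add_le_add_sqrt[of s "t - s"] s by simp
        also have "sqrt (t - s) \<le> sqrt (1 / real (N j))" using ts by (rule real_sqrt_le_mono)
        finally have "\<bar>log_average f t - log_average f s\<bar> < e / 2" using elim by simp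
        with 1 show "dist (F j t) (log_average f t) < e" unfolding dist_real_def by linarith
      qed
    qed
  qed
qed

section \<open>The sharp constant by a discrete Cauchy-Schwarz argument\<close>

text \<open>The difference of harmonic numbers H n - H i is the discrete counterpart of - ln
  (i/n).\<close>

definition tail_harm :: "nat \<Rightarrow> nat \<Rightarrow> real" where
  "tail_harm n i = (\<Sum>k\<in>{i..<n}. 1 / real (Suc k))"

lemma tail_harm_Suc: "i \<le> n \<Longrightarrow> tail_harm (Suc n) i = tail_harm n i + 1 / real (Suc n)"
  by (simp add: tail_harm_def)

lemma sum_tail_harm: "(\<Sum>i<n. tail_harm n i) = real n"
proof (induction n)
  case (Suc n)
  have "(\<Sum>i<Suc n. tail_harm (Suc n) i) = (\<Sum>i<Suc n. tail_harm n i + 1 / real (Suc n))"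
    by (intro sum.cong refl tail_harm_Suc) auto
  also have "\<dots> = (\<Sum>i<n. tail_harm n i) + tail_harm n n + real (Suc n) * (1 / real (Suc n))"
    by (simp only: sum.distrib sum.lessThan_Suc[of "tail_harm n"] sum_constant card_lessThan)
  also have "\<dots> = real (Suc n)" using Suc by (simp add: tail_harm_def)
  finally show ?case .
qed simp

text \<open>Discrete form of the fact that (ln u)^2 has integral 2 over the unit interval. Passing
  from n to n + 1 adds exactly 2 - 1/(n+1), where \<open>sum_tail_harm\<close> evaluates the mixed
  term.\<close>

lemma sum_tail_harm_square: "(\<Sum>i<n. (tail_harm n i)\<^sup>2) \<le> 2 * real n"
proof (induction n)
  case (Suc n)
  define z where "z = 1 / real (Suc n)"
  have z: "real (Suc n) * z = 1" "0 \<le> z" "z \<le> 1" by (simp_all add: z_def)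
  have "(\<Sum>i<Suc n. (tail_harm (Suc n) i)\<^sup>2) = (\<Sum>i<Suc n. (tail_harm n i + z)\<^sup>2)"
    unfolding z_def by (intro sum.cong refl) (simp add: tail_harm_Suc)
  also have "\<dots> = (\<Sum>i<Suc n. (tail_harm n i)\<^sup>2 + 2 * z * tail_harm n i + z\<^sup>2)"
    by (intro sum.cong refl) (simp add: power2_sum)
  also have "\<dots> = (\<Sum>i<Suc n. (tail_harm n i)\<^sup>2) + 2 * z * (\<Sum>i<Suc n. tail_harm n i) + real (Suc n) * z\<^sup>2"
    by (simp only: sum.distrib sum_distrib_left sum_constant card_lessThan)
  also have "\<dots> = (\<Sum>i<n. (tail_harm n i)\<^sup>2) + 2 * z * real n + (real (Suc n) * z) * z"
    using sum_tail_harm[of n] by (simp add: tail_harm_def power2_eq_square)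
  also have "\<dots> \<le> 2 * real n + (2 * (real (Suc n) * z) - 2 * z) + z"
    using Suc z by (simp add: algebra_simps)
  also have "\<dots> \<le> 2 * real (Suc n)" using z by simp
  finally show ?case .
qed simp

text \<open>Exchange of the order of summation: the increment with index i enters every partial sum
  from \<open>Suc i\<close> on, with total weight \<open>tail_harm n i\<close>.\<close>

lemma sum_partial_sums:
  "(\<Sum>k<n. (\<Sum>i<Suc k. D i) / real (Suc k)) = (\<Sum>i<n. D i * tail_harm n i)"
proof (induction n)
  case (Suc n)
  have "(\<Sum>i<Suc n. D i * tail_harm (Suc n) i) = (\<Sum>i<Suc n. D i * tail_harm n i + D i / real (Suc n))"
    by (intro sum.cong refl) (simp add: tail_harm_Suc algebra_simps)
  also have "\<dots> = (\<Sum>i<n. D i * tail_harm n i) + D n * tail_harm n n + (\<Sum>i<Suc n. D i) / real (Suc n)"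
    by (simp only: sum.distrib sum.lessThan_Suc[of "\<lambda>i. D i * tail_harm n i"] sum_divide_distrib)
  finally show ?case using Suc by (simp add: tail_harm_def)
qed simp

text \<open>In increments of f the sum is a pairing with \<open>tail_harm\<close>. Cauchy-Schwarz
  multiplies the bounds 1/n for the squared increments and 2n for the squared weights.\<close>

lemma weighted_sum_le_sqrt2:
  assumes f: "f \<in> strassen_class" and n: "n > 0"
  shows "(\<Sum>k\<in>{1..n}. f (real k / real n) / real k) \<le> sqrt 2"
proof -
  define D where "D i = f (real (Suc i) / real n) - f (real i / real n)" for i
  have "(\<Sum>k\<in>{1..n}. f (real k / real n) / real k) = (\<Sum>k<n. f (real (Suc k) / real n) / real (Suc k))"
    by (simp add: sum.atLeast1_atMost_eq)
  also have "\<dots> = (\<Sum>k<n. (\<Sum>i<Suc k. D i) / real (Suc k))"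
  proof (intro sum.cong refl)
    fix k
    have "(\<Sum>i<Suc k. D i) = f (real (Suc k) / real n)"
      unfolding D_def using sum_lessThan_telescope[of "\<lambda>i. f (real i / real n)" "Suc k"] strassen_class_0[OF f] by simp
    then show "f (real (Suc k) / real n) / real (Suc k) = (\<Sum>i<Suc k. D i) / real (Suc k)" by simp
  qed
  also have "\<dots> = (\<Sum>i<n. D i * tail_harm n i)" by (rule sum_partial_sums)
  also have "\<dots> \<le> sqrt 2"
  proof (rule real_le_rsqrt)
    have "(\<Sum>i<n. D i * tail_harm n i)\<^sup>2 \<le> (\<Sum>i<n. (D i)\<^sup>2) * (\<Sum>i<n. (tail_harm n i)\<^sup>2)"
      by (rule Cauchy_Schwarz_ineq_sum)
    also have "\<dots> \<le> (\<Sum>i<n. (D i)\<^sup>2) * (2 * real n)"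
      by (intro mult_left_mono sum_tail_harm_square sum_nonneg) auto
    also have "\<dots> = 2 * (real n * (\<Sum>i<n. (D i)\<^sup>2))" by simp
    also have "\<dots> \<le> 2 * 1"
      using strassen_class_grid_energy[OF f n] by (intro mult_left_mono) (auto simp: D_def)
    finally show "(\<Sum>i<n. D i * tail_harm n i)\<^sup>2 \<le> 2" by simp
  qed
  finally show ?thesis .
qed

text \<open>\<open>weighted_sum_limit\<close> is applied with h sampled from f itself, which carries
  the discrete bound over to the integral.\<close>

lemma log_average_le_sqrt2:
  assumes f: "f \<in> strassen_class"
  shows "log_average f 1 \<le> sqrt 2"
proof -
  have "uniform_limit {0..1} (\<lambda>j t. \<Sum>k\<in>{1..nat \<lfloor>real (Suc j) * t\<rfloor>}. f (real k / real (Suc j)) / real k) (log_average f) sequentially"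
  proof (rule weighted_sum_limit[OF f filterlim_Suc, where C=1])
    show "\<forall>\<^sub>F j in sequentially. \<forall>k\<in>{1..Suc j}. \<bar>f (real k / real (Suc j))\<bar> \<le> 1 * sqrt (real k / real (Suc j))"
    proof (intro always_eventually allI ballI)
      fix j k assume "k \<in> {1..Suc j}"
      then have "real k / real (Suc j) \<in> {0..1}" by (auto simp: divide_simps)
      from strassen_class_Holder[OF f _ this, of 0]
      show "\<bar>f (real k / real (Suc j))\<bar> \<le> 1 * sqrt (real k / real (Suc j))"
        using strassen_class_0[OF f] by simp
    qed
  qed simp
  from tendsto_uniform_limitI[OF this, of 1]
  have "(\<lambda>j. \<Sum>k\<in>{1..Suc j}. f (real k / real (Suc j)) / real k) \<longlonglongrightarrow> log_average f 1"
    by (simp del: of_nat_Suc sum.cl_ivl_Suc)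
  then show ?thesis
    using weighted_sum_le_sqrt2[OF f] by (intro LIMSEQ_le_const2) (auto simp del: of_nat_Suc sum.cl_ivl_Suc)
qed

section \<open>The normalised products\<close>

text \<open>Equality in Cauchy-Schwarz forces the derivative to be proportional to - ln u; the
  factor 1 / sqrt 2 normalises its energy to 1.\<close>

lemma extremal_function:
  obtains f where "f \<in> strassen_class" "log_average f 1 = sqrt 2"
proof -
  define f where "f t = t * (1 - ln t) / sqrt 2" for t :: real
  have mem: "f \<in> strassen_class"
    unfolding strassen_class_def
  proof (intro CollectI exI[of _ "\<lambda>u. - ln u / sqrt 2"] conjI ballI)
    show "set_borel_measurable lborel {0..1} (\<lambda>u. - ln u / sqrt 2)"
      unfolding set_borel_measurable_def by measurable
    \<comment> \<open>An antiderivative of (ln x)^2 / 2 with limit 0 at 0 and value 1 at 1.\<close>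
    define F where "F x = (x * (ln x)\<^sup>2 - 2 * x * ln x + 2 * x) / 2" for x :: real
    have d: "(F has_real_derivative (- ln x / sqrt 2)\<^sup>2) (at x)" if "0 < x" for x
      unfolding F_def using that
      by (auto intro!: derivative_eq_intros simp: power_divide power2_eq_square field_simps)
    have c: "isCont (\<lambda>u. (- ln u / sqrt 2)\<^sup>2) x" if "0 < x" for x
      using that by (intro continuous_intros) auto
    have A: "(F \<longlongrightarrow> 0) (at_right 0)" unfolding F_def by real_asymp
    have "isCont F 1" using d[of 1] DERIV_isCont by force
    then have B: "(F \<longlongrightarrow> F 1) (at_left 1)"
      unfolding isCont_def by (rule tendsto_mono[rotated]) (simp add: at_le)
    show "set_integrable lborel {0..1} (\<lambda>u. (- ln u / sqrt 2)\<^sup>2)"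
      by (rule integral_FTC_from_0(1)[OF zero_less_one d c _ A B]) auto
    have "(LINT u:{0..1}|lborel. (- ln u / sqrt 2)\<^sup>2) = F 1 - 0"
      by (rule integral_FTC_from_0(2)[OF zero_less_one d c _ A B]) auto
    then show "(LINT u:{0..1}|lborel. (- ln u / sqrt 2)\<^sup>2) \<le> 1" by (simp add: F_def)
    fix t :: real assume t: "t \<in> {0..1}"
    show "f t = (LINT u:{0..t}|lborel. - ln u / sqrt 2)"
    proof (cases "t = 0")
      case True
      have "(LINT u:{0..t}|lborel. - ln u / sqrt 2) = (LINT u|(lborel :: real measure). 0)"
        unfolding True set_lebesgue_integral_def
        by (intro Bochner_Integration.integral_cong) (auto simp: indicator_def)
      then show ?thesis by (simp add: True f_def)
    next
      case False
      then have t0: "0 < t" using t by simp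
      have d': "(f has_real_derivative - ln x / sqrt 2) (at x)" if "0 < x" for x
        unfolding f_def[abs_def] using that by (auto intro!: derivative_eq_intros simp: field_simps)
      have A': "(f \<longlongrightarrow> 0) (at_right 0)" unfolding f_def by real_asymp
      have "isCont f t" using d'[OF t0] DERIV_isCont by blast
      then have B': "(f \<longlongrightarrow> f t) (at_left t)"
        unfolding isCont_def by (rule tendsto_mono[rotated]) (simp add: at_le)
      have "(LINT u:{0..t}|lborel. - ln u / sqrt 2) = f t - 0"
        by (rule integral_FTC_from_0(2)[OF t0 d' _ _ A' B']) (use t in \<open>auto intro!: continuous_intros divide_nonpos_nonneg\<close>)
      then show ?thesis by simp
    qed
  qed
  define F where "F x = (2 * x - x * ln x) / sqrt 2" for x :: real
  have d: "(F has_real_derivative f x / x) (at x)" if "0 < x" for x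
    unfolding F_def f_def using that by (auto intro!: derivative_eq_intros simp: field_simps)
  have c: "isCont (\<lambda>u. f u / u) x" if "0 < x" for x
    unfolding f_def using that by (intro continuous_intros) auto
  have nn: "0 \<le> f x / x" if "0 < x" "x < 1" for x
    unfolding f_def using that by (intro divide_nonneg_nonneg mult_nonneg_nonneg) (auto simp: ln_le_zero_iff intro: order_trans[of _ 0])
  have A: "(F \<longlongrightarrow> 0) (at_right 0)" unfolding F_def by real_asymp
  have "isCont F 1" using d[of 1] DERIV_isCont by force
  then have B: "(F \<longlongrightarrow> F 1) (at_left 1)"
    unfolding isCont_def by (rule tendsto_mono[rotated]) (simp add: at_le)
  have "log_average f 1 = F 1 - 0"
    unfolding log_average_def by (rule integral_FTC_from_0(2)[OF zero_less_one d c nn A B])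
  also have "\<dots> = sqrt 2" by (simp add: F_def real_div_sqrt)
  finally show ?thesis using mem that by blast
qed

lemma sum_inverse_sqrt_le: "(\<Sum>k\<in>{1..n}. 1 / sqrt (real k)) \<le> 2 * sqrt (real n)"
proof (induction n)
  case (Suc n)
  \<comment> \<open>The geometric mean of n and n + 1 is at most their arithmetic mean; multiplying
    the induction step by sqrt (n+1) reduces it to this.\<close>
  have "sqrt (real (Suc n)) * sqrt (real n) \<le> real n + 1/2"
  proof (rule power2_le_imp_le)
    show "(sqrt (real (Suc n)) * sqrt (real n))\<^sup>2 \<le> (real n + 1/2)\<^sup>2"
      by (simp add: power_mult_distrib power2_eq_square algebra_simps)
  qed simp
  moreover define a where "a = sqrt (real (Suc n))"
  ultimately have "2 * (a * sqrt (real n)) + 1 \<le> 2 * (a * a)" and a: "a > 0"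
    by simp_all
  then have "a * (2 * sqrt (real n) + 1 / a) \<le> a * (2 * a)"
    using a by (simp add: distrib_left mult.left_commute)
  then have "2 * sqrt (real n) + 1 / a \<le> 2 * a"
    using a by simp
  then show ?case using Suc by (simp add: a_def)
qed simp

section \<open>From sums to products along one fixed path\<close>

locale strassen_product = strassen_path b for b +
  fixes s :: "nat \<Rightarrow> real" and \<mu> \<sigma> \<gamma> :: real
  assumes s_pos: "\<And>k. k \<ge> 1 \<Longrightarrow> s k > 0"
    and mu_pos: "\<mu> > 0" and sigma_pos: "\<sigma> > 0" and gamma: "\<gamma> = \<mu> / \<sigma>"
    and approx: "(\<lambda>n. s n - real n * \<mu> - \<sigma> * b n) \<in> o(\<lambda>n. sqrt (real n * ln (ln (real n))))"
begin

text \<open>With x the relative deviation of s k from k \<mu>, ln (1 + x) = x + O(x^2). The choice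
  \<gamma> = \<mu>/\<sigma> makes b k / k the main term of \<gamma> x. Since x is of the order sqrt
  (ln ln k / k), which tends to 0, the quadratic term is negligible at that order.\<close>

lemma log_factor_approx:
  assumes e: "e > 0"
  shows "\<forall>\<^sub>F k in sequentially. \<bar>\<gamma> * ln (s k / (real k * \<mu>)) - b k / real k\<bar> \<le> e * sqrt (ln (ln (real k)) / real k)"
proof -
  obtain C where C: "C > 0" "\<And>n k. n \<ge> 27 \<Longrightarrow> k \<le> n \<Longrightarrow> \<bar>b k\<bar> \<le> C * sqrt (real k * ln (ln (real n)))"
    using growth by blast
  have gamma_pos: "\<gamma> > 0" using mu_pos sigma_pos gamma by simp
  \<comment> \<open>The bound by e \<sigma> / 2 gives the final error share e/2, and the bound by
    \<sigma> gives the crude estimate of x with a constant \<open>B\<close> free of e.\<close>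
  define c where "c = min \<sigma> (e * \<sigma> / 2)"
  have c: "c > 0" "c \<le> \<sigma>" "c / \<sigma> \<le> e / 2" using e sigma_pos by (auto simp: c_def min_def field_simps)
  define B where "B = (\<sigma> * C + \<sigma>) / \<mu>"
  have B: "B > 0" using C sigma_pos mu_pos by (simp add: B_def add_pos_pos)
  define \<rho> where "\<rho> k = sqrt (ln (ln (real k)) / real k)" for k :: nat
  have "\<rho> \<longlonglongrightarrow> 0" unfolding \<rho>_def by real_asymp
  then have lims: "(\<lambda>k. B * \<rho> k) \<longlonglongrightarrow> 0" "(\<lambda>k. 2 * \<gamma> * B\<^sup>2 * \<rho> k) \<longlonglongrightarrow> 0"
    by (intro tendsto_mult_right_zero; assumption)+
  have "\<forall>\<^sub>F k in sequentially. B * \<rho> k < 1/2" "\<forall>\<^sub>F k in sequentially. 2 * \<gamma> * B\<^sup>2 * \<rho> k < e / 2"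
    using order_tendstoD(2)[OF lims(1), of "1/2"] order_tendstoD(2)[OF lims(2), of "e / 2"] e by simp_all
  moreover have "\<forall>\<^sub>F k in sequentially. \<bar>s k - real k * \<mu> - \<sigma> * b k\<bar> \<le> c * \<bar>sqrt (real k * ln (ln (real k)))\<bar>"
    using landau_o.smallD[OF approx c(1)] by simp
  ultimately show ?thesis using eventually_ge_at_top[of 27]
  proof eventually_elim
    case (elim k)
    define g where "g = sqrt (real k * ln (ln (real k)))"
    define u where "u = s k - real k * \<mu> - \<sigma> * b k"
    define x where "x = s k / (real k * \<mu>) - 1"
    have k: "real k > 0" using elim by simp
    have LL: "ln (ln (real k)) \<ge> 1" using elim by (intro ln_ln_ge_1)
    have g0: "g \<ge> 0" using LL by (simp add: g_def)
    have g\<rho>: "g / real k = \<rho> k"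
    proof -
      have "g / real k = sqrt (ln (ln (real k))) * (sqrt (real k) / real k)"
        by (simp add: g_def real_sqrt_mult)
      also have "\<dots> = sqrt (ln (ln (real k))) * inverse (sqrt (real k))"
        by (simp only: sqrt_divide_self_eq of_nat_0_le_iff)
      also have "\<dots> = \<rho> k"
        by (simp only: \<rho>_def real_sqrt_divide) (simp only: divide_inverse)
      finally show ?thesis .
    qed
    have \<rho>0: "\<rho> k \<ge> 0" using LL by (simp add: \<rho>_def)
    have u: "\<bar>u\<bar> \<le> c * g" using elim g0 by (simp add: u_def g_def)
    have bk: "\<bar>b k\<bar> \<le> C * g" using C(2)[of k k] elim by (simp add: g_def)
    have x_eq: "x = (\<sigma> * b k + u) / (real k * \<mu>)"
      using k mu_pos by (simp add: x_def u_def field_simps)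
    have "\<bar>\<sigma> * b k + u\<bar> \<le> \<sigma> * \<bar>b k\<bar> + \<bar>u\<bar>"
      using sigma_pos abs_triangle_ineq[of "\<sigma> * b k" u] by (simp add: abs_mult)
    also have "\<dots> \<le> \<sigma> * (C * g) + \<sigma> * g"
    proof (rule add_mono)
      show "\<sigma> * \<bar>b k\<bar> \<le> \<sigma> * (C * g)" using bk sigma_pos by (intro mult_left_mono) auto
      show "\<bar>u\<bar> \<le> \<sigma> * g" using u mult_right_mono[OF c(2) g0] by linarith
    qed
    also have "\<dots> = (\<sigma> * C + \<sigma>) * g" by (simp add: algebra_simps)
    finally have "\<bar>x\<bar> \<le> (\<sigma> * C + \<sigma>) * g / (real k * \<mu>)"
      unfolding x_eq using k mu_pos by (simp add: abs_divide abs_mult divide_right_mono)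
    also have "\<dots> = B * \<rho> k" by (simp add: B_def g\<rho>[symmetric])
    finally have x: "\<bar>x\<bar> \<le> B * \<rho> k" .
    then have "\<bar>x\<bar> \<le> 1/2" using elim by linarith
    then have "\<bar>ln (1 + x) - x\<bar> \<le> 2 * x\<^sup>2" by (rule abs_ln_one_plus_x_minus_x_bound)
    also have "\<dots> \<le> 2 * (B * \<rho> k)\<^sup>2" using x power_mono[of "\<bar>x\<bar>" "B * \<rho> k" 2] by simp
    finally have "\<gamma> * \<bar>ln (1 + x) - x\<bar> \<le> \<gamma> * (2 * (B * \<rho> k)\<^sup>2)"
      using gamma_pos by (intro mult_left_mono) auto
    also have "\<dots> = (2 * \<gamma> * B\<^sup>2 * \<rho> k) * \<rho> k" by (simp add: power2_eq_square algebra_simps)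
    also have "\<dots> \<le> e / 2 * \<rho> k" using elim \<rho>0 by (intro mult_right_mono) auto
    finally have 1: "\<bar>\<gamma> * (ln (1 + x) - x)\<bar> \<le> e / 2 * \<rho> k" using gamma_pos by (simp add: abs_mult)
    have "\<bar>u / (\<sigma> * real k)\<bar> \<le> c * g / (\<sigma> * real k)"
      using u sigma_pos k by (simp add: abs_divide abs_mult divide_right_mono)
    also have "\<dots> = c / \<sigma> * \<rho> k" by (simp add: g\<rho>[symmetric])
    also have "\<dots> \<le> e / 2 * \<rho> k" using c \<rho>0 by (intro mult_right_mono) auto
    finally have 2: "\<bar>u / (\<sigma> * real k)\<bar> \<le> e / 2 * \<rho> k" .
    have "\<gamma> * x = b k / real k + u / (\<sigma> * real k)"
      unfolding x_eq gamma using k mu_pos sigma_pos by (simp add: field_simps)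
    moreover have "1 + x = s k / (real k * \<mu>)" by (simp add: x_def)
    ultimately have "\<gamma> * ln (s k / (real k * \<mu>)) - b k / real k = u / (\<sigma> * real k) + \<gamma> * (ln (1 + x) - x)"
      by (simp add: algebra_simps)
    then show ?case using 1 2 unfolding \<rho>_def[symmetric] by linarith
  qed
qed

text \<open>Summing the absolute errors over all k \<le> n makes the bound uniform in K. Since 1 /
  sqrt k sums to at most 2 sqrt n, the errors beyond a fixed index are at most e/2 times the
  normalisation; the finitely many earlier ones vanish as the normalisation grows.\<close>

lemma log_product_approx:
  assumes e: "e > 0"
  shows "\<forall>\<^sub>F n in sequentially. \<forall>K\<le>n. \<bar>\<gamma> / lil_norm n * (\<Sum>k\<in>{1..K}. ln (s k / (real k * \<mu>)))
     - (\<Sum>k\<in>{1..K}. b k / lil_norm n / real k)\<bar> < e"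
proof -
  define d where "d k = \<gamma> * ln (s k / (real k * \<mu>)) - b k / real k" for k
  obtain K0 where K0: "\<And>k. k \<ge> K0 \<Longrightarrow> \<bar>d k\<bar> \<le> e / 4 * sqrt (ln (ln (real k)) / real k)"
    using log_factor_approx[of "e / 4"] e unfolding d_def eventually_sequentially by auto
  define C0 where "C0 = (\<Sum>k\<in>{1..<max K0 27}. \<bar>d k\<bar>)"
  have "\<forall>\<^sub>F n in sequentially. 4 * (C0 + 1) / e \<le> lil_norm n"
    using lil_norm_at_top unfolding filterlim_at_top by blast
  then show ?thesis using eventually_ge_at_top[of 27]
  proof eventually_elim
    case (elim n)
    have a: "lil_norm n > 0" using elim by (intro lil_norm_pos)
    have LL: "ln (ln (real n)) \<ge> 1" using elim by (intro ln_ln_ge_1)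
    have C0: "C0 < e / 2 * lil_norm n"
    proof -
      have "C0 + 1 \<le> e / 4 * lil_norm n" using elim e by (simp add: field_simps)
      moreover have "e / 4 * lil_norm n \<le> e / 2 * lil_norm n" using a e by (intro mult_right_mono) auto
      ultimately show ?thesis by linarith
    qed
    show ?case
    proof (intro allI impI)
      fix K assume K: "K \<le> n"
      have dk: "\<bar>d k\<bar> \<le> (if k < max K0 27 then \<bar>d k\<bar> else 0) + e / 4 * sqrt (ln (ln (real n))) * (1 / sqrt (real k))"
        if "k \<in> {1..n}" for k
      proof (cases "k < max K0 27")
        case True
        then show ?thesis using LL e by simp
      next
        case False
        then have "\<bar>d k\<bar> \<le> e / 4 * sqrt (ln (ln (real k)) / real k)" by (intro K0) simp
        also have "\<dots> \<le> e / 4 * sqrt (ln (ln (real n)) / real k)"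
          using False that e by (intro mult_left_mono real_sqrt_le_mono divide_right_mono ln_ln_mono) auto
        finally show ?thesis using False by (simp add: real_sqrt_divide)
      qed
      have "\<bar>\<Sum>k\<in>{1..K}. d k\<bar> \<le> (\<Sum>k\<in>{1..K}. \<bar>d k\<bar>)" by (rule sum_abs)
      also have "\<dots> \<le> (\<Sum>k\<in>{1..n}. \<bar>d k\<bar>)" using K by (intro sum_mono2) auto
      also have "\<dots> \<le> (\<Sum>k\<in>{1..n}. (if k < max K0 27 then \<bar>d k\<bar> else 0) + e / 4 * sqrt (ln (ln (real n))) * (1 / sqrt (real k)))"
        by (rule sum_mono) (rule dk)
      also have "\<dots> = (\<Sum>k\<in>{1..n}. if k < max K0 27 then \<bar>d k\<bar> else 0) + e / 4 * sqrt (ln (ln (real n))) * (\<Sum>k\<in>{1..n}. 1 / sqrt (real k))"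
        by (simp only: sum.distrib sum_distrib_left)
      also have "(\<Sum>k\<in>{1..n}. if k < max K0 27 then \<bar>d k\<bar> else 0) \<le> C0"
      proof -
        have "(\<Sum>k\<in>{1..n}. if k < max K0 27 then \<bar>d k\<bar> else 0) = (\<Sum>k\<in>{k\<in>{1..n}. k < max K0 27}. \<bar>d k\<bar>)"
          by (rule sum.inter_filter[symmetric]) simp
        also have "\<dots> \<le> C0" unfolding C0_def by (intro sum_mono2) auto
        finally show ?thesis .
      qed
      also have "e / 4 * sqrt (ln (ln (real n))) * (\<Sum>k\<in>{1..n}. 1 / sqrt (real k)) \<le> e / 4 * sqrt (ln (ln (real n))) * (2 * sqrt (real n))"
        using LL e by (intro mult_left_mono sum_inverse_sqrt_le) auto
      also have "\<dots> = e / 2 * sqrt (real n * ln (ln (real n)))" by (simp add: real_sqrt_mult)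
      also have "\<dots> \<le> e / 2 * lil_norm n"
        using LL e unfolding lil_norm_def by (intro mult_left_mono real_sqrt_le_mono) auto
      finally have "\<bar>\<Sum>k\<in>{1..K}. d k\<bar> < e * lil_norm n" using C0 by simp
      then have "\<bar>(\<Sum>k\<in>{1..K}. d k) / lil_norm n\<bar> < e"
        using a by (simp add: abs_divide pos_divide_less_eq)
      moreover have "(\<Sum>k\<in>{1..K}. d k) / lil_norm n = \<gamma> / lil_norm n * (\<Sum>k\<in>{1..K}. ln (s k / (real k * \<mu>)))
         - (\<Sum>k\<in>{1..K}. b k / lil_norm n / real k)"
        by (simp add: d_def sum_subtractf sum_divide_distrib sum_distrib_left diff_divide_distrib mult.commute)
      ultimately show "\<bar>\<gamma> / lil_norm n * (\<Sum>k\<in>{1..K}. ln (s k / (real k * \<mu>)))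
         - (\<Sum>k\<in>{1..K}. b k / lil_norm n / real k)\<bar> < e" by (simp only:)
    qed
  qed
qed

lemma prod_fun_eq_exp:
  "prod_fun \<mu> \<gamma> s n t = exp (\<gamma> / lil_norm n * (\<Sum>k\<in>{1..nat \<lfloor>real n * t\<rfloor>}. ln (s k / (real k * \<mu>))))"
proof -
  have pos: "0 < s k / (real k * \<mu>)" if "k \<in> {1..m}" for k m
    using that s_pos[of k] mu_pos by simp
  have "(\<Prod>k\<in>{1..m}. s k / (real k * \<mu>)) \<noteq> 0" for m
    by (intro less_imp_neq[symmetric] prod_pos pos)
  moreover have "ln (\<Prod>k\<in>{1..m}. s k / (real k * \<mu>)) = (\<Sum>k\<in>{1..m}. ln (s k / (real k * \<mu>)))" for m
    by (intro ln_prod finite_atLeastAtMost less_imp_neq[symmetric] pos)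
  ultimately show ?thesis 
    unfolding prod_fun_def lil_norm_def[symmetric] powr_def by (simp only: if_False)
qed

lemma product_limit:
  fixes r :: "nat \<Rightarrow> nat"
  assumes r: "strict_mono r" and lim: "rescaled_limit b r f"
  shows "uniform_limit {0..1} (\<lambda>n. prod_fun \<mu> \<gamma> s (r n)) (\<lambda>x. exp (log_average f x)) sequentially"
proof -
  have f: "f \<in> strassen_class" by (rule limit_in_strassen_class[OF r lim])
  have r_top: "filterlim r at_top sequentially" by (rule filterlim_subseq[OF r])
  obtain C where C: "C > 0" "\<And>n k. n \<ge> 27 \<Longrightarrow> k \<le> n \<Longrightarrow> \<bar>b k\<bar> \<le> C * sqrt (real k * ln (ln (real n)))"
    using growth by blast
  define L where "L n t = \<gamma> / lil_norm n * (\<Sum>k\<in>{1..nat \<lfloor>real n * t\<rfloor>}. ln (s k / (real k * \<mu>)))" for n t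
  define Y where "Y n t = (\<Sum>k\<in>{1..nat \<lfloor>real n * t\<rfloor>}. b k / lil_norm n / real k)" for n t
  have r27: "\<forall>\<^sub>F j in sequentially. 27 \<le> r j"
    using r_top unfolding filterlim_at_top by blast
  have Y: "uniform_limit {0..1} (\<lambda>j. Y (r j)) (log_average f) sequentially"
    unfolding Y_def
  proof (rule weighted_sum_limit[OF f r_top, where C=C])
    show "\<forall>\<^sub>F j in sequentially. \<forall>k\<in>{1..r j}. \<bar>b k / lil_norm (r j)\<bar> \<le> C * sqrt (real k / real (r j))"
      using r27 by eventually_elim (use rescaled_bounded[OF C(2) _ _ C(1)] in auto)
    fix e :: real assume "e > 0"
    then have "\<forall>\<^sub>F j in sequentially. \<forall>t\<in>{0..1}. dist (rescaled b (r j) t) (f t) < e"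
      using lim unfolding uniform_limit_iff by blast
    then show "\<forall>\<^sub>F j in sequentially. \<forall>k\<in>{1..r j}. \<bar>b k / lil_norm (r j) - f (real k / real (r j))\<bar> < e"
      using r27
    proof eventually_elim
      case (elim j)
      show ?case
      proof
        fix k assume "k \<in> {1..r j}"
        then have "real k / real (r j) \<in> {0..1}" by (auto simp: divide_simps)
        from elim(1)[rule_format, OF this] show "\<bar>b k / lil_norm (r j) - f (real k / real (r j))\<bar> < e"
          using rescaled_grid[of "r j" k] elim(2) by (simp add: dist_real_def)
      qed
    qed
  qed
  have L: "uniform_limit {0..1} (\<lambda>j. L (r j)) (log_average f) sequentially"
    unfolding uniform_limit_iff
  proof (intro allI impI)
    fix e :: real assume e: "e > 0"
    then have "e / 2 > 0" by simp
    have "\<forall>\<^sub>F j in sequentially. \<forall>t\<in>{0..1}. dist (Y (r j) t) (log_average f t) < e / 2"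
      using Y \<open>e / 2 > 0\<close> unfolding uniform_limit_iff by blast
    moreover have "\<forall>\<^sub>F j in sequentially. \<forall>K\<le>r j. \<bar>\<gamma> / lil_norm (r j) * (\<Sum>k\<in>{1..K}. ln (s k / (real k * \<mu>)))
     - (\<Sum>k\<in>{1..K}. b k / lil_norm (r j) / real k)\<bar> < e / 2"
      by (rule eventually_compose_filterlim[OF log_product_approx[OF \<open>e / 2 > 0\<close>] r_top])
    ultimately show "\<forall>\<^sub>F j in sequentially. \<forall>t\<in>{0..1}. dist (L (r j) t) (log_average f t) < e"
    proof eventually_elim
      case (elim j)
      show ?case
      proof
        fix t :: real assume t: "t \<in> {0..1}"
        have "real (r j) * t \<le> real (r j) * 1" using t by (intro mult_left_mono) auto
        then have "nat \<lfloor>real (r j) * t\<rfloor> \<le> r j" by linarith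
        then have "\<bar>L (r j) t - Y (r j) t\<bar> < e / 2" using elim(2) unfolding L_def Y_def by blast
        moreover have "\<bar>Y (r j) t - log_average f t\<bar> < e / 2" using elim(1) t by (auto simp: dist_real_def)
        ultimately show "dist (L (r j) t) (log_average f t) < e" unfolding dist_real_def by linarith
      qed
    qed
  qed
  have "uniform_limit {0..1} (\<lambda>j t. exp (L (r j) t)) (\<lambda>t. exp (log_average f t)) sequentially"
  \<comment> \<open>The logarithmic averages are at most 2 in absolute value and the approximation
    error is eventually below 1, so all arguments of exp lie in [-3, 3].\<close>
  proof (rule uniform_limit_compose_uniformly_continuous_on[OF L, where B="{-3..3}"])
    show "uniformly_continuous_on {-3..3} (exp :: real \<Rightarrow> real)"
      by (intro compact_uniformly_continuous continuous_intros compact_Icc)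
    have "\<forall>\<^sub>F j in sequentially. \<forall>t\<in>{0..1}. dist (L (r j) t) (log_average f t) < 1"
      using L unfolding uniform_limit_iff by (meson zero_less_one)
    then show "\<forall>\<^sub>F j in sequentially. \<forall>t\<in>{0..1}. L (r j) t \<in> {-3..3}"
    proof eventually_elim
      case (elim j)
      show ?case
      proof
        fix t :: real assume t: "t \<in> {0..1}"
        then have "\<bar>L (r j) t - log_average f t\<bar> < 1" using elim by (simp add: dist_real_def)
        then show "L (r j) t \<in> {-3..3}" using log_average_bounded[OF f t] by (auto simp: abs_le_iff)
      qed
    qed
  qed simp
  then show ?thesis unfolding L_def prod_fun_eq_exp .
qed

lemma subsequence_product_limit:
  fixes r :: "nat \<Rightarrow> nat"
  assumes r: "strict_mono r"
  obtains q f where "strict_mono (q :: nat \<Rightarrow> nat)" "f \<in> strassen_class"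
    "uniform_limit {0..1} (\<lambda>n. prod_fun \<mu> \<gamma> s (r (q n))) (\<lambda>x. exp (log_average f x)) sequentially"
proof -
  obtain q f where q: "strict_mono (q :: nat \<Rightarrow> nat)" and lim: "uniform_limit {0..1} (\<lambda>n. rescaled b (r (q n))) f sequentially"
    using relatively_compact[OF r] by blast
  have rq: "strict_mono (\<lambda>n. r (q n))" using r q by (simp add: strict_mono_def)
  show ?thesis
    using that[OF q limit_in_strassen_class[OF rq lim] product_limit[OF rq lim]] .
qed

lemma product_rel_compact: "rel_compact_seq (\<lambda>m. prod_fun \<mu> \<gamma> s (m + 3))"
  unfolding rel_compact_seq_def
proof (intro allI impI)
  fix r :: "nat \<Rightarrow> nat" assume "strict_mono r"
  then have "strict_mono (\<lambda>n. r n + 3)" by (simp add: strict_mono_def)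
  from subsequence_product_limit[OF this]
  show "\<exists>(q::nat\<Rightarrow>nat) h. strict_mono q \<and> uniform_limit {0..1} (\<lambda>n. prod_fun \<mu> \<gamma> s (r (q n) + 3)) h sequentially"
    by metis
qed

lemma product_limit_points:
  "limit_points (\<lambda>m. prod_fun \<mu> \<gamma> s (m + 3)) = {restrict (\<lambda>x. exp (log_average f x)) {0..1} | f. f \<in> strassen_class}"
proof (intro equalityI subsetI)
  fix k assume "k \<in> limit_points (\<lambda>m. prod_fun \<mu> \<gamma> s (m + 3))"
  then obtain h and r :: "nat \<Rightarrow> nat" where k: "k = restrict h {0..1}" and r: "strict_mono r"
    and lim: "uniform_limit {0..1} (\<lambda>n. prod_fun \<mu> \<gamma> s (r n + 3)) h sequentially"
    unfolding limit_points_def by blast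
  have "strict_mono (\<lambda>n. r n + 3)" using r by (simp add: strict_mono_def)
  then obtain q f where q: "strict_mono (q :: nat \<Rightarrow> nat)" and f: "f \<in> strassen_class"
    and lim': "uniform_limit {0..1} (\<lambda>n. prod_fun \<mu> \<gamma> s (r (q n) + 3)) (\<lambda>x. exp (log_average f x)) sequentially"
    by (rule subsequence_product_limit)
  \<comment> \<open>A further subsequence has a limit of the required form, and limits along
    subsequences agree.\<close>
  have "h x = exp (log_average f x)" if x: "x \<in> {0..1}" for x
  proof -
    have "(\<lambda>n. prod_fun \<mu> \<gamma> s (r n + 3) x) \<longlonglongrightarrow> h x" by (rule tendsto_uniform_limitI[OF lim x])
    then have "(\<lambda>n. prod_fun \<mu> \<gamma> s (r (q n) + 3) x) \<longlonglongrightarrow> h x"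
      using LIMSEQ_subseq_LIMSEQ[OF _ q] by (fastforce simp: o_def)
    then show ?thesis using tendsto_uniform_limitI[OF lim' x] by (rule LIMSEQ_unique)
  qed
  then have "k = restrict (\<lambda>x. exp (log_average f x)) {0..1}" unfolding k by (intro restrict_ext) auto
  then show "k \<in> {restrict (\<lambda>x. exp (log_average f x)) {0..1} | f. f \<in> strassen_class}" using f by blast
next
  fix k assume "k \<in> {restrict (\<lambda>x. exp (log_average f x)) {0..1} | f. f \<in> strassen_class}"
  then obtain f where k: "k = restrict (\<lambda>x. exp (log_average f x)) {0..1}" and f: "f \<in> strassen_class" by blast
  obtain r :: "nat \<Rightarrow> nat" where r: "strict_mono r" and lim: "rescaled_limit b r f"
    using strassen_class_is_limit[OF f] by blast
  \<comment> \<open>The family is indexed by n = m + 3, so the subsequence is started late enough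
    for 3 to be subtracted from its indices.\<close>
  have ge: "r (n + 3) \<ge> 3" for n using strict_mono_imp_increasing[OF r, of "n + 3"] by linarith
  define r' where "r' n = r (n + 3) - 3" for n
  have r'3: "r' n + 3 = r (n + 3)" for n using ge[of n] by (simp add: r'_def)
  have "strict_mono r'"
    unfolding strict_mono_Suc_iff
  proof
    fix n
    have "r (n + 3) < r (Suc n + 3)" using r by (simp add: strict_mono_def)
    then show "r' n < r' (Suc n)" using r'3[of n] r'3[of "Suc n"] by linarith
  qed
  moreover have "uniform_limit {0..1} (\<lambda>n. prod_fun \<mu> \<gamma> s (r' n + 3)) (\<lambda>x. exp (log_average f x)) sequentially"
    unfolding r'3
    by (rule filterlim_compose[OF product_limit[OF r lim] filterlim_add_const_nat_at_top])
  ultimately show "k \<in> limit_points (\<lambda>m. prod_fun \<mu> \<gamma> s (m + 3))"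
    unfolding limit_points_def k by blast
qed

text \<open>Infinitely many values above exp (sqrt 2) + e would, by compactness, produce a function
  of the class with logarithmic average above sqrt 2 at 1. The extremal function, being a limit
  point, shows that the value is attained.\<close>

lemma product_limsup:
  "limsup (\<lambda>n. ereal (prod_fun \<mu> \<gamma> s n 1)) = ereal (exp (sqrt 2))"
proof (rule antisym)
  show "limsup (\<lambda>n. ereal (prod_fun \<mu> \<gamma> s n 1)) \<le> ereal (exp (sqrt 2))"
  proof (rule ereal_le_epsilon2)
    fix e :: real assume e: "e > 0"
    have "\<forall>\<^sub>F n in sequentially. prod_fun \<mu> \<gamma> s n 1 \<le> exp (sqrt 2) + e"
    proof (rule ccontr)
      assume "\<not> (\<forall>\<^sub>F n in sequentially. prod_fun \<mu> \<gamma> s n 1 \<le> exp (sqrt 2) + e)"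
      then have "infinite {n. exp (sqrt 2) + e < prod_fun \<mu> \<gamma> s n 1}"
        by (simp add: not_eventually not_le frequently_cofinite[symmetric] cofinite_eq_sequentially)
      then obtain r :: "nat \<Rightarrow> nat" where r: "strict_mono r" "\<And>n. exp (sqrt 2) + e < prod_fun \<mu> \<gamma> s (r n) 1"
        using infinite_enumerate by blast
      obtain q f where q: "strict_mono (q :: nat \<Rightarrow> nat)" and f: "f \<in> strassen_class"
        and lim: "uniform_limit {0..1} (\<lambda>n. prod_fun \<mu> \<gamma> s (r (q n))) (\<lambda>x. exp (log_average f x)) sequentially"
        using subsequence_product_limit[OF r(1)] .
      have "(\<lambda>n. prod_fun \<mu> \<gamma> s (r (q n)) 1) \<longlonglongrightarrow> exp (log_average f 1)"
        by (rule tendsto_uniform_limitI[OF lim]) simp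
      then have "exp (sqrt 2) + e \<le> exp (log_average f 1)"
        using r(2) by (intro LIMSEQ_le_const) (auto intro: less_imp_le)
      moreover have "exp (log_average f 1) \<le> exp (sqrt 2)" using log_average_le_sqrt2[OF f] by simp
      ultimately show False using e by linarith
    qed
    then show "limsup (\<lambda>n. ereal (prod_fun \<mu> \<gamma> s n 1)) \<le> ereal (exp (sqrt 2)) + ereal e"
      by (intro Limsup_bounded) (simp add: eventually_mono)
  qed
  obtain f where f: "f \<in> strassen_class" "log_average f 1 = sqrt 2" by (rule extremal_function)
  obtain r :: "nat \<Rightarrow> nat" where r: "strict_mono r" and lim: "rescaled_limit b r f"
    using strassen_class_is_limit[OF f(1)] by blast
  have "(\<lambda>n. prod_fun \<mu> \<gamma> s (r n) 1) \<longlonglongrightarrow> exp (sqrt 2)"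
    using tendsto_uniform_limitI[OF product_limit[OF r lim], of 1] f(2) by simp
  then have "limsup (\<lambda>n. ereal (prod_fun \<mu> \<gamma> s (r n) 1)) = ereal (exp (sqrt 2))"
    by (intro lim_imp_Limsup) auto
  then show "ereal (exp (sqrt 2)) \<le> limsup (\<lambda>n. ereal (prod_fun \<mu> \<gamma> s n 1))"
    using limsup_subseq_mono[OF r, of "\<lambda>n. ereal (prod_fun \<mu> \<gamma> s n 1)"] by (simp add: o_def)
qed

end

section \<open>Return to the probability space\<close>

lemma (in gaussian_sequence) AE_strassen_path: "AE \<omega> in M. strassen_path (walk \<omega>)"
proof -
  have upper: "AE \<omega> in M. \<forall>cs. \<forall>q. block_upper (walk \<omega>) cs (1 / real (Suc q))"
    unfolding AE_all_countable
    by (intro allI AE_impI AE_block_combination_upper[OF _ refl]) auto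
  have lower: "AE \<omega> in M. \<forall>cs. \<forall>q. block_lower (walk \<omega>) cs (1 / real (Suc q))"
    unfolding AE_all_countable
    by (intro allI AE_impI AE_block_combination_lower) auto
  show ?thesis
    using AE_dyadic_increments upper lower
  proof eventually_elim
    case (elim \<omega>)
    show ?case
    proof
      show "walk \<omega> 0 = 0" by (simp add: walk_def)
      show "dyadic_bound (walk \<omega>)" unfolding dyadic_bound_def by (rule elim(1))
    qed (use elim(2,3) in blast)+
  qed
qed

text \<open>Independence is given for finitely many consecutive increments. It extends to the whole
  sequence because independence of a family is tested on finite index sets, and each lies in an
  initial segment.\<close>

lemma wiener_unit_increments:
  assumes W: "standard_wiener M W"
  shows "gaussian_sequence M (\<lambda>i \<omega>. W (real (Suc i)) \<omega> - W (real i) \<omega>)"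
proof -
  interpret prob_space M using W unfolding standard_wiener_def by (elim conjE)
  have "\<forall>(ts::nat \<Rightarrow> real) n. 0 \<le> ts 0 \<and> (\<forall>i<n. ts i < ts (Suc i)) \<longrightarrow>
      indep_vars (\<lambda>_. borel) (\<lambda>i \<omega>. W (ts (Suc i)) \<omega> - W (ts i) \<omega>) {..<n}"
    using W unfolding standard_wiener_def by (elim conjE)
  from this[rule_format, of real]
  have ind_n: "indep_vars (\<lambda>_. borel) (\<lambda>i \<omega>. W (real (Suc i)) \<omega> - W (real i) \<omega>) {..<n}" for n
    by simp
  have dist: "\<forall>s t. 0 \<le> s \<and> s < t \<longrightarrow>
      distributed M lborel (\<lambda>\<omega>. W t \<omega> - W s \<omega>) (normal_density 0 (sqrt (t - s)))"
    using W unfolding standard_wiener_def by (elim conjE)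
  show ?thesis
  proof
    show "indep_vars (\<lambda>_. borel) (\<lambda>i \<omega>. W (real (Suc i)) \<omega> - W (real i) \<omega>) UNIV"
      unfolding indep_vars_def2
    proof (intro conjI ballI)
      fix i :: nat
      show "random_variable borel (\<lambda>\<omega>. W (real (Suc i)) \<omega> - W (real i) \<omega>)"
        using ind_n[of "Suc i"] unfolding indep_vars_def2 by blast
    next
      show "indep_sets (\<lambda>i. {(\<lambda>\<omega>. W (real (Suc i)) \<omega> - W (real i) \<omega>) -` A \<inter> space M |A. A \<in> sets borel}) UNIV"
        unfolding indep_sets_finite_index_sets[of _ UNIV]
      proof (intro allI impI)
        fix J :: "nat set" assume "finite J"
        then obtain n where "J \<subseteq> {..<n}" using finite_nat_iff_bounded by auto
        from indep_vars_subset[OF ind_n this]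
        show "indep_sets (\<lambda>i. {(\<lambda>\<omega>. W (real (Suc i)) \<omega> - W (real i) \<omega>) -` A \<inter> space M |A. A \<in> sets borel}) J"
          unfolding indep_vars_def2 by blast
      qed
    qed
    fix i :: nat
    have "distributed M lborel (\<lambda>\<omega>. W (real (Suc i)) \<omega> - W (real i) \<omega>) (normal_density 0 (sqrt (real (Suc i) - real i)))"
      by (rule dist[rule_format]) simp
    then show "distributed M lborel (\<lambda>\<omega>. W (real (Suc i)) \<omega> - W (real i) \<omega>) std_normal_density" by simp
  qed
qed

theorem theorem1p2:
  fixes M :: "'a measure" and S :: "nat \<Rightarrow> 'a \<Rightarrow> real" and W :: "real \<Rightarrow> 'a \<Rightarrow> real"
    and \<mu> \<sigma> \<gamma> :: real
  assumes W: "standard_wiener M W"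
    and S_rv: "\<And>k. k \<ge> 1 \<Longrightarrow> S k \<in> borel_measurable M"
    and S_pos: "\<And>k \<omega>. k \<ge> 1 \<Longrightarrow> \<omega> \<in> space M \<Longrightarrow> S k \<omega> > 0"
    and mu_pos: "\<mu> > 0" and sigma_pos: "\<sigma> > 0"
    and approx: "AE \<omega> in M. (\<lambda>n. S n \<omega> - real n * \<mu> - \<sigma> * W (real n) \<omega>)
                   \<in> o(\<lambda>n. sqrt (real n * ln (ln (real n))))"
    and gamma: "\<gamma> = \<mu> / \<sigma>"
  shows "AE \<omega> in M.
      rel_compact_seq (\<lambda>m. prod_fun \<mu> \<gamma> (\<lambda>k. S k \<omega>) (m + 3)) \<and>
      limit_points (\<lambda>m. prod_fun \<mu> \<gamma> (\<lambda>k. S k \<omega>) (m + 3)) =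
        {restrict (\<lambda>x. exp (LINT u:{0..x}|lborel. f u / u)) {0..1} | f. f \<in> strassen_class} \<and>
      limsup (\<lambda>n. ereal ((\<Prod>k\<in>{1..n}. S k \<omega> / (real k * \<mu>))
                   powr (\<gamma> / sqrt (2 * real n * ln (ln (real n))))))
        = ereal (exp (sqrt 2))"
proof -
  interpret G: gaussian_sequence M "\<lambda>i \<omega>. W (real (Suc i)) \<omega> - W (real i) \<omega>"
    by (rule wiener_unit_increments[OF W])
  have W0: "AE \<omega> in M. W 0 \<omega> = 0" using W unfolding standard_wiener_def by (elim conjE)
  show ?thesis
    using G.AE_strassen_path approx W0 AE_space
  proof eventually_elim
    case (elim \<omega>)
    \<comment> \<open>The unit increments telescope to W(n) - W(0), and W(0) = 0 holds at this
      \<omega>.\<close>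
    have walk: "G.walk \<omega> n = W (real n) \<omega>" for n
      using sum_lessThan_telescope[of "\<lambda>i. W (real i) \<omega>" n] elim(3) unfolding G.walk_def by (simp del: of_nat_Suc)
    interpret strassen_product "G.walk \<omega>" "\<lambda>k. S k \<omega>" \<mu> \<sigma> \<gamma>
    proof (intro strassen_product.intro strassen_product_axioms.intro)
      show "strassen_path (G.walk \<omega>)" by (rule elim(1))
      show "(\<lambda>n. S n \<omega> - real n * \<mu> - \<sigma> * G.walk \<omega> n) \<in> o(\<lambda>n. sqrt (real n * ln (ln (real n))))"
        unfolding walk by (rule elim(2))
    qed (use S_pos elim(4) mu_pos sigma_pos gamma in auto)
    have "prod_fun \<mu> \<gamma> (\<lambda>k. S k \<omega>) n 1 = (\<Prod>k\<in>{1..n}. S k \<omega> / (real k * \<mu>))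
        powr (\<gamma> / sqrt (2 * real n * ln (ln (real n))))" for n
      by (simp add: prod_fun_def)
    then show ?case
      using product_rel_compact product_limit_points product_limsup
      by (simp only: log_average_def simp_thms)
  qed
qed

end
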